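(* Let $m,t,d$ be positive integers with $d>1$ and $t\mid m$, let $G=G(m,t,d)$ and let $\theta$ be the associated basic polynomial map. The category $\mathfrak H$ of Hilbert modules over $\mathcal A(\theta(\mathbb D^d))$ is strictly larger than the category $\mathfrak C$ of cramped Hilbert modules over $\mathcal A(\theta(\mathbb D^d))$; that is, there is a Hilbert module over $\mathcal A(\theta(\mathbb D^d))$ that is not similar to any contractive Hilbert module over $\mathcal A(\theta(\mathbb D^d))$.
   Context: $G(m,t,d)$ is the finite group of unitaries $(z_1,\dots,z_d)\mapsto(e^{2\pi i\nu_1/m}z_{\sigma(1)},\dots,e^{2\pi i\nu_d/m}z_{\sigma(d)})$, where $\sigma$ is a permutation of $\{1,\dots,d\}$ and $\nu_i$ are integers whose sum is divisible by $t$. Its basic polynomial map is $\theta=(\theta_1,\dots,\theta_d)$, $\theta_i(z)=E_i(z_1^m,\dots,z_d^m)$ for $1\le i\le d-1$ ($E_i$ the elementary symmetric polynomials) and $\theta_d(z)=(z_1\cdots z_d)^{m/t}$. $\mathcal A(\theta(\mathbb D^d))$ is the uniform algebra of functions holomorphic in $\theta(\mathbb D^d)$ and continuous on its closure. A Hilbert module over a function algebra $\mathcal A$ is a Hilbert space $\mathcal H$ that is a module over $\mathcal A$ such that $(a,h)\mapsto a\cdot h$ is continuous; it is contractive if $\|a\cdot h\|\le\|a\|\|h\|$ for all $a\in\mathcal A$, $h\in\mathcal H$. A module map is a bounded linear map commuting with the action; two modules are similar if there is an invertible module map between them; a Hilbert module is cramped if it is similar to a contractive Hilbert module. *)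

theory Defs
  imports "HOL-Analysis.Analysis" "HOL-Algebra.Module"
begin

section \<open>Complex Hilbert spaces\<close>

definition complex_ring :: "complex ring" where
  "complex_ring = \<lparr>carrier = UNIV, mult = (*), one = 1, zero = 0, add = (+)\<rparr>"

lemma complex_ring_simps [simp]:
  "carrier complex_ring = UNIV" "mult complex_ring = (*)" "one complex_ring = 1"
  "zero complex_ring = 0" "add complex_ring = (+)"
  by (simp_all add: complex_ring_def)

lemma cring_complex_ring: "cring complex_ring"
proof (rule cringI)
  show "abelian_group complex_ring"
    by (rule abelian_groupI) (auto intro: exI[of _ "- x" for x] simp: ac_simps)
  show "comm_monoid complex_ring"
    by (rule comm_monoidI) auto
qed (auto simp: algebra_simps)

text \<open>
  Hilbert spaces are carrier-based, so that one can quantify over them. Carriers inside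
  \<^typ>\<open>nat \<Rightarrow> complex\<close> realise, up to isomorphism, all Hilbert spaces whose cardinality is at most
  that of the continuum, in particular all separable ones. The \<^const>\<open>mult\<close> and
  \<^const>\<open>one\<close> fields, which the library's record of modules inherits from that of rings, carry no
  meaning.
\<close>

record 'h hspace = "(complex, 'h) module" +
  cinner :: "'h \<Rightarrow> 'h \<Rightarrow> complex"

definition hnorm :: "('h, 'z) hspace_scheme \<Rightarrow> 'h \<Rightarrow> real" where
  "hnorm H x = sqrt (Re (cinner H x x))"

text \<open>
  The locale \<^locale>\<open>Metric_space\<close> demands symmetry and nonnegativity of the distance also outside the
  carrier; hence the value \<open>0\<close> there.
\<close>

definition hdist :: "('h, 'z) hspace_scheme \<Rightarrow> 'h \<Rightarrow> 'h \<Rightarrow> real" where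
  "hdist H x y = (if x \<in> carrier H \<and> y \<in> carrier H then hnorm H (x \<ominus>\<^bsub>H\<^esub> y) else 0)"

locale hilbert_space = Module.module complex_ring H
  for H :: "('h, 'z) hspace_scheme" (structure) +
  assumes cinner_add_left:
      "\<lbrakk>x \<in> carrier H; y \<in> carrier H; z \<in> carrier H\<rbrakk>
        \<Longrightarrow> cinner H (x \<oplus> y) z = cinner H x z + cinner H y z"
    and cinner_smult_left:
      "\<lbrakk>x \<in> carrier H; y \<in> carrier H\<rbrakk> \<Longrightarrow> cinner H (c \<odot> x) y = c * cinner H x y"
    and cinner_commute:
      "\<lbrakk>x \<in> carrier H; y \<in> carrier H\<rbrakk> \<Longrightarrow> cinner H y x = cnj (cinner H x y)"
    and cinner_nonneg: "x \<in> carrier H \<Longrightarrow> 0 \<le> Re (cinner H x x)"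
    and cinner_definite: "\<lbrakk>x \<in> carrier H; cinner H x x = 0\<rbrakk> \<Longrightarrow> x = \<zero>"
    and complete: "Metric_space.mcomplete (carrier H) (hdist H)"
begin

lemma cinner_add_right:
  "\<lbrakk>x \<in> carrier H; y \<in> carrier H; z \<in> carrier H\<rbrakk>
    \<Longrightarrow> cinner H x (y \<oplus> z) = cinner H x y + cinner H x z"
  by (metis M.a_closed cinner_add_left cinner_commute complex_cnj_add)

lemma cinner_smult_right:
  "\<lbrakk>x \<in> carrier H; y \<in> carrier H\<rbrakk> \<Longrightarrow> cinner H x (c \<odot> y) = cnj c * cinner H x y"
proof -
  assume xy: "x \<in> carrier H" "y \<in> carrier H"
  hence "c \<odot> y \<in> carrier H" by simp
  thus ?thesis
    using xy cinner_smult_left[of y x c] cinner_commute by (metis complex_cnj_mult)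
qed

lemma cinner_self: "x \<in> carrier H \<Longrightarrow> cinner H x x = complex_of_real ((hnorm H x)\<^sup>2)"
proof -
  assume x: "x \<in> carrier H"
  have "Im (cinner H x x) = 0" using cinner_commute[OF x x] by (metis Reals_cnj_iff complex_is_Real_iff)
  thus ?thesis using cinner_nonneg[OF x] by (simp add: hnorm_def complex_eq_iff)
qed

lemma hnorm_nonneg: "x \<in> carrier H \<Longrightarrow> 0 \<le> hnorm H x"
  by (simp add: hnorm_def cinner_nonneg)

lemma cinner_zero_right: "x \<in> carrier H \<Longrightarrow> cinner H x \<zero> = 0"
  using cinner_add_right[of x \<zero> \<zero>] by simp

lemma hnorm_eq_0_iff: "x \<in> carrier H \<Longrightarrow> hnorm H x = 0 \<longleftrightarrow> x = \<zero>"
  by (metis M.zero_closed cinner_definite cinner_self cinner_zero_right hnorm_def of_real_0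
      real_sqrt_zero zero_complex.simps(1) zero_power2)

lemma hnorm_smult: "x \<in> carrier H \<Longrightarrow> hnorm H (c \<odot> x) = cmod c * hnorm H x"
proof -
  assume x: "x \<in> carrier H"
  have "cinner H (c \<odot> x) (c \<odot> x) = (c * cnj c) * cinner H x x"
    using x by (simp add: cinner_smult_left cinner_smult_right)
  also have "\<dots> = complex_of_real ((cmod c)\<^sup>2 * (hnorm H x)\<^sup>2)"
    using x by (simp add: cinner_self flip: complex_norm_square)
  finally have "hnorm H (c \<odot> x) = sqrt ((cmod c * hnorm H x)\<^sup>2)"
    by (simp add: hnorm_def power_mult_distrib)
  thus ?thesis using x by (simp add: hnorm_nonneg)
qed

lemma Cauchy_Schwarz:
  assumes x: "x \<in> carrier H" and y: "y \<in> carrier H"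
  shows "cmod (cinner H x y) \<le> hnorm H x * hnorm H y"
proof (cases "y = \<zero>")
  case True
  then show ?thesis using x by (simp add: cinner_zero_right hnorm_nonneg)
next
  case False
  define a where "a = cinner H x y"
  define n where "n = hnorm H y"
  have n: "n > 0" using False y hnorm_eq_0_iff hnorm_nonneg n_def
    by (metis less_eq_real_def)
  define c where "c = - a / complex_of_real (n\<^sup>2)"
  have yx: "cinner H y x = cnj a" using cinner_commute[OF x y] by (simp add: a_def)
  have "cinner H (x \<oplus> c \<odot> y) (x \<oplus> c \<odot> y)
      = cinner H x x + cnj c * a + c * cnj a + c * cnj c * cinner H y y"
    using x y by (simp add: cinner_add_left cinner_add_right cinner_smult_left cinner_smult_right
        a_def[symmetric] yx algebra_simps)
  also have "\<dots> = cinner H x x - a * cnj a / complex_of_real (n\<^sup>2)"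
    using n y by (simp add: cinner_self n_def[symmetric] c_def field_simps power2_eq_square)
  also have "\<dots> = complex_of_real ((hnorm H x)\<^sup>2 - (cmod a)\<^sup>2 / n\<^sup>2)"
    using x by (simp add: cinner_self flip: complex_norm_square)
  finally have "0 \<le> (hnorm H x)\<^sup>2 - (cmod a)\<^sup>2 / n\<^sup>2"
    using cinner_nonneg[of "x \<oplus> c \<odot> y"] x y by simp
  hence "(cmod a)\<^sup>2 \<le> (hnorm H x * n)\<^sup>2"
    using n by (simp add: field_simps)
  hence "cmod a \<le> hnorm H x * n"
    by (rule power2_le_imp_le) (use n x in \<open>simp add: hnorm_nonneg\<close>)
  thus ?thesis by (simp add: a_def n_def)
qed

lemma hnorm_triangle:
  assumes x: "x \<in> carrier H" and y: "y \<in> carrier H"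
  shows "hnorm H (x \<oplus> y) \<le> hnorm H x + hnorm H y"
proof -
  have "complex_of_real ((hnorm H (x \<oplus> y))\<^sup>2)
      = cinner H x x + (cinner H x y + cnj (cinner H x y)) + cinner H y y"
    using x y cinner_self[of "x \<oplus> y"] cinner_commute[OF x y]
    by (simp add: cinner_add_left cinner_add_right add_ac)
  also have "\<dots> = complex_of_real ((hnorm H x)\<^sup>2 + 2 * Re (cinner H x y) + (hnorm H y)\<^sup>2)"
    using x y by (simp add: cinner_self complex_add_cnj)
  finally have "(hnorm H (x \<oplus> y))\<^sup>2 = (hnorm H x)\<^sup>2 + 2 * Re (cinner H x y) + (hnorm H y)\<^sup>2"
    using of_real_eq_iff by blast
  also have "\<dots> \<le> (hnorm H x)\<^sup>2 + 2 * (hnorm H x * hnorm H y) + (hnorm H y)\<^sup>2"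
    using Cauchy_Schwarz[OF x y] complex_Re_le_cmod[of "cinner H x y"] by simp
  also have "\<dots> = (hnorm H x + hnorm H y)\<^sup>2" by (simp add: power2_sum)
  finally show ?thesis using x y by (meson add_nonneg_nonneg hnorm_nonneg power2_le_imp_le)
qed

lemma cinner_minus_left:
  assumes "x \<in> carrier H" "y \<in> carrier H"
  shows "cinner H (\<ominus> x) y = - cinner H x y"
proof -
  have "cinner H \<zero> y = 0"
    using cinner_commute[of y \<zero>] cinner_zero_right assms by simp
  hence "cinner H (\<ominus> x) y + cinner H x y = 0"
    using cinner_add_left[of "\<ominus> x" x y] assms by (simp add: M.l_neg)
  thus ?thesis by (simp add: eq_neg_iff_add_eq_0)
qed

lemma hnorm_minus: "x \<in> carrier H \<Longrightarrow> hnorm H (\<ominus> x) = hnorm H x"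
proof -
  assume x: "x \<in> carrier H"
  have "cinner H x (\<ominus> x) = - cinner H x x"
    using x cinner_minus_left[of x x] cinner_commute[of "\<ominus> x" x] cinner_commute[of x x] by simp
  thus ?thesis using x by (simp add: hnorm_def cinner_minus_left)
qed

lemma right_minus_eq:
  assumes "x \<in> carrier H" "y \<in> carrier H"
  shows "x \<ominus> y = \<zero> \<longleftrightarrow> x = y"
proof
  assume "x \<ominus> y = \<zero>"
  hence "\<ominus> y = \<ominus> x"
    using assms M.minus_equality[of "\<ominus> y" x] by (simp add: a_minus_def M.a_comm)
  thus "x = y" using assms by (metis M.minus_minus)
qed (use assms in \<open>simp add: a_minus_def M.r_neg\<close>)

lemma Metric_space_hdist: "Metric_space (carrier H) (hdist H)"
proof
  show "0 \<le> hdist H x y" for x y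
    by (simp add: hdist_def hnorm_nonneg)
  show "hdist H x y = hdist H y x" for x y
  proof (cases "x \<in> carrier H \<and> y \<in> carrier H")
    case True
    have "y \<ominus> x = \<ominus> (x \<ominus> y)"
      using True by (simp add: a_minus_def M.minus_add M.a_comm)
    then show ?thesis using True by (simp add: hdist_def hnorm_minus)
  qed (auto simp: hdist_def)
  show "hdist H x y = 0 \<longleftrightarrow> x = y" if "x \<in> carrier H" "y \<in> carrier H" for x y
    using that by (simp add: hdist_def hnorm_eq_0_iff right_minus_eq)
  show "hdist H x z \<le> hdist H x y + hdist H y z"
    if c: "x \<in> carrier H" "y \<in> carrier H" "z \<in> carrier H" for x y z
  proof -
    have "x \<ominus> z = (x \<ominus> y) \<oplus> (y \<ominus> z)"
      using c by (simp add: a_minus_def M.a_assoc M.r_neg1 M.r_neg2)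
    thus ?thesis
      using c hnorm_triangle[of "x \<ominus> y" "y \<ominus> z"] by (simp add: hdist_def)
  qed
qed

end


section \<open>Hilbert modules over function algebras\<close>

text \<open>
  A function on a compact set \<open>X\<close> is represented by the function on the whole type that extends it
  by \<open>0\<close>, so that two elements of an algebra of functions on \<open>X\<close> are equal iff they agree on \<open>X\<close>.
  The locale keeps only what the notion of a Hilbert module needs; uniform closedness and the
  separation of points are not part of it.
\<close>

locale function_algebra =
  fixes X :: "'x::topological_space set" and A :: "('x \<Rightarrow> complex) set"
  assumes compact: "compact X" and nonempty: "X \<noteq> {}"
    and continuous: "f \<in> A \<Longrightarrow> continuous_on X f"
    and support: "\<lbrakk>f \<in> A; x \<notin> X\<rbrakk> \<Longrightarrow> f x = 0"
    and const_closed: "(\<lambda>x. if x \<in> X then c else 0) \<in> A"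
    and add_closed: "\<lbrakk>f \<in> A; g \<in> A\<rbrakk> \<Longrightarrow> (\<lambda>x. f x + g x) \<in> A"
    and mult_closed: "\<lbrakk>f \<in> A; g \<in> A\<rbrakk> \<Longrightarrow> (\<lambda>x. f x * g x) \<in> A"

definition function_ring :: "'x set \<Rightarrow> ('x \<Rightarrow> complex) set \<Rightarrow> ('x \<Rightarrow> complex) ring" where
  "function_ring X A =
    \<lparr>carrier = A, mult = (\<lambda>f g x. f x * g x), one = indicator X,
     zero = (\<lambda>x. 0), add = (\<lambda>f g x. f x + g x)\<rparr>"

definition sup_norm :: "'x set \<Rightarrow> ('x \<Rightarrow> complex) \<Rightarrow> real" where
  "sup_norm X f = (SUP x\<in>X. cmod (f x))"

definition sup_dist ::
  "'x set \<Rightarrow> ('x \<Rightarrow> complex) set \<Rightarrow> ('x \<Rightarrow> complex) \<Rightarrow> ('x \<Rightarrow> complex) \<Rightarrow> real" where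
  "sup_dist X A f g = (if f \<in> A \<and> g \<in> A then sup_norm X (\<lambda>x. f x - g x) else 0)"

context function_algebra
begin

lemma scale_closed: "f \<in> A \<Longrightarrow> (\<lambda>x. c * f x) \<in> A"
proof -
  assume f: "f \<in> A"
  have "(\<lambda>x. (if x \<in> X then c else 0) * f x) = (\<lambda>x. c * f x)"
    using support[OF f] by auto
  thus ?thesis using mult_closed[OF const_closed[of c] f] by simp
qed

lemma cring_function_ring: "cring (function_ring X A)"
proof (rule cringI)
  have zero: "(\<lambda>x. 0) \<in> A"
    using const_closed[of 0] by simp
  have one: "indicator X \<in> A"
    using const_closed[of 1] by (simp add: indicator_def[abs_def] of_bool_def if_distrib cong: if_cong)
  have "\<exists>g\<in>A. (\<lambda>x. g x + f x) = (\<lambda>x. 0)" if "f \<in> A" for f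
    using scale_closed[OF that, of "- 1"] by (intro bexI[of _ "\<lambda>x. - 1 * f x"]) auto
  with zero show "abelian_group (function_ring X A)"
    by (intro abelian_groupI) (auto simp: function_ring_def add_closed add_ac)
  from one show "comm_monoid (function_ring X A)"
    by (intro comm_monoidI)
      (auto simp: function_ring_def mult_closed mult_ac indicator_def support fun_eq_iff)
qed (auto simp: function_ring_def algebra_simps)

lemma cmod_le_sup_norm:
  assumes "continuous_on X f" "x \<in> X"
  shows "cmod (f x) \<le> sup_norm X f"
proof -
  have "bdd_above ((\<lambda>x. cmod (f x)) ` X)"
    using assms compact
    by (intro bounded_imp_bdd_above compact_imp_bounded compact_continuous_image
        continuous_on_norm)
  thus ?thesis unfolding sup_norm_def using assms(2) by (rule cSUP_upper2) auto
qed

lemma sup_norm_le: "(\<And>x. x \<in> X \<Longrightarrow> cmod (f x) \<le> b) \<Longrightarrow> sup_norm X f \<le> b"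
  unfolding sup_norm_def using nonempty by (rule cSUP_least)

lemma Metric_space_sup_dist: "Metric_space A (sup_dist X A)"
proof
  have cont: "continuous_on X (\<lambda>x. f x - g x)" if "f \<in> A" "g \<in> A" for f g
    using that by (intro continuous_on_diff continuous)
  show "0 \<le> sup_dist X A f g" for f g
  proof (cases "f \<in> A \<and> g \<in> A")
    case True
    obtain x where "x \<in> X" using nonempty by auto
    then show ?thesis
      using True cmod_le_sup_norm[OF cont[of f g], of x] norm_ge_zero[of "f x - g x"]
      by (simp add: sup_dist_def del: norm_ge_zero)
  qed (auto simp: sup_dist_def)
  show "sup_dist X A f g = sup_dist X A g f" for f g
    by (simp add: sup_dist_def sup_norm_def norm_minus_commute)
  show "sup_dist X A f g = 0 \<longleftrightarrow> f = g" if fg: "f \<in> A" "g \<in> A" for f g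
  proof
    assume "sup_dist X A f g = 0"
    hence "f x = g x" if "x \<in> X" for x
      using fg cmod_le_sup_norm[OF cont[OF fg] that] by (simp add: sup_dist_def)
    thus "f = g" using support[OF fg(1)] support[OF fg(2)] by fastforce
  next
    assume "f = g"
    thus "sup_dist X A f g = 0" using nonempty by (simp add: sup_dist_def sup_norm_def)
  qed
  show "sup_dist X A f h \<le> sup_dist X A f g + sup_dist X A g h"
    if "f \<in> A" "g \<in> A" "h \<in> A" for f g h
  proof -
    have "sup_norm X (\<lambda>x. f x - h x) \<le> sup_norm X (\<lambda>x. f x - g x) + sup_norm X (\<lambda>x. g x - h x)"
    proof (rule sup_norm_le)
      fix x assume x: "x \<in> X"
      have "cmod (f x - h x) \<le> cmod (f x - g x) + cmod (g x - h x)"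
        using norm_triangle_ineq[of "f x - g x" "g x - h x"] by simp
      also have "\<dots> \<le> sup_norm X (\<lambda>x. f x - g x) + sup_norm X (\<lambda>x. g x - h x)"
        using that x by (intro add_mono cmod_le_sup_norm cont)
      finally show "cmod (f x - h x) \<le> \<dots>" .
    qed
    thus ?thesis using that by (simp add: sup_dist_def)
  qed
qed

end

record ('f, 'h) hmodule = "'h hspace" +
  act :: "'f \<Rightarrow> 'h \<Rightarrow> 'h"

definition action_module :: "('f, 'h, 'z) hmodule_scheme \<Rightarrow> ('f, 'h) module" where
  "action_module H =
    \<lparr>carrier = carrier H, mult = mult H, one = one H, zero = zero H, add = add H, smult = act H\<rparr>"

locale hilbert_module = function_algebra X A + hilbert_space H
  for X :: "'x::topological_space set" and A :: "('x \<Rightarrow> complex) set"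
    and H :: "('x \<Rightarrow> complex, 'h, 'z) hmodule_scheme" (structure) +
  assumes action: "Module.module (function_ring X A) (action_module H)"
    and act_scale_left:
      "\<lbrakk>f \<in> A; x \<in> carrier H\<rbrakk> \<Longrightarrow> act H (\<lambda>z. c * f z) x = c \<odot> act H f x"
    and act_scale_right:
      "\<lbrakk>f \<in> A; x \<in> carrier H\<rbrakk> \<Longrightarrow> act H f (c \<odot> x) = c \<odot> act H f x"
    and act_continuous:
      "continuous_map
        (prod_topology (Metric_space.mtopology A (sup_dist X A))
                       (Metric_space.mtopology (carrier H) (hdist H)))
        (Metric_space.mtopology (carrier H) (hdist H)) (\<lambda>(f, x). act H f x)"

locale contractive_hilbert_module = hilbert_module +
  assumes contractive:
    "\<lbrakk>f \<in> A; x \<in> carrier H\<rbrakk> \<Longrightarrow> hnorm H (act H f x) \<le> sup_norm X f * hnorm H x"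

definition module_map ::
  "('x \<Rightarrow> complex) set \<Rightarrow> ('x \<Rightarrow> complex, 'h, 'y) hmodule_scheme
    \<Rightarrow> ('x \<Rightarrow> complex, 'k, 'z) hmodule_scheme \<Rightarrow> ('h \<Rightarrow> 'k) \<Rightarrow> bool" where
  "module_map A H K T \<longleftrightarrow>
    T \<in> carrier H \<rightarrow> carrier K \<and>
    (\<forall>x\<in>carrier H. \<forall>y\<in>carrier H. T (x \<oplus>\<^bsub>H\<^esub> y) = T x \<oplus>\<^bsub>K\<^esub> T y) \<and>
    (\<forall>c. \<forall>x\<in>carrier H. T (c \<odot>\<^bsub>H\<^esub> x) = c \<odot>\<^bsub>K\<^esub> T x) \<and>
    (\<exists>C. \<forall>x\<in>carrier H. hnorm K (T x) \<le> C * hnorm H x) \<and>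
    (\<forall>f\<in>A. \<forall>x\<in>carrier H. T (act H f x) = act K f (T x))"

definition similar ::
  "('x \<Rightarrow> complex) set \<Rightarrow> ('x \<Rightarrow> complex, 'h, 'y) hmodule_scheme
    \<Rightarrow> ('x \<Rightarrow> complex, 'k, 'z) hmodule_scheme \<Rightarrow> bool" where
  "similar A H K \<longleftrightarrow>
    (\<exists>T S. module_map A H K T \<and> module_map A K H S \<and>
      (\<forall>x\<in>carrier H. S (T x) = x) \<and> (\<forall>y\<in>carrier K. T (S y) = y))"

text \<open>
  A contractive module similar to \<open>H\<close> is only sought among those whose elements have the same type
  as those of \<open>H\<close>. By \<open>crampedI\<close> below, other types would not make a difference.
\<close>

definition cramped ::
  "'x::topological_space set \<Rightarrow> ('x \<Rightarrow> complex) set \<Rightarrow> ('x \<Rightarrow> complex, 'h) hmodule \<Rightarrow> bool" where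
  "cramped X A H \<longleftrightarrow> hilbert_module X A H \<and>
    (\<exists>K :: ('x \<Rightarrow> complex, 'h) hmodule. contractive_hilbert_module X A K \<and> similar A H K)"

lemma crampedI:
  fixes H :: "('x::topological_space \<Rightarrow> complex, 'h) hmodule" and K :: "('x \<Rightarrow> complex, 'k) hmodule"
  assumes H: "hilbert_module X A H" and K: "contractive_hilbert_module X A K"
    and "similar A H K"
  shows "cramped X A H"
proof -
  interpret H: hilbert_module X A H by fact
  interpret K: contractive_hilbert_module X A K by fact
  obtain T S where T: "module_map A H K T" and S: "module_map A K H S"
    and ST: "\<And>x. x \<in> carrier H \<Longrightarrow> S (T x) = x" and TS: "\<And>y. y \<in> carrier K \<Longrightarrow> T (S y) = y"
    using \<open>similar A H K\<close> unfolding similar_def by blast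
  have T_carr: "T x \<in> carrier K" if "x \<in> carrier H" for x
    using T that unfolding module_map_def by blast
  have S_carr: "S y \<in> carrier H" if "y \<in> carrier K" for y
    using S that unfolding module_map_def by blast
  have T_add: "T (x \<oplus>\<^bsub>H\<^esub> y) = T x \<oplus>\<^bsub>K\<^esub> T y" if "x \<in> carrier H" "y \<in> carrier H" for x y
    using T that unfolding module_map_def by blast
  have T_smult: "T (c \<odot>\<^bsub>H\<^esub> x) = c \<odot>\<^bsub>K\<^esub> T x" if "x \<in> carrier H" for c x
    using T that unfolding module_map_def by blast
  have T_act: "T (act H f x) = act K f (T x)" if "f \<in> A" "x \<in> carrier H" for f x
    using T that unfolding module_map_def by blast
  have S_act: "S (act K f y) = act H f (S y)" if "f \<in> A" "y \<in> carrier K" for f y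
    using S that unfolding module_map_def by blast
  obtain C where C: "\<And>x. x \<in> carrier H \<Longrightarrow> hnorm K (T x) \<le> C * hnorm H x"
    using T unfolding module_map_def by blast
  obtain D where D: "\<And>y. y \<in> carrier K \<Longrightarrow> hnorm H (S y) \<le> D * hnorm K y"
    using S unfolding module_map_def by blast
  have T_zero: "T \<zero>\<^bsub>H\<^esub> = \<zero>\<^bsub>K\<^esub>"
  proof -
    have "hnorm H \<zero>\<^bsub>H\<^esub> = 0" by (rule H.hnorm_eq_0_iff[THEN iffD2]) auto
    hence "hnorm K (T \<zero>\<^bsub>H\<^esub>) = 0"
      using C[of "\<zero>\<^bsub>H\<^esub>"] K.hnorm_nonneg[of "T \<zero>\<^bsub>H\<^esub>"] T_carr[OF H.M.zero_closed] by auto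
    thus ?thesis using K.hnorm_eq_0_iff T_carr[OF H.M.zero_closed] by blast
  qed
  have T_minus: "T (x \<ominus>\<^bsub>H\<^esub> y) = T x \<ominus>\<^bsub>K\<^esub> T y" if c: "x \<in> carrier H" "y \<in> carrier H" for x y
  proof -
    have "T (\<ominus>\<^bsub>H\<^esub> y) \<oplus>\<^bsub>K\<^esub> T y = \<zero>\<^bsub>K\<^esub>"
      using c T_add[of "\<ominus>\<^bsub>H\<^esub> y" y] by (simp add: T_zero H.M.l_neg)
    hence "T (\<ominus>\<^bsub>H\<^esub> y) = \<ominus>\<^bsub>K\<^esub> T y"
      using c K.M.minus_equality[of "T (\<ominus>\<^bsub>H\<^esub> y)" "T y"] by (simp add: T_carr)
    thus ?thesis using c by (simp add: a_minus_def T_add)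
  qed

  define L where "L = H\<lparr>cinner := (\<lambda>x y. cinner K (T x) (T y))\<rparr>"
  have [simp]: "carrier L = carrier H" "add L = add H" "zero L = zero H" "mult L = mult H"
    "one L = one H" "smult L = smult H" "act L = act H"
    "cinner L = (\<lambda>x y. cinner K (T x) (T y))" "action_module L = action_module H"
    by (simp_all add: L_def action_module_def)
  have [simp]: "a_minus L = a_minus H"
    by (intro ext) (simp add: a_minus_def a_inv_def m_inv_def)
  have hnorm_L: "hnorm L x = hnorm K (T x)" for x
    by (simp add: hnorm_def)
  have hdist_L: "hdist L x y = hdist K (T x) (T y)" if "x \<in> carrier H" "y \<in> carrier H" for x y
    using that by (simp add: hdist_def hnorm_L T_minus T_carr)
  have "abelian_group L"
    using H.M.abelian_group_axioms
    by (simp add: abelian_group_def abelian_monoid_def abelian_group_axioms_def)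
  hence mod_L: "Module.module complex_ring L"
    by (intro Module.moduleI cring_complex_ring)
      (simp_all add: H.smult_l_distr[simplified] H.smult_r_distr H.smult_assoc1[simplified]
        H.smult_one[simplified])
  have definite: "x = \<zero>\<^bsub>H\<^esub>" if "x \<in> carrier H" "cinner K (T x) (T x) = 0" for x
    using K.cinner_definite[OF T_carr that(2)] that ST[of x] ST[of "\<zero>\<^bsub>H\<^esub>"] T_zero by simp
  have pre: "hilbert_space L" if "Metric_space.mcomplete (carrier H) (hdist L)"
    using mod_L that definite
    by (auto simp: hilbert_space_def hilbert_space_axioms_def T_add T_smult T_carr
        K.cinner_add_left K.cinner_smult_left K.cinner_nonneg intro: K.cinner_commute)

  interpret KM: Metric_space "carrier K" "hdist K" by (rule K.Metric_space_hdist)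
  interpret LM: Metric_space "carrier H" "hdist L"
  proof
    show "0 \<le> hdist L x y" for x y
      by (simp add: hdist_def hnorm_L K.hnorm_nonneg T_carr)
    show "hdist L x y = hdist L y x" for x y
      by (cases "x \<in> carrier H \<and> y \<in> carrier H")
        (auto simp: hdist_L KM.commute, auto simp: hdist_def)
    show "hdist L x y = 0 \<longleftrightarrow> x = y" if "x \<in> carrier H" "y \<in> carrier H" for x y
      using that ST by (metis hdist_L KM.zero T_carr)
    show "hdist L x z \<le> hdist L x y + hdist L y z"
      if "x \<in> carrier H" "y \<in> carrier H" "z \<in> carrier H" for x y z
      using that by (simp add: hdist_L KM.triangle T_carr)
  qed
  have hdist_S: "hdist L (S x) (S y) = hdist K x y" if "x \<in> carrier K" "y \<in> carrier K" for x y
    using that by (simp add: hdist_L S_carr TS)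
  have cont_T: "continuous_map LM.mtopology KM.mtopology T"
    unfolding LM.metric_continuous_map[OF KM.Metric_space_axioms]
    using T_carr hdist_L by fastforce
  have cont_S: "continuous_map KM.mtopology LM.mtopology S"
    unfolding KM.metric_continuous_map[OF LM.Metric_space_axioms]
    using S_carr hdist_S by fastforce
  have complete_L: "LM.mcomplete"
    unfolding LM.mcomplete_def
  proof (intro allI impI)
    fix \<sigma> assume \<sigma>: "LM.MCauchy \<sigma>"
    hence ran: "\<sigma> n \<in> carrier H" for n
      by (auto simp: LM.MCauchy_def)
    have "KM.MCauchy (T \<circ> \<sigma>)"
      using \<sigma> ran by (auto simp: LM.MCauchy_def KM.MCauchy_def T_carr hdist_L)
    then obtain y where "limitin KM.mtopology (T \<circ> \<sigma>) y sequentially"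
      using K.complete unfolding KM.mcomplete_def by blast
    hence "limitin LM.mtopology (S \<circ> (T \<circ> \<sigma>)) (S y) sequentially"
      by (rule continuous_map_limit[OF cont_S])
    moreover have "S \<circ> (T \<circ> \<sigma>) = \<sigma>"
      using ran by (auto simp: ST)
    ultimately show "\<exists>x. limitin LM.mtopology \<sigma> x sequentially" by auto
  qed
  interpret L: hilbert_space L
    by (rule pre) (rule complete_L)

  define TA where "TA = Metric_space.mtopology A (sup_dist X A)"
  have "continuous_map (prod_topology TA LM.mtopology) (prod_topology TA KM.mtopology)
      (\<lambda>p. (fst p, T (snd p)))"
    by (intro continuous_map_pairedI continuous_map_fst
        continuous_map_compose[OF continuous_map_snd cont_T, unfolded o_def])
  from continuous_map_compose[OF this K.act_continuous[folded TA_def]]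
  have "continuous_map (prod_topology TA LM.mtopology) LM.mtopology
      (S \<circ> ((\<lambda>(f, x). act K f x) \<circ> (\<lambda>p. (fst p, T (snd p)))))"
    using cont_S continuous_map_compose by blast
  hence "continuous_map (prod_topology TA LM.mtopology) LM.mtopology (\<lambda>(f, x). act H f x)"
  proof (rule continuous_map_eq)
    fix p assume "p \<in> topspace (prod_topology TA LM.mtopology)"
    then obtain f x where p: "p = (f, x)" "f \<in> topspace TA" "x \<in> carrier H" by auto
    have "topspace TA = A"
      unfolding TA_def by (rule Metric_space.topspace_mtopology[OF H.Metric_space_sup_dist])
    hence "f \<in> A" using p by auto
    hence "S (act K f (T x)) = act H f x"
      using p by (simp add: S_act T_carr ST)
    thus "(S \<circ> ((\<lambda>(f, x). act K f x) \<circ> (\<lambda>p. (fst p, T (snd p))))) p = (\<lambda>(f, x). act H f x) p"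
      by (simp add: p)
  qed
  hence "hilbert_module X A L"
    using H.action H.act_scale_left H.act_scale_right
    by (intro hilbert_module.intro H.function_algebra_axioms L.hilbert_space_axioms hilbert_module_axioms.intro)
      (simp_all add: TA_def)
  moreover have "hnorm L (act L f x) \<le> sup_norm X f * hnorm L x"
    if "f \<in> A" "x \<in> carrier L" for f x
    using that K.contractive[of f "T x"] by (simp add: hnorm_L T_act T_carr)
  ultimately have "contractive_hilbert_module X A L"
    by (intro contractive_hilbert_module.intro contractive_hilbert_module_axioms.intro)
  moreover have "similar A H L"
    unfolding similar_def
  proof (intro exI conjI)
    show "module_map A H L (\<lambda>x. x)"
      unfolding module_map_def using C by (auto simp: hnorm_L)
    have "hnorm H x \<le> D * hnorm L x" if "x \<in> carrier H" for x
      using D[of "T x"] that by (simp add: hnorm_L T_carr ST)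
    thus "module_map A L H (\<lambda>x. x)"
      unfolding module_map_def by auto
  qed auto
  ultimately show ?thesis
    using H unfolding cramped_def by blast
qed


section \<open>The algebra \<open>\<A>(\<Omega>)\<close>\<close>

text \<open>
  The type \<^typ>\<open>complex ^ 'd\<close> is a real normed space, so \<open>has_derivative\<close> alone is real
  differentiability; compatibility with \<open>*s\<close> makes the derivative complex-linear. The notion is meant for
  open \<open>\<Omega>\<close>, where \<open>at z within \<Omega>\<close> is \<open>at z\<close>.
\<close>

definition holomorphic_several :: "(complex ^ 'd \<Rightarrow> complex) \<Rightarrow> (complex ^ 'd) set \<Rightarrow> bool" where
  "holomorphic_several f \<Omega> \<longleftrightarrow>
    (\<forall>z\<in>\<Omega>. \<exists>F. (f has_derivative F) (at z within \<Omega>) \<and> (\<forall>c v. F (c *s v) = c * F v))"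

definition uniform_algebra :: "(complex ^ 'd) set \<Rightarrow> (complex ^ 'd \<Rightarrow> complex) set" where
  "uniform_algebra \<Omega> =
    {f. holomorphic_several f \<Omega> \<and> continuous_on (closure \<Omega>) f \<and> (\<forall>z. z \<notin> closure \<Omega> \<longrightarrow> f z = 0)}"

lemma function_algebra_uniform_algebra:
  assumes "bounded \<Omega>" "\<Omega> \<noteq> {}"
  shows "function_algebra (closure \<Omega>) (uniform_algebra \<Omega>)"
proof
  show "(\<lambda>z. if z \<in> closure \<Omega> then c else 0) \<in> uniform_algebra \<Omega>" for c
  proof -
    have "((\<lambda>z. if z \<in> closure \<Omega> then c else 0) has_derivative (\<lambda>v. 0)) (at z within \<Omega>)"
      if "z \<in> \<Omega>" for z
      using that by (intro has_derivative_transform[OF _ _ has_derivative_const[of c]])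
        (auto intro: closure_subset[THEN subsetD])
    thus ?thesis
      by (auto simp: uniform_algebra_def holomorphic_several_def cong: continuous_on_cong
          intro!: exI[of _ "\<lambda>v. 0"])
  qed
  fix f g assume fg: "f \<in> uniform_algebra \<Omega>" "g \<in> uniform_algebra \<Omega>"
  have diff: "\<exists>F G. (f has_derivative F) (at z within \<Omega>) \<and> (g has_derivative G) (at z within \<Omega>) \<and>
      (\<forall>c v. F (c *s v) = c * F v) \<and> (\<forall>c v. G (c *s v) = c * G v)" if "z \<in> \<Omega>" for z
    using fg that unfolding uniform_algebra_def holomorphic_several_def by blast
  have "holomorphic_several (\<lambda>z. f z + g z) \<Omega>"
    unfolding holomorphic_several_def
  proof
    fix z assume "z \<in> \<Omega>"
    from diff[OF this] obtain F G where
      *: "(f has_derivative F) (at z within \<Omega>)" "(g has_derivative G) (at z within \<Omega>)"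
        "\<forall>c v. F (c *s v) = c * F v" "\<forall>c v. G (c *s v) = c * G v" by blast
    show "\<exists>F. ((\<lambda>z. f z + g z) has_derivative F) (at z within \<Omega>) \<and> (\<forall>c v. F (c *s v) = c * F v)"
      by (intro exI[of _ "\<lambda>v. F v + G v"] conjI has_derivative_add *(1,2))
        (simp add: *(3,4) distrib_left)
  qed
  thus "(\<lambda>z. f z + g z) \<in> uniform_algebra \<Omega>"
    using fg by (auto simp: uniform_algebra_def intro: continuous_on_add)
  have "holomorphic_several (\<lambda>z. f z * g z) \<Omega>"
    unfolding holomorphic_several_def
  proof
    fix z assume "z \<in> \<Omega>"
    from diff[OF this] obtain F G where
      *: "(f has_derivative F) (at z within \<Omega>)" "(g has_derivative G) (at z within \<Omega>)"
        "\<forall>c v. F (c *s v) = c * F v" "\<forall>c v. G (c *s v) = c * G v" by blast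
    show "\<exists>F. ((\<lambda>z. f z * g z) has_derivative F) (at z within \<Omega>) \<and> (\<forall>c v. F (c *s v) = c * F v)"
      by (intro exI[of _ "\<lambda>v. f z * G v + F v * g z"] conjI has_derivative_mult *(1,2))
        (simp add: *(3,4) distrib_left mult_ac)
  qed
  thus "(\<lambda>z. f z * g z) \<in> uniform_algebra \<Omega>"
    using fg by (auto simp: uniform_algebra_def intro: continuous_on_mult)
qed (use assms in \<open>auto simp: uniform_algebra_def\<close>)


section \<open>The group \<open>G(m,t,d)\<close> and its basic polynomial map\<close>

text \<open>
  The dimension \<open>d\<close> is \<open>CARD('d)\<close>. The linear order on the index type numbers the coordinates;
  \<open>coord_num i\<close> ranges from \<open>1\<close> to \<open>d\<close>.
\<close>

definition reflection_group :: "nat \<Rightarrow> nat \<Rightarrow> (complex ^ 'd \<Rightarrow> complex ^ 'd) set" where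
  "reflection_group m t =
    {\<lambda>z. \<chi> i. exp (2 * pi * \<i> * of_int (\<nu> i) / of_nat m) * z $ \<sigma> i | \<sigma> \<nu>.
      bij \<sigma> \<and> int t dvd (\<Sum>i\<in>UNIV. \<nu> i)}"

definition coord_num :: "'d::{finite, linorder} \<Rightarrow> nat" where
  "coord_num i = card {..i}"

lemma bij_betw_coord_num:
  "bij_betw coord_num (UNIV :: 'd::{finite, linorder} set) {1..CARD('d)}"
proof -
  have "strict_mono (coord_num :: 'd \<Rightarrow> nat)"
    unfolding strict_mono_def coord_num_def by (auto intro!: psubset_card_mono)
  hence inj: "inj (coord_num :: 'd \<Rightarrow> nat)"
    by (rule strict_mono_imp_inj_on)
  have sub: "range (coord_num :: 'd \<Rightarrow> nat) \<subseteq> {1..CARD('d)}"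
    by (auto simp: coord_num_def card_mono Suc_le_eq card_gt_0_iff)
  have "range (coord_num :: 'd \<Rightarrow> nat) = {1..CARD('d)}"
    using sub inj by (intro card_subset_eq) (auto simp: card_image)
  with inj show ?thesis by (simp add: bij_betw_def)
qed

definition elem_sym :: "nat \<Rightarrow> complex ^ 'd \<Rightarrow> complex" where
  "elem_sym k x = (\<Sum>S | card S = k. \<Prod>i\<in>S. x $ i)"

definition basic_map ::
  "nat \<Rightarrow> nat \<Rightarrow> complex ^ 'd::{finite, linorder} \<Rightarrow> complex ^ 'd::{finite, linorder}" where
  "basic_map m t z = (\<chi> i.
    if coord_num i < CARD('d) then elem_sym (coord_num i) (\<chi> j. z $ j ^ m)
    else (\<Prod>j\<in>UNIV. z $ j) ^ (m div t))"

lemma elem_sym_permute: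
  assumes "bij \<sigma>"
  shows "elem_sym k (\<chi> j. x $ \<sigma> j) = elem_sym k x"
proof -
  have inj: "inj_on \<sigma> S" for S
    using assms by (meson bij_is_inj inj_on_subset subset_UNIV)
  have "elem_sym k (\<chi> j. x $ \<sigma> j) = (\<Sum>S | card S = k. \<Prod>i\<in>\<sigma> ` S. x $ i)"
    unfolding elem_sym_def by (intro sum.cong) (simp_all add: prod.reindex[OF inj])
  also have "\<dots> = elem_sym k x"
    unfolding elem_sym_def
  proof (rule sum.reindex_bij_betw)
    have "card (\<sigma> -` S) = card S" for S
      using assms by (simp add: card_vimage_inj bij_is_inj bij_is_surj)
    thus "bij_betw ((`) \<sigma>) {S. card S = k} {S. card S = k}"
      using assms inj
      by (intro bij_betw_byWitness[of _ "(-`) \<sigma>"])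
        (auto simp: card_image inj_vimage_image_eq bij_is_inj bij_is_surj surj_image_vimage_eq)
  qed
  finally show ?thesis .
qed

lemma basic_map_invariant:
  assumes "m > 0" "t dvd m" "g \<in> reflection_group m t"
  shows "basic_map m t (g z) = basic_map m t z"
proof -
  from assms(3) obtain \<sigma> \<nu> where \<sigma>: "bij \<sigma>" and \<nu>: "int t dvd (\<Sum>i\<in>UNIV. \<nu> i)"
    and g: "g = (\<lambda>z. \<chi> i. exp (2 * pi * \<i> * of_int (\<nu> i) / of_nat m) * z $ \<sigma> i)"
    unfolding reflection_group_def by auto
  from assms obtain q where q: "m = t * q" by auto
  from \<nu> obtain n where n: "(\<Sum>i\<in>UNIV. \<nu> i) = int t * n" by auto
  have root: "exp (2 * pi * \<i> * of_int k / of_nat m) ^ m = 1" for k :: int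
  proof -
    have "exp (2 * pi * \<i> * of_int k / of_nat m) ^ m = exp (2 * pi * \<i> * of_int k)"
      using assms(1) by (simp flip: exp_of_nat_mult)
    also have "\<dots> = 1" by (simp add: exp_eq_1)
    finally show ?thesis .
  qed
  have "(\<Prod>i\<in>UNIV. g z $ i) = exp (\<Sum>i\<in>UNIV. 2 * pi * \<i> * of_int (\<nu> i) / of_nat m) * (\<Prod>i\<in>UNIV. z $ \<sigma> i)"
    by (simp add: g prod.distrib exp_sum)
  also have "(\<Prod>i\<in>UNIV. z $ \<sigma> i) = (\<Prod>i\<in>UNIV. z $ i)"
    using \<sigma> by (rule prod.reindex_bij_betw)
  also have "(\<Sum>i\<in>UNIV. 2 * pi * \<i> * of_int (\<nu> i) / of_nat m) = 2 * pi * \<i> * of_int (int t * n) / of_nat m"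
    unfolding n[symmetric] by (simp add: sum_distrib_left sum_divide_distrib)
  finally have prod: "(\<Prod>i\<in>UNIV. g z $ i) =
      exp (2 * pi * \<i> * of_int (int t * n) / of_nat m) * (\<Prod>i\<in>UNIV. z $ i)" .
  have "exp (2 * pi * \<i> * of_int (int t * n) / of_nat m) ^ (m div t) = exp (2 * pi * \<i> * of_int n)"
    using assms(1) q by (simp add: field_simps flip: exp_of_nat_mult)
  also have "\<dots> = 1" by (simp add: exp_eq_1)
  finally have last: "(\<Prod>i\<in>UNIV. g z $ i) ^ (m div t) = (\<Prod>i\<in>UNIV. z $ i) ^ (m div t)"
    by (simp add: prod power_mult_distrib)
  have "(\<chi> j. g z $ j ^ m) = (\<chi> j. (\<chi> j. z $ j ^ m) $ \<sigma> j)"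
    unfolding g by (simp only: vec_lambda_beta power_mult_distrib root mult_1)
  hence sym: "elem_sym k (\<chi> j. g z $ j ^ m) = elem_sym k (\<chi> j. z $ j ^ m)" for k
    using elem_sym_permute[OF \<sigma>, of k "\<chi> j. z $ j ^ m"] by simp
  show ?thesis unfolding basic_map_def last sym ..
qed

definition polydisc :: "(complex ^ 'd) set" where
  "polydisc = {z. \<forall>i. cmod (z $ i) < 1}"

lemma function_algebra_basic_map_polydisc:
  fixes m t :: nat and \<Omega> :: "(complex ^ 'd::{finite, linorder}) set"
  defines "\<Omega> \<equiv> basic_map m t ` polydisc"
  shows "function_algebra (closure \<Omega>) (uniform_algebra \<Omega>)"
proof (rule function_algebra_uniform_algebra)
  have "norm z \<le> real CARD('d)" if "z \<in> polydisc" for z :: "(complex, 'd) vec"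
  proof -
    have "norm z \<le> (\<Sum>i\<in>UNIV. norm (z $ i))"
      by (simp add: norm_vec_def L2_set_le_sum)
    also have "\<dots> \<le> (\<Sum>i\<in>(UNIV :: 'd set). 1)"
      using that by (intro sum_mono) (simp add: polydisc_def less_imp_le)
    finally show ?thesis by simp
  qed
  hence "bounded (polydisc :: ((complex, 'd) vec) set)"
    by (rule boundedI)
  hence compact: "compact (closure (polydisc :: ((complex, 'd) vec) set))"
    by simp
  have "continuous_on UNIV (\<lambda>z :: (complex, 'd) vec. basic_map m t z $ i)" for i
    by (cases "coord_num i < CARD('d)")
      (simp_all add: basic_map_def elem_sym_def continuous_intros)
  hence "continuous_on UNIV (basic_map m t :: (complex, 'd) vec \<Rightarrow> (complex, 'd) vec)"
    by (rule continuous_on_vec_lambda[where f = "\<lambda>i z. basic_map m t z $ i", unfolded vec_lambda_eta])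
  hence "continuous_on (closure polydisc) (basic_map m t :: (complex, 'd) vec \<Rightarrow> (complex, 'd) vec)"
    by (rule continuous_on_subset) simp
  hence "bounded (basic_map m t ` closure polydisc :: ((complex, 'd) vec) set)"
    using compact by (intro compact_imp_bounded compact_continuous_image)
  thus "bounded \<Omega>"
    unfolding \<Omega>_def by (rule bounded_subset) (simp add: closure_subset image_mono)
  have "0 \<in> (polydisc :: ((complex, 'd) vec) set)"
    by (simp add: polydisc_def)
  thus "\<Omega> \<noteq> {}"
    unfolding \<Omega>_def by blast
qed

end

theory Submission
  imports Defs "HOL-Complex_Analysis.Complex_Analysis"
begin

text \<open>
  The image \<open>\<Omega>\<close> of the polydisc contains the analytic disc of all points \<open>(0,\<dots>,0,\<lambda>)\<close> with
  \<open>|\<lambda>| < 1\<close>: the powers \<open>z\<^sub>i\<^sup>m\<close> can be chosen to be \<open>\<mu>\<close> times the \<open>d\<close>-th roots of unity, which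
  kills the elementary symmetric functions of degree below \<open>d\<close>. The last coordinate maps \<open>\<Omega>\<close> into
  the disc and is the identity on that analytic disc. Hence every module over the bounded holomorphic
  functions on the disc is a module over the algebra of \<open>\<Omega>\<close>, and if the latter is similar to a
  contractive module, then multiplication by the coordinate is similar to a contraction. So the
  theorem amounts to Pisier's theorem that a polynomially bounded operator need not be similar to a
  contraction. What follows is an elementary proof of it; the operators are finite sections of
  Foguel-Hankel operators with lacunary symbols.

  Let \<open>C\<^sub>0,\<dots>,C\<^sub>K\<^sub>-\<^sub>1\<close> be matrices with the canonical anticommutation relations
  \<open>C\<^sub>l\<^sup>* C\<^sub>k + C\<^sub>k C\<^sub>l\<^sup>* = \<delta>\<close>, so that \<open>\<parallel>\<Sum> a\<^sub>l C\<^sub>l\<parallel> \<le> |a|\<close> for all scalars. A function \<open>f\<close> acts on pairs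
  \<open>(v, x)\<close> of vector-valued power series modulo \<open>X^(2^K + 1)\<close> by \<open>f \<cdot> (v, x) = (f v + f' D x, f x)\<close>
  with \<open>D x = \<Sum>\<^sub>k 2^-(k+1) X^(2^K - 2^(k+1) + 1) C\<^sub>k x\<close>. This is an action because differentiation is a
  derivation and \<open>D\<close> commutes with multiplication by power series. The module is the Hilbert sum of these blocks over all \<open>K\<close>.

  It is bounded, uniformly in \<open>K\<close> (\<open>derivation_bound_poly\<close>). Dually this is an estimate for
  \<open>\<Sum>\<^sub>k 2^-(k+1) c\<^sub>k\<close>, where \<open>c\<^sub>k\<close> is the coefficient of degree \<open>2^(k+1) - 1\<close> of \<open>f' \<beta>\<^sub>k\<close> and the polynomials \<open>\<beta>\<^sub>k\<close>
  satisfy \<open>|\<Sum> a\<^sub>k \<beta>\<^sub>k| \<le> |a| q\<close> pointwise. Consider Brownian motion \<open>u\<close> in the disc, stopped on the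
  circles of radius \<open>R\<^sub>k = 1 - 2^-(k+1)\<close>. Up to a factor, the \<open>k\<close>-th term is the expectation of
  \<open>f'(u\<^sub>k) \<beta>\<^sub>k(u\<^sub>k)\<close> times a phase, and \<open>f'(u\<^sub>k) \<beta>\<^sub>k(u\<^sub>k)\<close> is in turn the mean over \<open>u\<^sub>k\<^sub>+\<^sub>1\<close> of
  \<open>(f(u\<^sub>k\<^sub>+\<^sub>1) - f(u\<^sub>k)) \<beta>\<^sub>k(u\<^sub>k\<^sub>+\<^sub>1)\<close> times a phase. The square function of the increments
  of a bounded function need not be bounded, but it becomes bounded if, in each later step, the coefficients collected so far are multiplied by a
  function that is holomorphic in that step and has mean \<open>1\<close>, so that the expectation does not change
  (\<open>bellman_weight\<close>, \<open>bellman_chain\<close>). With a positive quadrature on roots of unity in place of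
  harmonic measure the argument needs finite sums only.

  It is not similar to a contractive module (\<open>not_cramped_disc_action\<close>). For a contraction \<open>T\<close> the
  operator \<open>\<Sum>\<^sub>l C\<^sub>l \<otimes> T^m\<^sub>l\<close> has norm at most \<open>\<surd>K\<close> (\<open>car_von_neumann\<close>). In block \<open>K\<close>, with
  \<open>m\<^sub>l = 2^(l+1)\<close>, it has norm at least \<open>K/2\<close>, because the derivation sends \<open>z^m\<^sub>l\<close> to
  \<open>C\<^sub>l\<close> in the top degree. A similarity would have to absorb the factor \<open>\<surd>K/2\<close> for every \<open>K\<close>.
\<close>

(* Coordinates of vectors and coefficients of power series share one infix; below, each part
   switches on the one that it uses. *)
unbundle no vec_syntax
no_notation fps_nth (infixl "$" 75)

section \<open>Matrices with the canonical anticommutation relations\<close>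

text \<open>
  The entry at \<open>(S', S)\<close> of the \<open>l\<close>-th creation operator of fermionic Fock space; subsets of
  \<open>{..<K}\<close> index a basis of the exterior algebra on \<open>K\<close> generators.
\<close>

definition car :: "nat \<Rightarrow> nat set \<Rightarrow> nat set \<Rightarrow> real" where
  "car l S' S = (if l \<in> S' \<and> S = S' - {l} then (-1) ^ card {j\<in>S. j < l} else 0)"

lemma sum_rotate3:
  "(\<Sum>a\<in>A. \<Sum>b\<in>B. \<Sum>c\<in>C. f a b c) = (\<Sum>b\<in>B. \<Sum>c\<in>C. \<Sum>a\<in>A. f a b c)"
  by (subst sum.swap, rule sum.cong[OF refl], rule sum.swap)

lemma car_alt: "car l S' S = (if l \<notin> S \<and> S' = insert l S then (-1) ^ card {j\<in>S. j < l} else 0)"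
proof -
  have "l \<in> S' \<and> S = S' - {l} \<longleftrightarrow> l \<notin> S \<and> S' = insert l S"
    by blast
  thus ?thesis by (simp only: car_def)
qed

text \<open>
  This is \<open>C\<^sub>l\<^sup>* C\<^sub>l\<^sub>' + C\<^sub>l\<^sub>' C\<^sub>l\<^sup>* = \<delta>\<close> read off at an entry. For distinct \<open>l\<close> and \<open>l'\<close> each of the two sums has
  at most one nonzero term, both for the same index pairs, and exchanging the order in which \<open>l\<close> is
  removed and \<open>l'\<close> is inserted flips exactly one of the signs.
\<close>

lemma car_anticommute:
  assumes "l < K" "l' < K" "S \<subseteq> {..<K}" "S'' \<subseteq> {..<K}"
  shows "(\<Sum>S'\<in>Pow {..<K}. car l' S' S * car l S' S'' + car l S S' * car l' S'' S') =
    (if l = l' \<and> S = S'' then 1 else 0)"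
proof -
  have fin: "finite S" "finite S''" using assms finite_subset by blast+
  have first: "(\<Sum>S'\<in>Pow {..<K}. car l' S' S * car l S' S'') =
      (if l' \<in> S then 0 else car l' (insert l' S) S * car l (insert l' S) S'')"
  proof -
    have "(\<Sum>S'\<in>Pow {..<K}. car l' S' S * car l S' S'') =
        (\<Sum>S'\<in>Pow {..<K}. if S' = insert l' S then (if l' \<in> S then 0 else car l' S' S * car l S' S'') else 0)"
      by (intro sum.cong refl) (simp add: car_alt[of l'])
    also have "\<dots> = (if l' \<in> S then 0 else car l' (insert l' S) S * car l (insert l' S) S'')"
      using assms by (subst sum.delta) auto
    finally show ?thesis .
  qed
  have second: "(\<Sum>S'\<in>Pow {..<K}. car l S S' * car l' S'' S') = car l S (S - {l}) * car l' S'' (S - {l})"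
  proof -
    have "(\<Sum>S'\<in>Pow {..<K}. car l S S' * car l' S'' S') =
        (\<Sum>S'\<in>Pow {..<K}. if S' = S - {l} then car l S S' * car l' S'' S' else 0)"
      by (intro sum.cong refl) (simp add: car_def[of l])
    also have "\<dots> = car l S (S - {l}) * car l' S'' (S - {l})"
      using assms by (subst sum.delta) auto
    finally show ?thesis .
  qed
  have sq: "((-1::real) ^ n) * (-1) ^ n = 1" for n :: nat
    by (simp flip: power_mult_distrib)
  show ?thesis
  proof (cases "l = l'")
    case True
    show ?thesis
    proof (cases "l \<in> S")
      case lS: True
      have "car l S (S - {l}) * car l S'' (S - {l}) = (if S = S'' then 1 else 0)"
        unfolding car_alt using lS by (auto simp add: sq insert_absorb)
      thus ?thesis unfolding sum.distrib first second unfolding True[symmetric] using lS by simp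
    next
      case lS: False
      hence "insert l S - {l} = S" by blast
      hence "car l (insert l S) S * car l (insert l S) S'' = (if S = S'' then 1 else 0)"
        unfolding car_def using lS by (auto simp add: sq)
      moreover have "car l S (S - {l}) = 0" using lS by (simp add: car_def)
      ultimately show ?thesis unfolding sum.distrib first second unfolding True[symmetric] using lS by simp
    qed
  next
    case ne: False
    consider "l \<in> S" "l' \<notin> S" "S'' = insert l' S - {l}" | "\<not> (l \<in> S \<and> l' \<notin> S \<and> S'' = insert l' S - {l})"
      by blast
    thus ?thesis
    proof cases
      case 1
      let ?s = "\<lambda>A i. (-1::real) ^ card {j\<in>A. j < i}"
      have c: "?s (insert i A) j = (if i < j then - 1 else 1) * ?s A j" if "i \<notin> A" "finite A" for A i j
      proof -
        have "{k \<in> insert i A. k < j} = (if i < j then insert i {k\<in>A. k < j} else {k\<in>A. k < j})"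
          by auto
        thus ?thesis using that by auto
      qed
      define A where "A = S - {l}"
      have A: "S = insert l A" "l \<notin> A" "l' \<notin> A" "finite A" "S'' = insert l' A" "insert l' S - {l} = insert l' A"
        "S'' - {l'} = A"
        using 1 ne fin by (auto simp: A_def)
      have "car l' (insert l' S) S = ?s S l'"
        using 1(2) by (simp add: car_alt)
      moreover have "car l (insert l' S) S'' = ?s S'' l"
        unfolding car_def using 1 by simp
      moreover have "car l S (S - {l}) = ?s A l"
        unfolding car_def A_def using 1(1) by simp
      moreover have "car l' S'' (S - {l}) = ?s A l'"
        unfolding A_def[symmetric] car_alt using A(3,5) by simp
      ultimately have "(\<Sum>S'\<in>Pow {..<K}. car l' S' S * car l S' S'' + car l S S' * car l' S'' S') = 
         ?s S l' * ?s S'' l + ?s A l * ?s A l'"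
        unfolding sum.distrib first second using 1 by simp
      also have "\<dots> = 0"
        using c[OF A(2,4), of l'] c[OF A(3,4), of l] ne unfolding A(1,5) by auto
      finally show ?thesis using ne by simp
    next
      case 2
      have "l' \<in> S \<or> car l' (insert l' S) S * car l (insert l' S) S'' = 0"
        using 2 ne unfolding car_def[of l] by auto
      moreover have "car l S (S - {l}) * car l' S'' (S - {l}) = 0"
      proof (cases "l \<in> S \<and> l' \<notin> S")
        case True
        hence "insert l' (S - {l}) = insert l' S - {l}" using ne by blast
        thus ?thesis using 2 True unfolding car_alt[of l'] by simp
      qed (use ne in \<open>auto simp: car_def[of l] car_alt[of l']\<close>)
      ultimately show ?thesis unfolding sum.distrib first second using ne by auto
    qed
  qed
qed

lemma car_square_sum:
  assumes "S' \<subseteq> {..<K}"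
  shows "(\<Sum>S\<in>Pow {..<K}. (car l S' S)\<^sup>2) = (if l \<in> S' then 1 else 0)"
proof -
  have "(\<Sum>S\<in>Pow {..<K}. (car l S' S)\<^sup>2) = (\<Sum>S\<in>Pow {..<K}. if S = S' - {l} then (if l \<in> S' then 1 else 0) else 0)"
    by (intro sum.cong) (auto simp: car_def simp flip: power_mult)
  thus ?thesis using assms by auto
qed

text \<open>
  The anticommutation relations, applied to a Gram matrix \<open>G\<close>. In the norm bound below \<open>G\<close> comes from
  scalars, in \<open>car_von_neumann\<close> from vectors moved by powers of a contraction.
\<close>

lemma car_gram_sum:
  fixes G :: "nat set \<Rightarrow> nat set \<Rightarrow> complex"
  assumes "l < K" "l' < K"
  shows "(\<Sum>S'\<in>Pow {..<K}. \<Sum>S\<in>Pow {..<K}. \<Sum>S''\<in>Pow {..<K}.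
      of_real (car l' S' S * car l S' S'' + car l S S' * car l' S'' S') * G S S'') =
    (if l = l' then \<Sum>S\<in>Pow {..<K}. G S S else 0)"
proof -
  let ?P = "Pow {..<K}"
  have "(\<Sum>S'\<in>?P. \<Sum>S\<in>?P. \<Sum>S''\<in>?P.
      of_real (car l' S' S * car l S' S'' + car l S S' * car l' S'' S') * G S S'') =
    (\<Sum>S\<in>?P. \<Sum>S''\<in>?P. \<Sum>S'\<in>?P. 
      of_real (car l' S' S * car l S' S'' + car l S S' * car l' S'' S') * G S S'')"
    by (rule sum_rotate3)
  also have "\<dots> = (\<Sum>S\<in>?P. \<Sum>S''\<in>?P. if S'' = S then (if l = l' then G S S else 0) else 0)"
  proof (intro sum.cong refl)
    fix S S'' assume "S \<in> ?P" "S'' \<in> ?P"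
    hence "(\<Sum>S'\<in>?P. car l' S' S * car l S' S'' + car l S S' * car l' S'' S') = (if l = l' \<and> S = S'' then 1 else 0)"
      using assms by (intro car_anticommute) auto
    thus "(\<Sum>S'\<in>?P. of_real (car l' S' S * car l S' S'' + car l S S' * car l' S'' S') * G S S'') =
       (if S'' = S then (if l = l' then G S S else 0) else 0)"
      unfolding sum_distrib_right[symmetric] of_real_sum[symmetric] by auto
  qed
  also have "\<dots> = (if l = l' then \<Sum>S\<in>?P. G S S else 0)"
    by simp
  finally show ?thesis .
qed

text \<open>
  With \<open>C = \<Sum> a\<^sub>l C\<^sub>l\<close> the relations give \<open>C\<^sup>* C + C C\<^sup>* = |a|\<^sup>2\<close>; dropping the second summand leaves
  \<open>\<parallel>C \<xi>\<parallel>\<^sup>2 \<le> |a|\<^sup>2 \<parallel>\<xi>\<parallel>\<^sup>2\<close>.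
\<close>

lemma car_combination_bound:
  fixes a :: "nat \<Rightarrow> complex" and \<xi> :: "nat set \<Rightarrow> complex"
  shows "(\<Sum>S'\<in>Pow {..<K}. (cmod (\<Sum>l<K. \<Sum>S\<in>Pow {..<K}. a l * car l S' S * \<xi> S))\<^sup>2)
    \<le> (\<Sum>l<K. (cmod (a l))\<^sup>2) * (\<Sum>S\<in>Pow {..<K}. (cmod (\<xi> S))\<^sup>2)"
proof -
  let ?P = "Pow {..<K}"
  define u where "u S' = (\<Sum>l<K. \<Sum>S\<in>?P. a l * car l S' S * \<xi> S)" for S'
  define w where "w S' = (\<Sum>l<K. \<Sum>S\<in>?P. cnj (a l) * car l S S' * \<xi> S)" for S'
  define G where "G S S'' = \<xi> S * cnj (\<xi> S'')" for S S''
  have u2: "u S' * cnj (u S') = (\<Sum>l'<K. \<Sum>l<K. a l' * cnj (a l) * (\<Sum>S\<in>?P. \<Sum>S''\<in>?P. 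
      of_real (car l' S' S * car l S' S'') * G S S''))" for S'
    unfolding u_def cnj_sum sum_product G_def
    by (simp add: sum_distrib_left sum_distrib_right mult_ac)
  have w2: "w S' * cnj (w S') = (\<Sum>l'<K. \<Sum>l<K. a l' * cnj (a l) * (\<Sum>S\<in>?P. \<Sum>S''\<in>?P. 
      of_real (car l S S' * car l' S'' S') * G S S''))" for S'
    unfolding w_def cnj_sum sum_product G_def
    by (subst sum.swap) (simp add: sum_distrib_left sum_distrib_right mult_ac)
  have "(\<Sum>S'\<in>?P. u S' * cnj (u S') + w S' * cnj (w S')) =
    (\<Sum>S'\<in>?P. \<Sum>l'<K. \<Sum>l<K. a l' * cnj (a l) * (\<Sum>S\<in>?P. \<Sum>S''\<in>?P. 
      of_real (car l' S' S * car l S' S'' + car l S S' * car l' S'' S') * G S S''))"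
    unfolding u2 w2 by (simp add: sum.distrib distrib_left distrib_right)
  also have "\<dots> = (\<Sum>l'<K. \<Sum>l<K. \<Sum>S'\<in>?P. a l' * cnj (a l) * (\<Sum>S\<in>?P. \<Sum>S''\<in>?P. 
      of_real (car l' S' S * car l S' S'' + car l S S' * car l' S'' S') * G S S''))"
    by (rule sum_rotate3)
  also have "\<dots> = (\<Sum>l'<K. \<Sum>l<K. a l' * cnj (a l) * (if l = l' then \<Sum>S\<in>?P. G S S else 0))"
    by (intro sum.cong refl) (simp only: sum_distrib_left[symmetric] car_gram_sum lessThan_iff)
  also have "\<dots> = (\<Sum>l<K. a l * cnj (a l)) * (\<Sum>S\<in>?P. G S S)"
    by (simp add: sum_distrib_right if_distrib cong: if_cong)
  finally have "complex_of_real (\<Sum>S'\<in>?P. (cmod (u S'))\<^sup>2 + (cmod (w S'))\<^sup>2) =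
     complex_of_real ((\<Sum>l<K. (cmod (a l))\<^sup>2) * (\<Sum>S\<in>?P. (cmod (\<xi> S))\<^sup>2))"
    unfolding G_def by (simp add: complex_norm_square[symmetric] del: of_real_power flip: of_real_power)
  hence "(\<Sum>S'\<in>?P. (cmod (u S'))\<^sup>2 + (cmod (w S'))\<^sup>2) = 
     (\<Sum>l<K. (cmod (a l))\<^sup>2) * (\<Sum>S\<in>?P. (cmod (\<xi> S))\<^sup>2)"
    using of_real_eq_iff by blast
  moreover have "(\<Sum>S'\<in>?P. (cmod (u S'))\<^sup>2) \<le> (\<Sum>S'\<in>?P. (cmod (u S'))\<^sup>2 + (cmod (w S'))\<^sup>2)"
    by (intro sum_mono) simp
  ultimately show ?thesis unfolding u_def by simp
qed

section \<open>A positive quadrature on roots of unity\<close>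

definition unit_root :: "nat \<Rightarrow> nat \<Rightarrow> complex" where
  "unit_root N i = cis (2 * pi * real i / real N)"

lemma norm_unit_root [simp]: "cmod (unit_root N i) = 1"
  by (simp add: unit_root_def)

lemma unit_root_cnj [simp]: "unit_root N i * cnj (unit_root N i) = 1"
  by (simp add: unit_root_def cis_cnj flip: cis_inverse)

lemma unit_root_power_order:
  assumes "N > 0"
  shows "unit_root N i ^ N = 1"
proof -
  have "unit_root N i ^ N = cis (2 * pi * real i)"
    unfolding unit_root_def Complex.DeMoivre using assms by simp
  thus ?thesis by (simp add: cis_multiple_2pi)
qed

lemma sum_unit_root_orthogonal:
  assumes "p < N" "q < N"
  shows "(\<Sum>i<N. unit_root N i ^ p * cnj (unit_root N i) ^ q) = (if p = q then of_nat N else 0)"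
proof -
  have N: "N > 0" using assms by simp
  define \<tau> where "\<tau> = unit_root N p * cnj (unit_root N q)"
  have pow: "unit_root N i ^ p = unit_root N p ^ i" for i p
    unfolding unit_root_def Complex.DeMoivre by (simp add: mult_ac)
  have "(\<Sum>i<N. unit_root N i ^ p * cnj (unit_root N i) ^ q) = (\<Sum>i<N. \<tau> ^ i)"
    by (simp add: \<tau>_def pow power_mult_distrib flip: complex_cnj_power)
  also have "\<dots> = (if p = q then of_nat N else 0)"
  proof (cases "p = q")
    case False
    have "inj_on (\<lambda>k. unit_root N k) {..<N}"
      unfolding unit_root_def by (rule bij_betw_imp_inj_on[OF Complex.bij_betw_roots_unity[OF N]])
    hence "unit_root N p \<noteq> unit_root N q"
      using assms False by (auto dest: inj_onD)
    moreover have "unit_root N p = \<tau> * unit_root N q"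
      by (simp add: \<tau>_def mult_ac)
    ultimately have "\<tau> \<noteq> 1" by auto
    moreover have "\<tau> ^ N = 1"
      using unit_root_power_order[OF N, of p] unit_root_power_order[OF N, of q] by (simp add: \<tau>_def power_mult_distrib flip: complex_cnj_power)
    ultimately show ?thesis using False
      by (simp add: sum_gp_strict)
  qed (simp add: \<tau>_def)
  finally show ?thesis .
qed

text \<open>
  The Poisson kernel \<open>Re ((1 + s) / (1 - s))\<close> at \<open>s = r \<upsilon> cnj \<omega>\<close>, with its power series cut off after degree
  \<open>L\<close>, as a weight for \<open>N\<close> points. The truncation makes integration against it on \<open>N > 2 L\<close> roots of unity exact for polynomials
  of degree at most \<open>L\<close>.
\<close>

definition poisson_weight :: "nat \<Rightarrow> nat \<Rightarrow> real \<Rightarrow> nat \<Rightarrow> nat \<Rightarrow> real" where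
  "poisson_weight N L r i k = Re (1 + 2 * (\<Sum>n=1..L. (of_real r * unit_root N k * cnj (unit_root N i)) ^ n)) / real N"

text \<open>
  Positivity survives the truncation for large \<open>L\<close>, because on \<open>|s| = r < 1\<close> the full kernel is bounded
  away from \<open>0\<close> while the tail of its series is of size \<open>r^(L+1)\<close>.
\<close>

lemma poisson_weight_nonneg:
  assumes "0 \<le> r" "r < 1" "4 * r ^ (L + 1) \<le> 1 - r\<^sup>2"
  shows "0 \<le> poisson_weight N L r i k"
proof -
  define s where "s = of_real r * unit_root N k * cnj (unit_root N i)"
  have ns: "cmod s = r" using assms by (simp add: s_def norm_mult)
  define E where "E = 1 + 2 * (\<Sum>n=1..L. s ^ n)"
  have E: "(1 - s) * E = 1 + s - 2 * s ^ (L + 1)"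
    unfolding E_def
  proof (induction L)
    case (Suc L)
    have "(\<Sum>n=1..Suc L. s ^ n) = (\<Sum>n=1..L. s ^ n) + s ^ Suc L"
      by simp
    hence "(1 - s) * (1 + 2 * (\<Sum>n=1..Suc L. s ^ n)) = (1 - s) * (1 + 2 * (\<Sum>n=1..L. s ^ n)) + 2 * (1 - s) * s ^ Suc L"
      by (simp only: distrib_left mult_ac) (simp only: add_ac)
    also have "\<dots> = 1 + s - 2 * s ^ (Suc L + 1)"
      unfolding Suc by (simp add: algebra_simps)
    finally show ?case .
  qed simp
  have "(cmod (1 - s))\<^sup>2 * Re E = Re (((1 - s) * E) * cnj (1 - s))"
  proof -
    have "((1 - s) * E) * cnj (1 - s) = of_real ((cmod (1 - s))\<^sup>2) * E"
      by (simp only: complex_norm_square mult_ac)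
    thus ?thesis
      by (simp only: Re_complex_of_real Im_complex_of_real times_complex.sel mult_zero_left diff_zero)
  qed
  also have "((1 - s) * E) * cnj (1 - s) = (1 + s) * (1 - cnj s) - 2 * s ^ (L + 1) * (1 - cnj s)"
    unfolding E by (simp add: algebra_simps)
  also have "Re \<dots> = (1 - r\<^sup>2) - Re (2 * s ^ (L + 1) * (1 - cnj s))"
  proof -
    have "s * cnj s = of_real (r\<^sup>2)" by (simp add: ns flip: complex_norm_square)
    hence "Re (s * cnj s) = r\<^sup>2" by simp
    thus ?thesis by (simp add: algebra_simps)
  qed
  also have "\<dots> \<ge> 0"
  proof -
    have "Re (2 * s ^ (L + 1) * (1 - cnj s)) \<le> cmod (2 * s ^ (L + 1) * (1 - cnj s))"
      by (rule complex_Re_le_cmod)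
    also have "\<dots> = 2 * r ^ (L + 1) * cmod (1 - cnj s)"
      by (simp add: norm_mult norm_power ns)
    also have "\<dots> \<le> 2 * r ^ (L + 1) * 2"
    proof (intro mult_left_mono)
      have "cmod (1 - cnj s) \<le> 1 + r" using norm_triangle_ineq4[of 1 "cnj s"] ns by simp
      thus "cmod (1 - cnj s) \<le> 2" using assms by simp
    qed (use assms in auto)
    finally show ?thesis using assms(3) by simp
  qed
  finally have "0 \<le> (cmod (1 - s))\<^sup>2 * Re E" .
  moreover have "s \<noteq> 1" using ns assms by auto
  ultimately have "0 \<le> Re E" by (simp add: zero_le_mult_iff)
  thus ?thesis by (simp add: poisson_weight_def E_def s_def)
qed

lemma poisson_weight_expand:
  "of_nat N * complex_of_real (poisson_weight N L r i k) =
    (if N = 0 then 0 else 1 + (\<Sum>n=1..L. of_real r ^ n * (unit_root N k ^ n * cnj (unit_root N i) ^ n))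
      + (\<Sum>n=1..L. of_real r ^ n * (unit_root N i ^ n * cnj (unit_root N k) ^ n)))"
proof -
  define S where "S = (\<Sum>n=1..L. (of_real r * unit_root N k * cnj (unit_root N i)) ^ n)"
  have "complex_of_real (Re (1 + 2 * S)) = 1 + S + cnj S"
    by (simp add: complex_eq_iff)
  moreover have "S = (\<Sum>n=1..L. of_real r ^ n * (unit_root N k ^ n * cnj (unit_root N i) ^ n))"
    by (simp add: S_def power_mult_distrib mult_ac)
  moreover have "cnj S = (\<Sum>n=1..L. of_real r ^ n * (unit_root N i ^ n * cnj (unit_root N k) ^ n))"
    by (simp add: S_def power_mult_distrib mult_ac)
  ultimately show ?thesis unfolding poisson_weight_def S_def[symmetric] by simp
qed

lemma sum_poisson_weight_power:
  assumes "2 * L < N" "j \<le> L"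
  shows "(\<Sum>i<N. complex_of_real (poisson_weight N L r i k) * unit_root N i ^ j) = (of_real r * unit_root N k) ^ j"
proof -
  have N: "N > 0" using assms by simp
  have "of_nat N * (\<Sum>i<N. complex_of_real (poisson_weight N L r i k) * unit_root N i ^ j) =
     (\<Sum>i<N. (of_nat N * complex_of_real (poisson_weight N L r i k)) * unit_root N i ^ j)"
    by (simp add: sum_distrib_left mult_ac)
  also have "\<dots> = (\<Sum>i<N. unit_root N i ^ j * cnj (unit_root N i) ^ 0)
      + (\<Sum>n=1..L. of_real r ^ n * unit_root N k ^ n * (\<Sum>i<N. unit_root N i ^ j * cnj (unit_root N i) ^ n))
      + (\<Sum>n=1..L. of_real r ^ n * cnj (unit_root N k) ^ n * (\<Sum>i<N. unit_root N i ^ (j + n) * cnj (unit_root N i) ^ 0))"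
    unfolding poisson_weight_expand using N
    by (simp add: distrib_right distrib_left sum.distrib sum_distrib_left sum_distrib_right sum.swap[of _ "{..<N}"]
      power_add mult_ac)
  also have "(\<Sum>n=1..L. of_real r ^ n * cnj (unit_root N k) ^ n * (\<Sum>i<N. unit_root N i ^ (j + n) * cnj (unit_root N i) ^ 0)) = 0"
    using assms by (intro sum.neutral ballI) (subst sum_unit_root_orthogonal, auto)
  also have "(\<Sum>i<N. unit_root N i ^ j * cnj (unit_root N i) ^ 0) = (if j = 0 then of_nat N else 0)"
    using assms by (subst sum_unit_root_orthogonal) auto
  also have "(\<Sum>n=1..L. of_real r ^ n * unit_root N k ^ n * (\<Sum>i<N. unit_root N i ^ j * cnj (unit_root N i) ^ n)) = 
     (\<Sum>n=1..L. if n = j then of_real r ^ n * unit_root N k ^ n * of_nat N else 0)"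
    using assms by (intro sum.cong refl) (subst sum_unit_root_orthogonal, auto)
  also have "\<dots> = (if j = 0 then 0 else of_real r ^ j * unit_root N k ^ j * of_nat N)"
    using assms by (subst sum.delta) auto
  finally have "of_nat N * (\<Sum>i<N. complex_of_real (poisson_weight N L r i k) * unit_root N i ^ j) = 
     of_nat N * (of_real r * unit_root N k) ^ j"
    by (auto simp: power_mult_distrib split: if_splits)
  thus ?thesis using N by (subst (asm) mult_cancel_left) auto
qed

lemma sum_poisson_weight_poly:
  assumes "2 * L < N" "degree p \<le> L"
  shows "(\<Sum>i<N. complex_of_real (poisson_weight N L r i k) * poly p (of_real R * unit_root N i)) = poly p (of_real (R * r) * unit_root N k)"
proof -
  have "(\<Sum>i<N. complex_of_real (poisson_weight N L r i k) * poly p (of_real R * unit_root N i)) =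
    (\<Sum>j\<le>degree p. coeff p j * of_real R ^ j * (\<Sum>i<N. complex_of_real (poisson_weight N L r i k) * unit_root N i ^ j))"
    unfolding poly_altdef
    by (simp add: sum_distrib_left power_mult_distrib sum.swap[of _ "{..<N}"] mult_ac)
  also have "\<dots> = (\<Sum>j\<le>degree p. coeff p j * of_real R ^ j * (of_real r * unit_root N k) ^ j)"
    using assms by (intro sum.cong refl) (subst sum_poisson_weight_power, auto)
  also have "\<dots> = poly p (of_real (R * r) * unit_root N k)"
    unfolding poly_altdef by (simp add: power_mult_distrib mult_ac)
  finally show ?thesis .
qed

lemma sum_poisson_weight_source:
  assumes "2 * L < N"
  shows "(\<Sum>k<N. poisson_weight N L r i k) = 1"
proof -
  have sym: "poisson_weight N L r i k = poisson_weight N L r k i" for k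
  proof -
    have "of_real r * unit_root N k * cnj (unit_root N i) = cnj (of_real r * unit_root N i * cnj (unit_root N k))"
      by simp
    hence eq: "(\<Sum>n=1..L. (of_real r * unit_root N k * cnj (unit_root N i)) ^ n) =
        cnj (\<Sum>n=1..L. (of_real r * unit_root N i * cnj (unit_root N k)) ^ n)"
      by (simp only: cnj_sum complex_cnj_power)
    have "Re (1 + 2 * cnj B) = Re (1 + 2 * B)" for B
      by simp
    thus ?thesis unfolding poisson_weight_def eq by (simp only:)
  qed
  have "(\<Sum>k<N. complex_of_real (poisson_weight N L r k i) * unit_root N k ^ 0) = (of_real r * unit_root N i) ^ 0"
    using assms by (intro sum_poisson_weight_power) auto
  hence "complex_of_real (\<Sum>k<N. poisson_weight N L r i k) = of_real 1"
    unfolding sym by simp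
  thus ?thesis using of_real_eq_iff by blast
qed

lemma sum_poly_cnj_power:
  assumes "degree p < N" "m < N"
  shows "(\<Sum>i<N. poly p (of_real R * unit_root N i) * cnj (unit_root N i) ^ m) = of_nat N * (coeff p m * of_real R ^ m)"
proof -
  have "(\<Sum>i<N. poly p (of_real R * unit_root N i) * cnj (unit_root N i) ^ m) =
    (\<Sum>j\<le>degree p. coeff p j * of_real R ^ j * (\<Sum>i<N. unit_root N i ^ j * cnj (unit_root N i) ^ m))"
    unfolding poly_altdef sum_distrib_left sum_distrib_right
    by (subst sum.swap) (simp add: power_mult_distrib mult_ac)
  also have "\<dots> = (\<Sum>j\<le>degree p. if j = m then coeff p j * of_real R ^ j * of_nat N else 0)"
    using assms by (intro sum.cong refl) (subst sum_unit_root_orthogonal, auto)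
  also have "\<dots> = of_nat N * (coeff p m * of_real R ^ m)"
    by (auto simp: coeff_eq_0)
  finally show ?thesis .
qed

lemma sum_norm_poly_square:
  assumes "degree p < N"
  shows "(\<Sum>i<N. (cmod (poly p (of_real R * unit_root N i)))\<^sup>2) = real N * (\<Sum>j\<le>degree p. (R ^ j * cmod (coeff p j))\<^sup>2)"
proof -
  have "complex_of_real (\<Sum>i<N. (cmod (poly p (of_real R * unit_root N i)))\<^sup>2) =
     (\<Sum>i<N. poly p (of_real R * unit_root N i) * (\<Sum>j\<le>degree p. cnj (coeff p j) * of_real R ^ j * cnj (unit_root N i) ^ j))"
    unfolding of_real_sum complex_norm_square
    by (intro sum.cong refl arg_cong2[of _ _ _ _ "(*)"])
      (simp add: poly_altdef power_mult_distrib mult_ac)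
  also have "\<dots> = (\<Sum>j\<le>degree p. cnj (coeff p j) * of_real R ^ j * (\<Sum>i<N. poly p (of_real R * unit_root N i) * cnj (unit_root N i) ^ j))"
    unfolding sum_distrib_left by (subst sum.swap) (simp add: mult_ac)
  also have "\<dots> = (\<Sum>j\<le>degree p. cnj (coeff p j) * of_real R ^ j * (of_nat N * (coeff p j * of_real R ^ j)))"
    using assms by (intro sum.cong refl) (subst sum_poly_cnj_power, auto)
  also have "\<dots> = complex_of_real (real N * (\<Sum>j\<le>degree p. (R ^ j * cmod (coeff p j))\<^sup>2))"
    unfolding of_real_mult of_real_sum sum_distrib_left of_real_of_nat_eq power_mult_distrib complex_norm_square
    by (simp add: power2_eq_square mult_ac)
  finally show ?thesis using of_real_eq_iff by blast
qed

section \<open>A square function estimate by backward induction\<close>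

text \<open>
  A Markov chain on the \<open>N\<close>-th roots of unity that moves from the circle of radius \<open>R k\<close> to that of
  radius \<open>R (Suc k)\<close> with the Poisson weights. \<open>chain_mean\<close> is the expected value of \<open>q\<close> after \<open>n\<close> more
  steps from level \<open>k\<close>.
\<close>

primrec chain_mean :: "nat \<Rightarrow> nat \<Rightarrow> (nat \<Rightarrow> real) \<Rightarrow> (complex \<Rightarrow> real) \<Rightarrow> nat \<Rightarrow> nat \<Rightarrow> nat \<Rightarrow> real" where
  "chain_mean N L R q 0 k i = q (of_real (R k) * unit_root N i)"
| "chain_mean N L R q (Suc n) k i = (\<Sum>j<N. poisson_weight N L (R k / R (Suc k)) j i * chain_mean N L R q n (Suc k) j)"

text \<open>
  The expected value of the sum of \<open>h\<close> over levels \<open>k, \<dots>, k + n - 1\<close> along the chain started at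
  level \<open>k\<close>.
\<close>

primrec chain_tail :: "nat \<Rightarrow> nat \<Rightarrow> (nat \<Rightarrow> real) \<Rightarrow> (nat \<Rightarrow> nat \<Rightarrow> complex) \<Rightarrow> nat \<Rightarrow> nat \<Rightarrow> nat \<Rightarrow> complex" where
  "chain_tail N L R h 0 k i = 0"
| "chain_tail N L R h (Suc n) k i = h k i
    + (\<Sum>j<N. of_real (poisson_weight N L (R k / R (Suc k)) j i) * chain_tail N L R h n (Suc k) j)"

text \<open>
  The uniform distribution is preserved by each step, so means over a uniformly distributed start only
  see the uniform distribution at each level.
\<close>

lemma sum_chain_mean:
  assumes "2 * L < N"
  shows "(\<Sum>i<N. chain_mean N L R q n k i) = (\<Sum>i<N. q (of_real (R (k + n)) * unit_root N i))"
proof (induction n arbitrary: k)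
  case (Suc n)
  have "(\<Sum>i<N. chain_mean N L R q (Suc n) k i) =
      (\<Sum>j<N. (\<Sum>i<N. poisson_weight N L (R k / R (Suc k)) j i) * chain_mean N L R q n (Suc k) j)"
    unfolding chain_mean.simps sum_distrib_right by (rule sum.swap)
  thus ?case using sum_poisson_weight_source[OF assms] Suc by simp
qed simp

lemma sum_chain_tail:
  assumes "2 * L < N"
  shows "(\<Sum>i<N. chain_tail N L R h n k i) = (\<Sum>m<n. \<Sum>i<N. h (k + m) i)"
proof (induction n arbitrary: k)
  case (Suc n)
  have "(\<Sum>i<N. chain_tail N L R h (Suc n) k i) = (\<Sum>i<N. h k i) +
      (\<Sum>j<N. (\<Sum>i<N. of_real (poisson_weight N L (R k / R (Suc k)) j i)) * chain_tail N L R h n (Suc k) j)"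
    unfolding chain_tail.simps sum_distrib_right sum.distrib
    by (intro arg_cong2[of _ _ _ _ "(+)"] refl sum.swap)
  also have "\<dots> = (\<Sum>i<N. h k i) + (\<Sum>m<n. \<Sum>i<N. h (Suc k + m) i)"
    using sum_poisson_weight_source[OF assms] Suc by (simp flip: of_real_sum)
  also have "\<dots> = (\<Sum>m<Suc n. \<Sum>i<N. h (k + m) i)"
    by (simp only: sum.lessThan_Suc_shift) simp
  finally show ?case .
qed simp

text \<open>
  One step of the square function estimate. \<open>F\<close> and \<open>G\<close> are successive values of the martingale
  \<open>f(u)\<close>. The factor \<open>g\<close> is affine in \<open>G\<close>, hence holomorphic in the new point, and equals \<open>1\<close> at
  \<open>G = F\<close>. Its square modulus agrees with \<open>(1 + |G|\<^sup>2) / (1 + |F|\<^sup>2)\<close> to first order and is smaller by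
  exactly \<open>|G - F|\<^sup>2 / (1 + |F|\<^sup>2)\<^sup>2\<close>; this gain pays for the new term \<open>|G - F|\<^sup>2\<close>.
\<close>

lemma bellman_weight:
  fixes F G :: complex
  assumes "cmod F \<le> 1" "cmod G \<le> 1"
  defines "g \<equiv> 1 + cnj F * (G - F) / of_real (1 + (cmod F)\<^sup>2)"
  shows "(cmod g)\<^sup>2 * (4 * (1 + (cmod F)\<^sup>2)) + (cmod (G - F))\<^sup>2 \<le> 4 * (1 + (cmod G)\<^sup>2)"
proof -
  define f2 where "f2 = (cmod F)\<^sup>2"
  define \<delta> where "\<delta> = (cmod (G - F))\<^sup>2"
  define B where "B = 1 + f2"
  define r where "r = Re (cnj F * (G - F))"
  have f2: "0 \<le> f2" "f2 \<le> 1" using assms by (auto simp: f2_def abs_square_le_1)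
  have B: "1 \<le> B" using f2 by (simp add: B_def)
  have \<delta>: "0 \<le> \<delta>" by (simp add: \<delta>_def)
  have G2: "(cmod G)\<^sup>2 = f2 + 2 * r + \<delta>"
    unfolding f2_def \<delta>_def r_def cmod_power2 by (simp add: power2_eq_square algebra_simps)
  have Gle: "(cmod G)\<^sup>2 \<le> 1" using assms by (simp add: abs_square_le_1)
  have g2: "(cmod g)\<^sup>2 = 1 + 2 * (r / B) + f2 * \<delta> / B\<^sup>2"
  proof -
    have a: "(cmod (1 + z))\<^sup>2 = 1 + 2 * Re z + (cmod z)\<^sup>2" for z
      unfolding cmod_power2 by (simp add: power2_eq_square algebra_simps)
    have b: "Re (cnj F * (G - F) / of_real B) = r / B"
      by (simp only: r_def Re_divide_of_real)
    have c: "(cmod (cnj F * (G - F) / of_real B))\<^sup>2 = f2 * \<delta> / B\<^sup>2"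
      by (simp add: norm_mult norm_divide power_divide power_mult_distrib f2_def \<delta>_def)
    have "g = 1 + cnj F * (G - F) / of_real B"
      by (simp only: g_def B_def f2_def)
    thus ?thesis by (simp only: a b c) 
  qed
  have "(cmod g)\<^sup>2 * B = B + 2 * r + f2 * \<delta> / B"
    unfolding g2 using B by (simp add: field_simps power2_eq_square)
  moreover have "f2 * \<delta> / B \<le> \<delta> / 2"
  proof -
    have "f2 * \<delta> * 2 \<le> \<delta> * B"
      using mult_right_mono[OF f2(2) \<delta>] by (simp add: B_def algebra_simps)
    thus ?thesis using B by (simp add: field_simps)
  qed
  ultimately have "(cmod g)\<^sup>2 * B \<le> B + 2 * r + \<delta> / 2" by simp
  hence "(cmod g)\<^sup>2 * (4 * B) + \<delta> \<le> 4 * (B + 2 * r + \<delta>)"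
    using \<delta> by simp
  thus ?thesis using G2 by (simp add: B_def f2_def \<delta>_def)
qed

lemma poly_synthetic_div_self: "poly (synthetic_div f u) u = poly (pderiv f) (u :: complex)"
proof -
  have "pderiv f = pderiv ([:- u, 1:] * synthetic_div f u + [:poly f u:])"
    by (simp only: synthetic_div_correct')
  also have "poly \<dots> u = poly (synthetic_div f u) u"
    unfolding pderiv_add pderiv_mult by (simp add: pderiv_pCons)
  finally show ?thesis by simp
qed

lemma poly_synthetic_div_eq: "poly f v - poly f u = (v - u) * poly (synthetic_div f u) (v :: complex)"
proof -
  have "poly f v = poly ([:- u, 1:] * synthetic_div f u + [:poly f u:]) v"
    by (simp only: synthetic_div_correct')
  thus ?thesis by (simp add: algebra_simps)
qed

text \<open>
  The coefficients \<open>a\<close> collected so far satisfy \<open>|a|\<^sup>2 \<le> 4 (1 + |f|\<^sup>2)\<close>, which is at most \<open>8\<close> at the last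
  level. There \<open>|\<Sum> a\<^sub>l \<beta>\<^sub>l| \<le> |a| q\<close> applies; the induction pulls the bound back along the chain. In one
  step, the left-hand side is written as the mean of the same expression one level up, with
  the old coefficients multiplied by \<open>g\<close> and with \<open>\<theta> D\<close> as new coefficient.
\<close>

lemma bellman_chain:
  fixes f :: "complex poly" and \<beta> :: "nat \<Rightarrow> complex poly" and R :: "nat \<Rightarrow> real"
  assumes f: "\<And>z. cmod z \<le> 1 \<Longrightarrow> cmod (poly f z) \<le> 1"
    and R: "\<And>k. 0 < R k" "\<And>k. R k < R (Suc k)" "\<And>k. R k \<le> 1"
    and \<theta>: "\<And>k i. cmod (\<theta> k i) \<le> 1"
    and L: "2 * L < N" "\<And>k. k < K \<Longrightarrow> degree f + degree (\<beta> k) + 1 \<le> L"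
      "\<And>k. k < K \<Longrightarrow> 4 * (R k / R (Suc k)) ^ (L + 1) \<le> 1 - (R k / R (Suc k))\<^sup>2"
    and q: "\<And>a z. cmod z \<le> 1 \<Longrightarrow> cmod (\<Sum>l<K. a l * poly (\<beta> l) z) \<le> sqrt (\<Sum>l<K. (cmod (a l))\<^sup>2) * q z"
      "\<And>z. 0 \<le> q z"
  defines "h \<equiv> \<lambda>k i. \<theta> k i * of_real (((R (Suc k))\<^sup>2 - (R k)\<^sup>2) / R (Suc k))
      * poly (pderiv f * \<beta> k) (of_real (R k) * unit_root N i)"
  assumes "k + n = K"
    and "(\<Sum>l<k. (cmod (a l))\<^sup>2) \<le> 4 * (1 + (cmod (poly f (of_real (R k) * unit_root N i)))\<^sup>2)"
  shows "cmod ((\<Sum>l<k. a l * poly (\<beta> l) (of_real (R k) * unit_root N i)) + chain_tail N L R h n k i)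
    \<le> sqrt 8 * chain_mean N L R q n k i"
  using assms(12-)
proof (induction n arbitrary: k a i)
  case 0
  have [simp]: "k = K" using 0 by simp
  have nz: "cmod (of_real (R K) * unit_root N i) \<le> 1"
    using R(1,3)[of K] by (simp add: norm_mult)
  have "(\<Sum>l<K. (cmod (a l))\<^sup>2) \<le> 8"
  proof -
    have "(cmod (poly f (of_real (R K) * unit_root N i)))\<^sup>2 \<le> 1"
      using f[OF nz] by (simp add: abs_square_le_1)
    thus ?thesis using 0 by simp
  qed
  hence "sqrt (\<Sum>l<K. (cmod (a l))\<^sup>2) * q (of_real (R K) * unit_root N i) \<le> sqrt 8 * q (of_real (R K) * unit_root N i)"
    by (intro mult_right_mono q) simp
  with q(1)[OF nz, of a] show ?case by simp
next
  case (Suc n)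
  hence k: "k < K" by simp
  define R' where "R' = R (Suc k)"
  define r where "r = R k / R'"
  define u where "u = of_real (R k) * unit_root N i"
  define v where "v j = of_real R' * unit_root N j" for j
  have R': "0 < R'" "R' \<le> 1" "R k < R'" using R by (auto simp: R'_def)
  have r: "0 \<le> r" "r < 1" using R' R(1)[of k] by (auto simp: r_def)
  have nu: "cmod u = R k" "cmod u \<le> 1" using R(1,3)[of k] by (auto simp: u_def norm_mult)
  have nv: "cmod (v j) = R'" "cmod (v j) \<le> 1" for j using R' by (auto simp: v_def norm_mult)
  define F where "F = poly f u"
  define B where "B = 1 + (cmod F)\<^sup>2"
  \<comment> \<open>Both are polynomials in the next point, so their products with the \<open>\<beta>\<close> have their value at \<open>u\<close>
    as mean. \<open>g\<close> is the factor of \<open>bellman_weight\<close>. \<open>D\<close> is the increment \<open>f v - f u\<close> divided by the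
    Blaschke factor of the disc of radius \<open>R'\<close> at \<open>u\<close>: dividing does not change the modulus on the
    circle, and it turns the value at \<open>u\<close> from \<open>0\<close> into a multiple of \<open>f' u\<close>.\<close>
  define g where "g = [:1 - cnj F * F / of_real B:] + Polynomial.smult (cnj F / of_real B) f"
  define D where "D = synthetic_div f u * [:of_real R', - cnj u / of_real R':]"
  have g: "poly g z = 1 + cnj F * (poly f z - F) / of_real (1 + (cmod F)\<^sup>2)" for z
    unfolding g_def B_def by (simp add: algebra_simps diff_divide_distrib)
  have gu: "poly g u = 1" by (simp add: g F_def)
  have Du: "poly D u = poly (pderiv f) u * of_real ((R'\<^sup>2 - (R k)\<^sup>2) / R')"
  proof -
    have "u * cnj u = of_real ((R k)\<^sup>2)" by (simp add: nu(1) flip: complex_norm_square)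
    hence "of_real R' - u * cnj u / of_real R' = complex_of_real ((R'\<^sup>2 - (R k)\<^sup>2) / R')"
      using R' by (simp add: field_simps power2_eq_square)
    moreover have "poly [:of_real R', - cnj u / of_real R':] u = of_real R' - u * cnj u / of_real R'"
      by simp
    ultimately show ?thesis by (simp only: D_def poly_mult poly_synthetic_div_self)
  qed
  have Dv: "cmod (poly D (v j)) = cmod (poly f (v j) - F)" for j
  proof -
    have "v j * cnj (v j) = of_real (R'\<^sup>2)" by (simp add: nv(1) flip: complex_norm_square)
    hence "of_real R' - v j * cnj u / of_real R' = (v j * cnj (v j - u)) / of_real R'"
      using R' by (simp add: field_simps power2_eq_square)
    moreover have "poly [:of_real R', - cnj u / of_real R':] (v j) = of_real R' - v j * cnj u / of_real R'"
      by simp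
    ultimately have "poly D (v j) = poly (synthetic_div f u) (v j) * ((v j * cnj (v j - u)) / of_real R')"
      by (simp only: D_def poly_mult)
    hence "cmod (poly D (v j)) = cmod (poly (synthetic_div f u) (v j)) * cmod (v j - u)"
      using R' nv(1)[of j] by (simp add: norm_mult norm_divide flip: complex_cnj_diff)
    thus ?thesis unfolding F_def poly_synthetic_div_eq by (simp add: norm_mult mult.commute)
  qed
  define G where "G = (\<Sum>l<k. Polynomial.smult (a l) (g * \<beta> l)) + Polynomial.smult (\<theta> k i) (D * \<beta> k)"
  define a' where "a' j l = (if l < k then poly g (v j) * a l else \<theta> k i * poly D (v j))" for j l
  have Gv: "poly G (v j) = (\<Sum>l<Suc k. a' j l * poly (\<beta> l) (v j))" for j
  proof -
    have "(\<Sum>l<k. a' j l * poly (\<beta> l) (v j)) = (\<Sum>l<k. a l * (poly g (v j) * poly (\<beta> l) (v j)))"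
      by (intro sum.cong) (auto simp: a'_def)
    moreover have "a' j k = \<theta> k i * poly D (v j)" by (simp add: a'_def)
    ultimately show ?thesis
      unfolding sum.lessThan_Suc by (simp add: G_def poly_sum)
  qed
  have Gu: "poly G u = (\<Sum>l<k. a l * poly (\<beta> l) u) + h k i"
    unfolding h_def u_def[symmetric] R'_def[symmetric]
    by (simp only: G_def poly_sum poly_add poly_smult poly_mult gu Du mult_ac mult_1_right mult_1_left)
  have degG: "degree G \<le> L"
  proof -
    have dg: "degree g \<le> degree f" unfolding g_def
      by (intro degree_add_le order.trans[OF degree_smult_le]) auto
    have dD: "degree D \<le> degree f + 1" unfolding D_def
      by (rule order.trans[OF degree_mult_le]) (auto simp: degree_synthetic_div)
    have "degree (\<Sum>l<k. Polynomial.smult (a l) (g * \<beta> l)) \<le> L"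
    proof (rule degree_sum_le)
      fix l assume "l \<in> {..<k}"
      hence "degree f + degree (\<beta> l) + 1 \<le> L" using L(2) k by simp
      thus "degree (Polynomial.smult (a l) (g * \<beta> l)) \<le> L"
        using degree_smult_le[of "a l" "g * \<beta> l"] degree_mult_le[of g "\<beta> l"] dg by linarith
    qed simp
    moreover have "degree (Polynomial.smult (\<theta> k i) (D * \<beta> k)) \<le> L"
      using degree_smult_le[of "\<theta> k i" "D * \<beta> k"] degree_mult_le[of D "\<beta> k"] dD L(2)[OF k] by linarith
    ultimately show ?thesis unfolding G_def by (rule degree_add_le)
  qed
  have quad: "(\<Sum>j<N. complex_of_real (poisson_weight N L r j i) * poly G (v j)) = poly G u"
  proof -
    have "of_real (R' * r) * unit_root N i = u" using R' by (simp add: u_def r_def)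
    thus ?thesis unfolding v_def using sum_poisson_weight_poly[OF L(1) degG] by metis
  qed
  have poisson_weight: "0 \<le> poisson_weight N L r j i" for j
    using r L(3)[OF k] by (intro poisson_weight_nonneg) (auto simp: r_def R'_def)
  have step: "cmod (poly G (v j) + chain_tail N L R h n (Suc k) j) \<le> sqrt 8 * chain_mean N L R q n (Suc k) j" for j
  proof -
    have "(\<Sum>l<Suc k. (cmod (a' j l))\<^sup>2) = (cmod (poly g (v j)))\<^sup>2 * (\<Sum>l<k. (cmod (a l))\<^sup>2) 
        + (cmod (\<theta> k i))\<^sup>2 * (cmod (poly D (v j)))\<^sup>2"
      by (simp add: a'_def norm_mult power_mult_distrib sum_distrib_left)
    also have "\<dots> \<le> (cmod (poly g (v j)))\<^sup>2 * (4 * (1 + (cmod F)\<^sup>2)) + 1 * (cmod (poly f (v j) - F))\<^sup>2"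
      unfolding Dv using Suc.prems(2) \<theta>
      by (intro add_mono mult_left_mono mult_right_mono) (auto simp: F_def u_def abs_square_le_1)
    also have "\<dots> \<le> 4 * (1 + (cmod (poly f (v j)))\<^sup>2)"
      unfolding g using bellman_weight[of F "poly f (v j)"] f nu nv by (simp add: F_def)
    finally show ?thesis
      using Suc.IH[of "Suc k" "a' j" j] Suc.prems(1) unfolding Gv unfolding v_def R'_def by simp
  qed
  have "(\<Sum>l<k. a l * poly (\<beta> l) u) + chain_tail N L R h (Suc n) k i =
     poly G u + (\<Sum>j<N. of_real (poisson_weight N L r j i) * chain_tail N L R h n (Suc k) j)"
    unfolding Gu by (simp add: r_def R'_def)
  also have "\<dots> = (\<Sum>j<N. of_real (poisson_weight N L r j i) * (poly G (v j) + chain_tail N L R h n (Suc k) j))"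
    unfolding quad[symmetric] by (simp add: distrib_left sum.distrib)
  finally have eq: "(\<Sum>l<k. a l * poly (\<beta> l) u) + chain_tail N L R h (Suc n) k i =
      (\<Sum>j<N. of_real (poisson_weight N L r j i) * (poly G (v j) + chain_tail N L R h n (Suc k) j))" .
  have "cmod (\<Sum>j<N. of_real (poisson_weight N L r j i) * (poly G (v j) + chain_tail N L R h n (Suc k) j))
      \<le> (\<Sum>j<N. sqrt 8 * (poisson_weight N L r j i * chain_mean N L R q n (Suc k) j))"
  proof (rule sum_norm_le)
    fix j
    have "cmod (of_real (poisson_weight N L r j i) * (poly G (v j) + chain_tail N L R h n (Suc k) j)) =
        poisson_weight N L r j i * cmod (poly G (v j) + chain_tail N L R h n (Suc k) j)"
      using poisson_weight[of j] by (simp add: norm_mult)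
    also have "\<dots> \<le> poisson_weight N L r j i * (sqrt 8 * chain_mean N L R q n (Suc k) j)"
      by (rule mult_left_mono[OF step poisson_weight])
    finally show "cmod (of_real (poisson_weight N L r j i) * (poly G (v j) + chain_tail N L R h n (Suc k) j))
        \<le> sqrt 8 * (poisson_weight N L r j i * chain_mean N L R q n (Suc k) j)"
      by (simp only: mult.left_commute)
  qed
  moreover have "(\<Sum>j<N. sqrt 8 * (poisson_weight N L r j i * chain_mean N L R q n (Suc k) j)) =
      sqrt 8 * chain_mean N L R q (Suc n) k i"
    by (simp only: chain_mean.simps sum_distrib_left r_def R'_def)
  ultimately show ?case unfolding u_def[symmetric] eq by (simp only:)
qed

lemma eventually_truncation_positive:
  fixes r :: real
  assumes "0 \<le> r" "r < 1"
  shows "\<forall>\<^sub>F L in sequentially. 4 * r ^ (L + 1) \<le> 1 - r\<^sup>2"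
proof -
  have "(\<lambda>L. 4 * r ^ (L + 1)) \<longlonglongrightarrow> 4 * (0 * r)"
    unfolding power_add power_one_right
    using assms by (intro tendsto_intros LIMSEQ_realpow_zero)
  moreover have "4 * (0 * r) < 1 - r\<^sup>2"
    using assms by (simp add: power2_eq_square mult_strict_mono[of r 1 r 1, simplified])
  ultimately have "\<forall>\<^sub>F L in sequentially. 4 * r ^ (L + 1) < 1 - r\<^sup>2"
    by (rule order_tendstoD)
  thus ?thesis by (rule eventually_mono) simp
qed

text \<open>
  The phases \<open>cnj (unit_root N i) ^ e k\<close> in the chain, together with uniform start, pick out the Taylor
  coefficient of degree \<open>e k\<close> at level \<open>k\<close>.
\<close>

lemma poly_derivative_functional_bound:
  fixes f :: "complex poly" and \<beta> :: "nat \<Rightarrow> complex poly" and R t :: "nat \<Rightarrow> real" and e :: "nat \<Rightarrow> nat"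
  assumes f: "\<And>z. cmod z \<le> 1 \<Longrightarrow> cmod (poly f z) \<le> 1"
    and R: "\<And>k. 0 < R k" "\<And>k. R k < R (Suc k)" "\<And>k. R k \<le> 1"
    and t: "\<And>k. \<bar>t k\<bar> \<le> 1"
    and q: "\<And>a z. cmod z \<le> 1 \<Longrightarrow> cmod (\<Sum>l<K. a l * poly (\<beta> l) z) \<le> sqrt (\<Sum>l<K. (cmod (a l))\<^sup>2) * q z"
      "\<And>z. 0 \<le> q z"
  shows "\<forall>\<^sub>F N in sequentially. real N * cmod (\<Sum>k<K. of_real (t k * ((R (Suc k))\<^sup>2 - (R k)\<^sup>2) / R (Suc k) * R k ^ e k)
      * coeff (pderiv f * \<beta> k) (e k)) \<le> sqrt 8 * (\<Sum>i<N. q (of_real (R K) * unit_root N i))"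
proof -
  have "\<forall>\<^sub>F L in sequentially. \<forall>k\<in>{..<K}. 4 * (R k / R (Suc k)) ^ (L + 1) \<le> 1 - (R k / R (Suc k))\<^sup>2"
  proof (intro eventually_ball_finite ballI)
    show "\<forall>\<^sub>F L in sequentially. 4 * (R k / R (Suc k)) ^ (L + 1) \<le> 1 - (R k / R (Suc k))\<^sup>2" for k
      using R(1)[of k] R(1)[of "Suc k"] R(2)[of k] by (intro eventually_truncation_positive) auto
  qed simp
  moreover have "\<forall>\<^sub>F L in sequentially. \<forall>k\<in>{..<K}. degree f + degree (\<beta> k) + 1 \<le> L"
    by (intro eventually_ball_finite ballI eventually_ge_at_top) simp
  ultimately obtain L where L: "\<And>k. k < K \<Longrightarrow> 4 * (R k / R (Suc k)) ^ (L + 1) \<le> 1 - (R k / R (Suc k))\<^sup>2"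
      "\<And>k. k < K \<Longrightarrow> degree f + degree (\<beta> k) + 1 \<le> L"
    using eventually_happens'[OF sequentially_bot eventually_conj] by (metis (no_types, lifting) lessThan_iff)
  have "\<forall>\<^sub>F N in sequentially. 2 * L < N"
    by (rule eventually_gt_at_top)
  moreover have "\<forall>\<^sub>F N in sequentially. \<forall>k\<in>{..<K}. e k < N"
    by (intro eventually_ball_finite ballI eventually_gt_at_top) simp
  ultimately show ?thesis
  proof eventually_elim
    case (elim N)
    define \<theta> where "\<theta> k i = of_real (t k) * cnj (unit_root N i) ^ e k" for k i
    have \<theta>: "cmod (\<theta> k i) \<le> 1" for k i
      using t[of k] by (simp add: \<theta>_def norm_mult norm_power)
    define h where "h k i = \<theta> k i * of_real (((R (Suc k))\<^sup>2 - (R k)\<^sup>2) / R (Suc k))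
      * poly (pderiv f * \<beta> k) (of_real (R k) * unit_root N i)" for k i
    have bound: "cmod (chain_tail N L R h K 0 i) \<le> sqrt 8 * chain_mean N L R q K 0 i" for i
      using bellman_chain[where f = f and R = R and \<theta> = \<theta> and \<beta> = \<beta> and q = q, OF f R \<theta> elim(1) L(2,1) q, of 0 K "\<lambda>_. 0" i]
      unfolding h_def[abs_def] by simp
    define Z where "Z = (\<Sum>k<K. of_real (t k * ((R (Suc k))\<^sup>2 - (R k)\<^sup>2) / R (Suc k) * R k ^ e k)
      * coeff (pderiv f * \<beta> k) (e k))"
    have "(\<Sum>i<N. chain_tail N L R h K 0 i) = (\<Sum>m<K. \<Sum>i<N. h m i)"
      using sum_chain_tail[OF elim(1)] by simp
    also have "\<dots> = (\<Sum>k<K. of_nat N * (of_real (t k * ((R (Suc k))\<^sup>2 - (R k)\<^sup>2) / R (Suc k) * R k ^ e k)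
      * coeff (pderiv f * \<beta> k) (e k)))"
    proof (intro sum.cong refl)
      fix k assume k: "k \<in> {..<K}"
      have deg: "degree (pderiv f * \<beta> k) < N"
        using degree_mult_le[of "pderiv f" "\<beta> k"] L(2)[of k] elim(1) k by (simp add: degree_pderiv)
      have "(\<Sum>i<N. h k i) = of_real (t k * (((R (Suc k))\<^sup>2 - (R k)\<^sup>2) / R (Suc k))) *
         (\<Sum>i<N. poly (pderiv f * \<beta> k) (of_real (R k) * unit_root N i) * cnj (unit_root N i) ^ e k)"
        unfolding h_def \<theta>_def sum_distrib_left of_real_mult by (intro sum.cong refl) (simp only: mult_ac)
      also have "\<dots> = of_real (t k * (((R (Suc k))\<^sup>2 - (R k)\<^sup>2) / R (Suc k))) *
         (of_nat N * (coeff (pderiv f * \<beta> k) (e k) * of_real (R k) ^ e k))"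
        using elim(2) k by (subst sum_poly_cnj_power[OF deg]) auto
      finally show "(\<Sum>i<N. h k i) = of_nat N * (of_real (t k * ((R (Suc k))\<^sup>2 - (R k)\<^sup>2) / R (Suc k) * R k ^ e k)
         * coeff (pderiv f * \<beta> k) (e k))"
        by simp
    qed
    finally have "(\<Sum>i<N. chain_tail N L R h K 0 i) = of_nat N * Z"
      by (simp only: Z_def sum_distrib_left)
    hence "real N * cmod Z = cmod (\<Sum>i<N. chain_tail N L R h K 0 i)"
      by (simp add: norm_mult)
    also have "\<dots> \<le> (\<Sum>i<N. sqrt 8 * chain_mean N L R q K 0 i)"
      using bound by (intro sum_norm_le)
    also have "\<dots> = sqrt 8 * (\<Sum>i<N. q (of_real (R K) * unit_root N i))"
      using sum_chain_mean[OF elim(1), of R q K 0] by (simp flip: sum_distrib_left)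
    finally show ?case unfolding Z_def .
  qed
qed

section \<open>Lacunary derivations of truncated power series\<close>

definition coeff_sq :: "complex poly \<Rightarrow> real" where
  "coeff_sq p = (\<Sum>j\<le>degree p. (cmod (coeff p j))\<^sup>2)"

lemma coeff_sq_nonneg: "0 \<le> coeff_sq p"
  by (simp add: coeff_sq_def sum_nonneg)

lemma coeff_sq_eq:
  assumes "\<And>j. j > D \<Longrightarrow> coeff p j = 0"
  shows "coeff_sq p = (\<Sum>j\<le>D. (cmod (coeff p j))\<^sup>2)"
proof -
  have "degree p \<le> D" using assms by (intro degree_le) auto
  thus ?thesis unfolding coeff_sq_def
    by (intro sum.mono_neutral_left) (auto simp: coeff_eq_0)
qed

lemma sum_le_coeff_sq: "finite A \<Longrightarrow> (\<Sum>j\<in>A. (cmod (coeff p j))\<^sup>2) \<le> coeff_sq p"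
proof -
  assume A: "finite A"
  have "(\<Sum>j\<in>A. (cmod (coeff p j))\<^sup>2) \<le> (\<Sum>j\<in>{..degree p} \<union> A. (cmod (coeff p j))\<^sup>2)"
    using A by (intro sum_mono2) auto
  also have "\<dots> = coeff_sq p"
    unfolding coeff_sq_def using A by (intro sum.mono_neutral_right) (auto simp: coeff_eq_0)
  finally show ?thesis .
qed

lemma sum_norm_poly_le_coeff_sq:
  assumes "degree p < N" "0 \<le> R" "R \<le> 1"
  shows "(\<Sum>i<N. (cmod (poly p (of_real R * unit_root N i)))\<^sup>2) \<le> real N * coeff_sq p"
  unfolding sum_norm_poly_square[OF assms(1)] coeff_sq_def
proof (intro mult_left_mono sum_mono)
  fix j
  have "(R ^ j * cmod (coeff p j)) ^ 2 \<le> (1 * cmod (coeff p j)) ^ 2"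
    using assms by (intro power_mono mult_right_mono power_le_one) auto
  thus "(R ^ j * cmod (coeff p j)) ^ 2 \<le> (cmod (coeff p j))\<^sup>2" by simp
qed simp

text \<open>
  By Parseval's identity on sufficiently many roots of unity, \<open>coeff_sq\<close> is the mean square on the unit circle.
\<close>

lemma coeff_sq_mult_bounded:
  assumes f: "\<And>z. cmod z \<le> 1 \<Longrightarrow> cmod (poly f z) \<le> B"
  shows "coeff_sq (f * p) \<le> B\<^sup>2 * coeff_sq p"
proof -
  define N where "N = Suc (degree (f * p) + degree p)"
  have B: "0 \<le> B" using f[of 0] norm_ge_zero[of "poly f 0"] by (simp del: norm_ge_zero)
  have eq: "real N * coeff_sq g = (\<Sum>i<N. (cmod (poly g (unit_root N i)))\<^sup>2)" if "degree g < N" for g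
    using sum_norm_poly_square[OF that, of 1] by (simp add: coeff_sq_def)
  have "real N * coeff_sq (f * p) = (\<Sum>i<N. (cmod (poly (f * p) (unit_root N i)))\<^sup>2)"
    by (rule eq) (simp add: N_def)
  also have "\<dots> \<le> (\<Sum>i<N. B\<^sup>2 * (cmod (poly p (unit_root N i)))\<^sup>2)"
    using f by (intro sum_mono) (auto simp: norm_mult power_mult_distrib intro!: mult_right_mono power_mono)
  also have "\<dots> = real N * (B\<^sup>2 * coeff_sq p)"
    using eq[of p] by (simp add: N_def sum_distrib_left[symmetric])
  finally show ?thesis by (simp add: N_def)
qed

text \<open>
  The factor \<open>R k ^ (2 ^ Suc k - 1)\<close> stays above \<open>1/4\<close> since the exponent is of the order of the inverse of
  \<open>1 - R k\<close>, and the gap of the radii is half of \<open>1 - R k\<close>. This is where degrees and radii are matched.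
\<close>

lemma lacunary_weight:
  fixes k :: nat
  defines "R \<equiv> \<lambda>k. 1 - 1 / 2 ^ Suc k :: real"
  shows "1 / (8 * 2 ^ Suc k) \<le> ((R (Suc k))\<^sup>2 - (R k)\<^sup>2) / R (Suc k) * R k ^ (2 ^ Suc k - 1)"
proof -
  define n :: nat where "n = 2 ^ k"
  have n: "n \<ge> 1" by (simp add: n_def)
  have "(1::real) < 2 * 2 ^ k"
    using one_le_power[of "2::real" k] by linarith
  hence R: "0 < R k" "R k < R (Suc k)" "R k \<le> 1"
    by (auto simp: R_def field_simps)
  have "R (Suc k) - R k \<le> ((R (Suc k))\<^sup>2 - (R k)\<^sup>2) / R (Suc k)"
  proof -
    have "(R (Suc k) - R k) * R (Suc k) \<le> (R (Suc k) - R k) * (R (Suc k) + R k)"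
      using R by (intro mult_left_mono) auto
    also have "\<dots> = (R (Suc k))\<^sup>2 - (R k)\<^sup>2" by (simp add: power2_eq_square algebra_simps)
    finally show ?thesis using R by (simp add: pos_le_divide_eq)
  qed
  moreover have "R (Suc k) - R k = 1 / (2 * 2 ^ Suc k)"
    by (simp add: R_def field_simps)
  moreover have "1 / 4 \<le> R k ^ (2 ^ Suc k - 1)"
  proof -
    have "1 / 2 \<le> R k ^ n"
    proof -
      have "1 + real n * (- (1 / 2 ^ Suc k)) \<le> (1 + (- (1 / 2 ^ Suc k))) ^ n"
        using R(1) unfolding R_def by (intro Bernoulli_inequality) linarith
      thus ?thesis by (simp add: R_def n_def)
    qed
    hence "(1 / 2) ^ 2 \<le> (R k ^ n) ^ 2" by (intro power_mono) auto
    also have "\<dots> = R k ^ (2 ^ Suc k)" by (simp add: n_def mult.commute flip: power_mult)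
    also have "\<dots> \<le> R k ^ (2 ^ Suc k - 1)" using R by (intro power_decreasing) auto
    finally show ?thesis by (simp add: power2_eq_square)
  qed
  ultimately have "1 / (2 * 2 ^ Suc k) * (1 / 4) \<le> ((R (Suc k))\<^sup>2 - (R k)\<^sup>2) / R (Suc k) * R k ^ (2 ^ Suc k - 1)"
    using R by (intro mult_mono) (auto intro!: divide_nonneg_nonneg power_mono)
  thus ?thesis by simp
qed

text \<open>
  The square function estimate for the polynomials \<open>\<beta>\<^sub>l = \<langle>C\<^sub>l X, Y\<rangle>\<close>, for which \<open>|\<Sum> a\<^sub>l \<beta>\<^sub>l| \<le> |a| |X| |Y|\<close>
  by the anticommutation relations.
\<close>

lemma lacunary_functional_bound:
  fixes f :: "complex poly" and X Y :: "nat set \<Rightarrow> complex poly" and K :: nat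
  assumes f: "\<And>z. cmod z \<le> 1 \<Longrightarrow> cmod (poly f z) \<le> 1"
  defines "\<beta> \<equiv> \<lambda>l. \<Sum>S'\<in>Pow {..<K}. \<Sum>S\<in>Pow {..<K}. Polynomial.smult (of_real (car l S' S)) (X S * Y S')"
  shows "cmod (\<Sum>k<K. coeff (pderiv f * \<beta> k) (2 ^ Suc k - 1) / 2 ^ Suc k) \<le>
    8 * sqrt 8 * (sqrt (\<Sum>S\<in>Pow {..<K}. coeff_sq (X S)) * sqrt (\<Sum>S\<in>Pow {..<K}. coeff_sq (Y S)))"
proof -
  let ?P = "Pow {..<K}"
  define R :: "nat \<Rightarrow> real" where "R k = 1 - 1 / 2 ^ Suc k" for k
  define w where "w k = ((R (Suc k))\<^sup>2 - (R k)\<^sup>2) / R (Suc k) * R k ^ (2 ^ Suc k - 1)" for k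
  \<comment> \<open>The damping \<open>t\<close> turns the weights that the chain produces into \<open>2^-(k+1) / 8\<close>.\<close>
  define t where "t k = 1 / (8 * 2 ^ Suc k) / w k" for k
  define nrm where "nrm X z = sqrt (\<Sum>S\<in>?P. (cmod (poly (X S) z))\<^sup>2)" for X :: "nat set \<Rightarrow> complex poly" and z
  define q where "q z = nrm X z * nrm Y z" for z
  have "(1::real) < 2 * 2 ^ k" for k :: nat
    using one_le_power[of "2::real" k] by linarith
  hence R: "0 < R k" "R k < R (Suc k)" "R k \<le> 1" for k
    by (auto simp: R_def field_simps)
  have w: "1 / (8 * 2 ^ Suc k) \<le> w k" for k
    using lacunary_weight[of k] by (simp only: w_def R_def)
  have wpos: "0 < w k" for k
    by (rule order.strict_trans2[OF _ w]) simp
  have t: "\<bar>t k\<bar> \<le> 1" for k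
  proof -
    have "t k \<le> 1" unfolding t_def using w[of k] wpos[of k] by (simp only: divide_le_eq_1_pos)
    moreover have "0 \<le> t k" unfolding t_def using wpos[of k] by simp
    ultimately show ?thesis by simp
  qed
  have tw: "t k * ((R (Suc k))\<^sup>2 - (R k)\<^sup>2) / R (Suc k) * R k ^ (2 ^ Suc k - 1) = 1 / (8 * 2 ^ Suc k)" for k
  proof -
    have "t k * ((R (Suc k))\<^sup>2 - (R k)\<^sup>2) / R (Suc k) * R k ^ (2 ^ Suc k - 1) = t k * w k"
      by (simp add: w_def)
    thus ?thesis using wpos[of k] by (simp add: t_def)
  qed
  have nrm0: "0 \<le> nrm X z" for X z by (simp add: nrm_def sum_nonneg)
  have q0: "0 \<le> q z" for z by (simp add: q_def nrm0)
  have q: "cmod (\<Sum>l<K. a l * poly (\<beta> l) z) \<le> sqrt (\<Sum>l<K. (cmod (a l))\<^sup>2) * q z" for a z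
  proof -
    define U where "U S' = (\<Sum>l<K. \<Sum>S\<in>?P. a l * car l S' S * poly (X S) z)" for S'
    have "(\<Sum>l<K. a l * poly (\<beta> l) z) = (\<Sum>l<K. \<Sum>S'\<in>?P. \<Sum>S\<in>?P. a l * (of_real (car l S' S) * (poly (X S) z * poly (Y S') z)))"
      by (simp add: \<beta>_def poly_sum sum_distrib_left)
    also have "\<dots> = (\<Sum>S'\<in>?P. \<Sum>l<K. \<Sum>S\<in>?P. a l * (of_real (car l S' S) * (poly (X S) z * poly (Y S') z)))"
      by (rule sum.swap)
    also have "\<dots> = (\<Sum>S'\<in>?P. U S' * poly (Y S') z)"
      unfolding U_def sum_distrib_right by (simp only: mult.assoc)
    finally have eq: "(\<Sum>l<K. a l * poly (\<beta> l) z) = (\<Sum>S'\<in>?P. U S' * poly (Y S') z)" .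
    have "cmod (\<Sum>S'\<in>?P. U S' * poly (Y S') z) \<le> (\<Sum>S'\<in>?P. \<bar>cmod (U S')\<bar> * \<bar>cmod (poly (Y S') z)\<bar>)"
      by (rule sum_norm_le) (simp add: norm_mult)
    also have "\<dots> \<le> L2_set (\<lambda>S'. cmod (U S')) ?P * L2_set (\<lambda>S'. cmod (poly (Y S') z)) ?P"
      by (rule L2_set_mult_ineq)
    also have "\<dots> \<le> (sqrt (\<Sum>l<K. (cmod (a l))\<^sup>2) * nrm X z) * nrm Y z"
    proof (rule mult_mono)
      show "L2_set (\<lambda>S'. cmod (U S')) ?P \<le> sqrt (\<Sum>l<K. (cmod (a l))\<^sup>2) * nrm X z"
        unfolding L2_set_def nrm_def real_sqrt_mult[symmetric] U_def
        using car_combination_bound[where a = a and K = K and \<xi> = "\<lambda>S. poly (X S) z"] by (rule real_sqrt_le_mono)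
    qed (auto simp: L2_set_def nrm_def sum_nonneg)
    finally show ?thesis unfolding eq q_def by (simp only: mult.assoc)
  qed
  have "\<forall>\<^sub>F N in sequentially. real N * cmod (\<Sum>k<K. of_real (t k * ((R (Suc k))\<^sup>2 - (R k)\<^sup>2) / R (Suc k) * R k ^ (2 ^ Suc k - 1))
      * coeff (pderiv f * \<beta> k) (2 ^ Suc k - 1)) \<le> sqrt 8 * (\<Sum>i<N. q (of_real (R K) * unit_root N i))"
    by (rule poly_derivative_functional_bound[where R = R and t = t and q = q, OF f R t q q0])
  moreover have "\<forall>\<^sub>F N in sequentially. \<forall>S\<in>?P. degree (X S) < N"
    by (intro eventually_ball_finite ballI eventually_gt_at_top) simp
  moreover have "\<forall>\<^sub>F N in sequentially. \<forall>S\<in>?P. degree (Y S) < N"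
    by (intro eventually_ball_finite ballI eventually_gt_at_top) simp
  moreover have "\<forall>\<^sub>F N in sequentially. 0 < (N :: nat)"
    by (rule eventually_gt_at_top)
  ultimately have "\<forall>\<^sub>F N in sequentially. real N * cmod (\<Sum>k<K. of_real (t k * ((R (Suc k))\<^sup>2 - (R k)\<^sup>2) / R (Suc k) * R k ^ (2 ^ Suc k - 1))
      * coeff (pderiv f * \<beta> k) (2 ^ Suc k - 1)) \<le> sqrt 8 * (\<Sum>i<N. q (of_real (R K) * unit_root N i)) \<and>
     (\<forall>S\<in>?P. degree (X S) < N) \<and> (\<forall>S\<in>?P. degree (Y S) < N) \<and> 0 < N"
    by eventually_elim simp
  then obtain N where N: "real N * cmod (\<Sum>k<K. of_real (t k * ((R (Suc k))\<^sup>2 - (R k)\<^sup>2) / R (Suc k) * R k ^ (2 ^ Suc k - 1))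
      * coeff (pderiv f * \<beta> k) (2 ^ Suc k - 1)) \<le> sqrt 8 * (\<Sum>i<N. q (of_real (R K) * unit_root N i))"
     "\<forall>S\<in>?P. degree (X S) < N" "\<forall>S\<in>?P. degree (Y S) < N" "0 < N"
    using eventually_happens'[OF sequentially_bot] by blast
  define Z where "Z = (\<Sum>k<K. coeff (pderiv f * \<beta> k) (2 ^ Suc k - 1) / 2 ^ Suc k)"
  have Z: "(\<Sum>k<K. of_real (t k * ((R (Suc k))\<^sup>2 - (R k)\<^sup>2) / R (Suc k) * R k ^ (2 ^ Suc k - 1))
      * coeff (pderiv f * \<beta> k) (2 ^ Suc k - 1)) = Z / 8"
    unfolding tw Z_def sum_divide_distrib by (intro sum.cong) auto
  have avg: "(\<Sum>i<N. (nrm X (of_real (R K) * unit_root N i))\<^sup>2) \<le> real N * (\<Sum>S\<in>?P. coeff_sq (X S))"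
    if "\<forall>S\<in>?P. degree (X S) < N" for X
  proof -
    have "(\<Sum>i<N. (nrm X (of_real (R K) * unit_root N i))\<^sup>2) = (\<Sum>S\<in>?P. \<Sum>i<N. (cmod (poly (X S) (of_real (R K) * unit_root N i)))\<^sup>2)"
      unfolding nrm_def by (subst sum.swap) (simp add: sum_nonneg)
    also have "\<dots> \<le> (\<Sum>S\<in>?P. real N * coeff_sq (X S))"
      using that R[of K] by (intro sum_mono sum_norm_poly_le_coeff_sq) auto
    finally show ?thesis by (simp add: sum_distrib_left)
  qed
  have "(\<Sum>i<N. q (of_real (R K) * unit_root N i)) = (\<Sum>i<N. \<bar>nrm X (of_real (R K) * unit_root N i)\<bar> * \<bar>nrm Y (of_real (R K) * unit_root N i)\<bar>)"
    by (simp add: q_def nrm0)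
  also have "\<dots> \<le> L2_set (\<lambda>i. nrm X (of_real (R K) * unit_root N i)) {..<N} * L2_set (\<lambda>i. nrm Y (of_real (R K) * unit_root N i)) {..<N}"
    by (rule L2_set_mult_ineq)
  also have "\<dots> \<le> sqrt (real N * (\<Sum>S\<in>?P. coeff_sq (X S))) * sqrt (real N * (\<Sum>S\<in>?P. coeff_sq (Y S)))"
    unfolding L2_set_def using avg[OF N(2)] avg[OF N(3)]
    by (intro mult_mono real_sqrt_le_mono) (auto simp: sum_nonneg coeff_sq_nonneg)
  also have "\<dots> = real N * (sqrt (\<Sum>S\<in>?P. coeff_sq (X S)) * sqrt (\<Sum>S\<in>?P. coeff_sq (Y S)))"
    by (simp add: real_sqrt_mult)
  finally have "(\<Sum>i<N. q (of_real (R K) * unit_root N i)) \<le> \<dots>" .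
  hence "sqrt 8 * (\<Sum>i<N. q (of_real (R K) * unit_root N i)) \<le>
     sqrt 8 * (real N * (sqrt (\<Sum>S\<in>?P. coeff_sq (X S)) * sqrt (\<Sum>S\<in>?P. coeff_sq (Y S))))"
    by (rule mult_left_mono) simp
  with N(1) have "real N * cmod (Z / 8) \<le> real N * (sqrt 8 * (sqrt (\<Sum>S\<in>?P. coeff_sq (X S)) * sqrt (\<Sum>S\<in>?P. coeff_sq (Y S))))"
    unfolding Z by (simp only: mult.left_commute)
  hence "cmod (Z / 8) \<le> sqrt 8 * (sqrt (\<Sum>S\<in>?P. coeff_sq (X S)) * sqrt (\<Sum>S\<in>?P. coeff_sq (Y S)))"
    using N(4) by (simp only: mult_le_cancel_left_pos of_nat_0_less_iff)
  thus ?thesis unfolding Z_def[symmetric] by (simp add: norm_divide)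
qed

notation fps_nth (infixl "$" 75)

text \<open>
  The vector-valued power series \<open>D x\<close> of block \<open>K\<close>. The shift by \<open>2^K - 2^(k+1) + 1\<close> is chosen such that the
  derivative of \<open>X^(2^(k+1))\<close> times the \<open>k\<close>-th summand, for constant \<open>x\<close>, has degree exactly \<open>2^K\<close>, the
  largest degree that is kept. Counting degrees of \<open>D x\<close> backwards from \<open>2^K\<close> turns \<open>D\<close>
  into a Hankel operator.
\<close>

definition block_der :: "nat \<Rightarrow> (nat set \<Rightarrow> complex fps) \<Rightarrow> nat set \<Rightarrow> complex fps" where
  "block_der K x S' = (\<Sum>k<K. \<Sum>S\<in>Pow {..<K}.
     fps_const (of_real (car k S' S) / 2 ^ Suc k) * (fps_X ^ (2 ^ K - 2 ^ Suc k + 1) * x S))"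

lemma nth_mult_block_der:
  "(g * block_der K x S') $ n = (\<Sum>k<K. \<Sum>S\<in>Pow {..<K}. of_real (car k S' S) / 2 ^ Suc k *
    (if n < 2 ^ K - 2 ^ Suc k + 1 then 0 else (g * x S) $ (n - (2 ^ K - 2 ^ Suc k + 1))))"
proof -
  have *: "g * (fps_const c * (fps_X ^ m * x S)) = fps_const c * (fps_X ^ m * (g * x S))" for c m S
    by (simp only: mult_ac)
  show ?thesis
    unfolding block_der_def sum_distrib_left * fps_sum_nth fps_mult_left_const_nth fps_X_power_mult_nth ..
qed

text \<open>
  Truncation after degree \<open>2^K\<close> is compatible with the derivation, since \<open>block_der\<close> only raises degrees.
\<close>

lemma block_der_cong_low:
  assumes "\<And>S n. S \<in> Pow {..<K} \<Longrightarrow> n \<le> 2 ^ K \<Longrightarrow> x S $ n = y S $ n" "n \<le> 2 ^ K"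
  shows "(g * block_der K x S') $ n = (g * block_der K y S') $ n"
  unfolding nth_mult_block_der using assms
  by (intro sum.cong refl arg_cong2[of _ _ _ _ "(*)"] if_cong) (auto simp: fps_mult_nth intro!: sum.cong)

lemma coeff_sum_monom: 
  "coeff (\<Sum>n\<le>M. monom (x n) n) j = (if j \<le> M then x j else (0::complex))"
  by (simp add: coeff_sum)

lemma fps_of_poly_mult_nth_low:
  fixes f :: "complex poly"
  assumes "n \<le> M"
  shows "(fps_of_poly f * x) $ n = coeff (f * (\<Sum>n\<le>M. monom (x $ n) n)) n"
  using assms unfolding coeff_mult fps_mult_nth atMost_atLeast0[symmetric]
  by (intro sum.cong) (auto simp: coeff_sum_monom)

lemma sum_reverse_window:
  fixes G w :: "nat \<Rightarrow> complex"
  assumes "1 \<le> m" "m \<le> M"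
  shows "(\<Sum>n\<le>M. (if n < M - m + 1 then 0 else G (n - (M - m + 1))) * w n) = (\<Sum>q\<le>m - 1. G q * w (M - (m - 1 - q)))"
proof -
  have "(\<Sum>n\<le>M. (if n < M - m + 1 then 0 else G (n - (M - m + 1))) * w n) =
     (\<Sum>n\<in>{M - m + 1..M}. G (n - (M - m + 1)) * w n)"
    by (intro sum.mono_neutral_cong_right) auto
  also have "\<dots> = (\<Sum>q\<le>m - 1. G q * w (M - (m - 1 - q)))"
    using assms by (intro sum.reindex_bij_witness[of _ "\<lambda>q. q + (M - m + 1)" "\<lambda>n. n - (M - m + 1)"]) auto
  finally show ?thesis .
qed

lemma sum_rotate4:
  "(\<Sum>a\<in>A. \<Sum>b\<in>B. \<Sum>c\<in>C. \<Sum>d\<in>D. f a b c d) = (\<Sum>c\<in>C. \<Sum>a\<in>A. \<Sum>d\<in>D. \<Sum>b\<in>B. f a b c d)"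
proof -
  have "(\<Sum>a\<in>A. \<Sum>b\<in>B. \<Sum>c\<in>C. \<Sum>d\<in>D. f a b c d) = (\<Sum>a\<in>A. \<Sum>c\<in>C. \<Sum>d\<in>D. \<Sum>b\<in>B. f a b c d)"
    by (intro sum.cong[OF refl] sum_rotate3)
  also have "\<dots> = (\<Sum>c\<in>C. \<Sum>a\<in>A. \<Sum>d\<in>D. \<Sum>b\<in>B. f a b c d)"
    by (rule sum.swap)
  finally show ?thesis .
qed

text \<open>
  Duality: the square sum \<open>W\<close> of the coefficients \<open>w\<close> is the functional of \<open>lacunary_functional_bound\<close> at
  \<open>x\<close> and at the conjugate of \<open>w\<close> read backwards, so \<open>W \<le> 8 \<surd>8 \<surd>A \<surd>W\<close>.
\<close>

lemma derivation_bound_poly: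
  fixes f :: "complex poly" and x :: "nat set \<Rightarrow> complex fps" and K :: nat
  assumes f: "\<And>z. cmod z \<le> 1 \<Longrightarrow> cmod (poly f z) \<le> 1"
  defines "w \<equiv> \<lambda>S' n. (fps_deriv (fps_of_poly f) * block_der K x S') $ n"
  shows "(\<Sum>S'\<in>Pow {..<K}. \<Sum>n\<le>2 ^ K. (cmod (w S' n))\<^sup>2) \<le>
    512 * (\<Sum>S\<in>Pow {..<K}. \<Sum>n\<le>2 ^ K. (cmod (x S $ n))\<^sup>2)"
proof -
  let ?P = "Pow {..<K}"
  define M :: nat where "M = 2 ^ K"
  define X where "X S = (\<Sum>n\<le>M. monom (x S $ n) n)" for S
  define Y where "Y S = (\<Sum>q\<le>M. monom (cnj (w S (M - q))) q)" for S
  define \<beta> where "\<beta> l = (\<Sum>S'\<in>?P. \<Sum>S\<in>?P. Polynomial.smult (of_real (car l S' S)) (X S * Y S'))" for l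
  define A where "A = (\<Sum>S\<in>?P. \<Sum>n\<le>M. (cmod (x S $ n))\<^sup>2)"
  define W where "W = (\<Sum>S'\<in>?P. \<Sum>n\<le>M. (cmod (w S' n))\<^sup>2)"
  have X: "coeff_sq (X S) = (\<Sum>n\<le>M. (cmod (x S $ n))\<^sup>2)" for S
    unfolding X_def by (subst coeff_sq_eq[of M]) (auto simp: coeff_sum_monom)
  have Y: "coeff_sq (Y S) = (\<Sum>n\<le>M. (cmod (w S n))\<^sup>2)" for S
  proof -
    have "coeff_sq (Y S) = (\<Sum>q\<le>M. (cmod (w S (M - q)))\<^sup>2)"
      unfolding Y_def by (subst coeff_sq_eq[of M]) (auto simp: coeff_sum_monom)
    also have "\<dots> = (\<Sum>n\<le>M. (cmod (w S n))\<^sup>2)"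
      by (intro sum.reindex_bij_witness[of _ "\<lambda>q. M - q" "\<lambda>q. M - q"]) auto
    finally show ?thesis .
  qed
  have Mk: "1 \<le> (2::nat) ^ Suc k" "2 ^ Suc k \<le> M" if "k < K" for k
  proof -
    show "2 ^ Suc k \<le> M" unfolding M_def using that by (intro power_increasing) auto
    show "1 \<le> (2::nat) ^ Suc k" by (rule one_le_power) simp
  qed
  have conv: "(\<Sum>n\<le>M. (if n < M - 2 ^ Suc k + 1 then 0 else (fps_deriv (fps_of_poly f) * x S) $ (n - (M - 2 ^ Suc k + 1))) * cnj (w S' n))
      = coeff (pderiv f * (X S * Y S')) (2 ^ Suc k - 1)" if k: "k < K" for k S S'
  proof -
    define m :: nat where "m = 2 ^ Suc k"
    have m: "1 \<le> m" "m \<le> M" using Mk[OF k] by (auto simp: m_def)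
    have "(\<Sum>n\<le>M. (if n < M - m + 1 then 0 else (fps_deriv (fps_of_poly f) * x S) $ (n - (M - m + 1))) * cnj (w S' n))
       = (\<Sum>q\<le>m - 1. (fps_deriv (fps_of_poly f) * x S) $ q * cnj (w S' (M - (m - 1 - q))))"
      by (rule sum_reverse_window[OF m])
    also have "\<dots> = (\<Sum>q\<le>m - 1. coeff (pderiv f * X S) q * coeff (Y S') (m - 1 - q))"
    proof (intro sum.cong refl)
      fix q assume "q \<in> {..m - 1}"
      hence q: "q \<le> M" "m - 1 - q \<le> M" using m by auto
      have "(fps_deriv (fps_of_poly f) * x S) $ q = coeff (pderiv f * X S) q"
        unfolding X_def fps_of_poly_pderiv[symmetric] by (rule fps_of_poly_mult_nth_low[OF q(1)])
      moreover have "coeff (Y S') (m - 1 - q) = cnj (w S' (M - (m - 1 - q)))"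
        using q by (simp add: Y_def coeff_sum_monom)
      ultimately show "(fps_deriv (fps_of_poly f) * x S) $ q * cnj (w S' (M - (m - 1 - q))) =
          coeff (pderiv f * X S) q * coeff (Y S') (m - 1 - q)" by simp
    qed
    also have "\<dots> = coeff (pderiv f * (X S * Y S')) (m - 1)"
      unfolding mult.assoc[symmetric] coeff_mult[of "pderiv f * X S"] ..
    finally show ?thesis unfolding m_def .
  qed
  have "complex_of_real W = (\<Sum>S'\<in>?P. \<Sum>n\<le>M. w S' n * cnj (w S' n))"
    unfolding W_def by (simp only: of_real_sum complex_norm_square)
  also have "\<dots> = (\<Sum>S'\<in>?P. \<Sum>n\<le>M. \<Sum>k<K. \<Sum>S\<in>?P. of_real (car k S' S) / 2 ^ Suc k *
     ((if n < M - 2 ^ Suc k + 1 then 0 else (fps_deriv (fps_of_poly f) * x S) $ (n - (M - 2 ^ Suc k + 1))) * cnj (w S' n)))"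
    by (subst (1) w_def) (simp only: nth_mult_block_der sum_distrib_right M_def mult.assoc)
  also have "\<dots> = (\<Sum>k<K. \<Sum>S'\<in>?P. \<Sum>S\<in>?P. \<Sum>n\<le>M. of_real (car k S' S) / 2 ^ Suc k *
     ((if n < M - 2 ^ Suc k + 1 then 0 else (fps_deriv (fps_of_poly f) * x S) $ (n - (M - 2 ^ Suc k + 1))) * cnj (w S' n)))"
    by (rule sum_rotate4)
  also have "\<dots> = (\<Sum>k<K. \<Sum>S'\<in>?P. \<Sum>S\<in>?P. of_real (car k S' S) / 2 ^ Suc k *
     coeff (pderiv f * (X S * Y S')) (2 ^ Suc k - 1))"
    unfolding sum_distrib_left[symmetric] using conv by simp
  also have "\<dots> = (\<Sum>k<K. coeff (pderiv f * \<beta> k) (2 ^ Suc k - 1) / 2 ^ Suc k)"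
    unfolding \<beta>_def sum_distrib_left coeff_sum sum_divide_distrib mult_smult_right coeff_smult
    by (intro sum.cong refl) simp
  finally have eq: "complex_of_real W = (\<Sum>k<K. coeff (pderiv f * \<beta> k) (2 ^ Suc k - 1) / 2 ^ Suc k)" .
  have W0: "0 \<le> W" and A0: "0 \<le> A" by (auto simp: W_def A_def intro!: sum_nonneg)
  have "W = cmod (complex_of_real W)" using W0 by simp
  also have "\<dots> \<le> 8 * sqrt 8 * (sqrt (\<Sum>S\<in>?P. coeff_sq (X S)) * sqrt (\<Sum>S\<in>?P. coeff_sq (Y S)))"
    unfolding eq \<beta>_def by (rule lacunary_functional_bound[OF f])
  also have "\<dots> = 8 * sqrt 8 * (sqrt A * sqrt W)"
    unfolding X Y A_def W_def ..
  finally have "W \<le> 8 * sqrt 8 * (sqrt A * sqrt W)" .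
  hence "sqrt W * sqrt W \<le> (8 * sqrt 8 * sqrt A) * sqrt W"
    using W0 by (simp add: mult_ac)
  hence "sqrt W \<le> 8 * sqrt 8 * sqrt A"
    using W0 A0 by (cases "W = 0") (auto intro: mult_right_le_imp_le[of _ "sqrt W"])
  hence "(sqrt W)\<^sup>2 \<le> (8 * sqrt 8 * sqrt A)\<^sup>2"
    using W0 by (intro power_mono) auto
  hence "W \<le> 512 * A" using W0 A0 by (simp add: power_mult_distrib)
  thus ?thesis unfolding W_def A_def M_def .
qed

lemma multiplication_bound_poly:
  fixes f :: "complex poly" and x :: "complex fps"
  assumes f: "\<And>z. cmod z \<le> 1 \<Longrightarrow> cmod (poly f z) \<le> 1"
  shows "(\<Sum>n\<le>M. (cmod ((fps_of_poly f * x) $ n))\<^sup>2) \<le> (\<Sum>n\<le>M. (cmod (x $ n))\<^sup>2)"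
proof -
  define X where "X = (\<Sum>n\<le>M. monom (x $ n) n)"
  have "(\<Sum>n\<le>M. (cmod ((fps_of_poly f * x) $ n))\<^sup>2) = (\<Sum>n\<le>M. (cmod (coeff (f * X) n))\<^sup>2)"
    unfolding X_def by (intro sum.cong refl) (subst fps_of_poly_mult_nth_low, auto)
  also have "\<dots> \<le> coeff_sq (f * X)" by (rule sum_le_coeff_sq) simp
  also have "\<dots> \<le> 1\<^sup>2 * coeff_sq X" by (rule coeff_sq_mult_bounded[OF f])
  also have "coeff_sq X = (\<Sum>n\<le>M. (cmod (x $ n))\<^sup>2)"
    unfolding X_def by (subst coeff_sq_eq[of M]) (auto simp: coeff_sum_monom)
  finally show ?thesis by simp
qed

text \<open>
  Taylor polynomials of the dilations \<open>\<phi> (r z)\<close> with \<open>r < 1\<close>, whose series converge uniformly on the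
  closed disc.
\<close>

lemma bounded_holomorphic_poly_approx:
  assumes hol: "\<phi> holomorphic_on ball 0 1" and B: "\<And>z. cmod z < 1 \<Longrightarrow> cmod (\<phi> z) \<le> B"
  obtains p :: "nat \<Rightarrow> complex poly" where
    "\<And>m z. cmod z \<le> 1 \<Longrightarrow> cmod (poly (p m) z) \<le> B + 1 / Suc m"
    "\<And>j. (\<lambda>m. coeff (p m) j) \<longlonglongrightarrow> fps_expansion \<phi> 0 $ j"
proof -
  define c where "c j = fps_expansion \<phi> 0 $ j" for j
  have sums: "(\<lambda>j. c j * z ^ j) sums \<phi> z" if "cmod z < 1" for z
    using holomorphic_power_series[OF hol, of z] that by (simp add: c_def fps_expansion_def)
  define r :: "nat \<Rightarrow> real" where "r m = 1 - 1 / real (m + 2)" for m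
  have r: "0 \<le> r m" "r m < 1" for m by (auto simp: r_def field_simps)
  have abs_sum: "summable (\<lambda>j. cmod (c j) * r m ^ j)" for m
  proof -
    define s where "s = (1 + r m) / 2"
    have s: "r m < s" "s < 1" "0 \<le> s" using r[of m] by (auto simp: s_def)
    have "summable (\<lambda>j. c j * of_real s ^ j)"
      using sums[of "of_real s"] s by (intro sums_summable) auto
    hence "summable (\<lambda>j. norm (c j * of_real (r m) ^ j))"
      using r[of m] s by (intro powser_insidea[where x = "of_real s"]) auto
    thus ?thesis using r[of m] by (simp add: norm_mult norm_power)
  qed
  have "\<exists>n. n > m \<and> (\<Sum>j. cmod (c (j + n)) * r m ^ (j + n)) < 1 / Suc m" for m
  proof -
    have "(\<lambda>n. \<Sum>j. cmod (c (j + n)) * r m ^ (j + n)) \<longlonglongrightarrow> 0"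
      using suminf_exist_split2[OF abs_sum[of m]] by simp
    hence "\<forall>\<^sub>F n in sequentially. (\<Sum>j. cmod (c (j + n)) * r m ^ (j + n)) < 1 / Suc m"
      by (rule order_tendstoD) simp
    moreover have "\<forall>\<^sub>F n in sequentially. n > m" by (rule eventually_gt_at_top)
    ultimately have "\<forall>\<^sub>F n in sequentially. n > m \<and> (\<Sum>j. cmod (c (j + n)) * r m ^ (j + n)) < 1 / Suc m"
      by eventually_elim simp
    thus ?thesis using eventually_happens'[OF sequentially_bot] by blast
  qed
  then obtain n where n: "\<And>m. n m > m" "\<And>m. (\<Sum>j. cmod (c (j + n m)) * r m ^ (j + n m)) < 1 / Suc m"
    by metis
  define p where "p m = (\<Sum>j<n m. monom (c j * of_real (r m) ^ j) j)" for m
  show ?thesis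
  proof
    fix m z assume z: "cmod z \<le> 1"
    define y where "y = of_real (r m) * z"
    have y: "cmod y < 1" "cmod y \<le> r m"
      using r[of m] z mult_left_le[of "cmod z" "r m"] by (auto simp: y_def norm_mult)
    have py: "poly (p m) z = (\<Sum>j<n m. c j * y ^ j)"
      by (simp add: p_def y_def poly_sum poly_monom power_mult_distrib mult_ac)
    have le: "norm (c j * y ^ j) \<le> cmod (c j) * r m ^ j" for j
      using y by (auto simp: norm_mult norm_power intro!: mult_left_mono power_mono)
    have sumle: "summable (\<lambda>j. norm (c (j + n m) * y ^ (j + n m)))"
      by (rule summable_comparison_test'[OF summable_ignore_initial_segment[OF abs_sum[of m], of "n m"], of 0])
        (use le in auto)
    have "\<phi> y = (\<Sum>j. c j * y ^ j)" using sums[OF y(1)] by (simp add: sums_iff)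
    also have "\<dots> = (\<Sum>j. c (j + n m) * y ^ (j + n m)) + poly (p m) z"
      unfolding py using sums[OF y(1)] by (intro suminf_split_initial_segment) (simp add: sums_iff)
    finally have "poly (p m) z = \<phi> y - (\<Sum>j. c (j + n m) * y ^ (j + n m))" by simp
    hence "cmod (poly (p m) z) \<le> cmod (\<phi> y) + cmod (\<Sum>j. c (j + n m) * y ^ (j + n m))"
      using norm_triangle_ineq4 by simp
    also have "cmod (\<Sum>j. c (j + n m) * y ^ (j + n m)) \<le> (\<Sum>j. norm (c (j + n m) * y ^ (j + n m)))"
      by (rule summable_norm[OF sumle])
    also have "\<dots> \<le> (\<Sum>j. cmod (c (j + n m)) * r m ^ (j + n m))"
      by (rule suminf_le[OF le sumle summable_ignore_initial_segment[OF abs_sum]])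
    also have "\<dots> \<le> 1 / Suc m" using n(2)[of m] by simp
    also have "cmod (\<phi> y) \<le> B" by (rule B[OF y(1)])
    finally show "cmod (poly (p m) z) \<le> B + 1 / Suc m" by simp
  next
    fix j
    have "(\<lambda>m. c j * of_real (r m) ^ j) \<longlonglongrightarrow> c j * of_real 1 ^ j"
    proof (intro tendsto_intros)
      have "(\<lambda>m. 1 - 1 / real (m + 2)) \<longlonglongrightarrow> 1 - 0"
        by (intro tendsto_intros) (use LIMSEQ_ignore_initial_segment[OF lim_1_over_n, of 2] in simp)
      thus "r \<longlonglongrightarrow> 1" by (simp add: r_def[abs_def])
    qed
    moreover have "\<forall>\<^sub>F m in sequentially. coeff (p m) j = c j * of_real (r m) ^ j"
      using eventually_ge_at_top[of j]
    proof eventually_elim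
      case (elim m)
      thus ?case using n(1)[of m] by (simp add: p_def coeff_sum)
    qed
    ultimately show "(\<lambda>m. coeff (p m) j) \<longlonglongrightarrow> fps_expansion \<phi> 0 $ j"
      unfolding c_def[symmetric] by (subst tendsto_cong) auto
  qed
qed

lemma tendsto_fps_mult_nth:
  fixes F :: "nat \<Rightarrow> complex fps"
  assumes "\<And>j. (\<lambda>m. F m $ j) \<longlonglongrightarrow> G $ j"
  shows "(\<lambda>m. (F m * x) $ n) \<longlonglongrightarrow> (G * x) $ n"
  unfolding fps_mult_nth by (intro tendsto_intros assms)

text \<open>
  Both bounds involve finitely many Taylor coefficients, so they pass to the limit of the approximating
  polynomials.
\<close>

lemma bounded_holomorphic_action_bound:
  assumes hol: "\<phi> holomorphic_on ball 0 1" and B: "\<And>z. cmod z < 1 \<Longrightarrow> cmod (\<phi> z) \<le> B"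
  shows "(\<Sum>n\<le>M. (cmod ((fps_expansion \<phi> 0 * x) $ n))\<^sup>2) \<le> B\<^sup>2 * (\<Sum>n\<le>M. (cmod (x $ n))\<^sup>2)"
    and "(\<Sum>S'\<in>Pow {..<K}. \<Sum>n\<le>2 ^ K. (cmod ((fps_deriv (fps_expansion \<phi> 0) * block_der K X S') $ n))\<^sup>2) \<le>
      512 * B\<^sup>2 * (\<Sum>S\<in>Pow {..<K}. \<Sum>n\<le>2 ^ K. (cmod (X S $ n))\<^sup>2)"
proof -
  obtain p where p: "\<And>m z. cmod z \<le> 1 \<Longrightarrow> cmod (poly (p m) z) \<le> B + 1 / Suc m"
    "\<And>j. (\<lambda>m. coeff (p m) j) \<longlonglongrightarrow> fps_expansion \<phi> 0 $ j"
    using bounded_holomorphic_poly_approx[OF hol B] by metis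
  have B0: "0 \<le> B" using B[of 0] norm_ge_zero[of "\<phi> 0"] by (simp del: norm_ge_zero)
  define b where "b m = B + 1 / Suc m" for m
  have b: "0 < b m" for m using B0 by (simp add: b_def add_nonneg_pos)
  have blim: "b \<longlonglongrightarrow> B"
    using tendsto_add[OF tendsto_const LIMSEQ_inverse_real_of_nat, of B] by (simp add: b_def[abs_def] inverse_eq_divide)
  define u where "u m = Polynomial.smult (of_real (1 / b m)) (p m)" for m
  have u: "cmod (poly (u m) z) \<le> 1" if "cmod z \<le> 1" for m z
  proof -
    have "cmod (poly (p m) z) \<le> b m" unfolding b_def by (rule p(1)[OF that])
    thus ?thesis using b[of m] by (simp add: u_def norm_divide)
  qed
  have pu: "fps_of_poly (p m) = fps_const (of_real (b m)) * fps_of_poly (u m)" for m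
    using b[of m] by (simp add: u_def fps_of_poly_smult flip: mult.assoc fps_const_mult)
  have lim1: "(\<lambda>m. (fps_of_poly (p m) * x) $ n) \<longlonglongrightarrow> (fps_expansion \<phi> 0 * x) $ n" for x n
    by (intro tendsto_fps_mult_nth) (simp add: p(2))
  have lim2: "(\<lambda>m. (fps_deriv (fps_of_poly (p m)) * x) $ n) \<longlonglongrightarrow> (fps_deriv (fps_expansion \<phi> 0) * x) $ n" for x n
    by (intro tendsto_fps_mult_nth) (simp add: p(2) tendsto_mult_left)
  show "(\<Sum>n\<le>M. (cmod ((fps_expansion \<phi> 0 * x) $ n))\<^sup>2) \<le> B\<^sup>2 * (\<Sum>n\<le>M. (cmod (x $ n))\<^sup>2)"
  proof (rule LIMSEQ_le)
    show "(\<lambda>m. \<Sum>n\<le>M. (cmod ((fps_of_poly (p m) * x) $ n))\<^sup>2) \<longlonglongrightarrow> (\<Sum>n\<le>M. (cmod ((fps_expansion \<phi> 0 * x) $ n))\<^sup>2)"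
      by (intro tendsto_intros lim1)
    show "(\<lambda>m. (b m)\<^sup>2 * (\<Sum>n\<le>M. (cmod (x $ n))\<^sup>2)) \<longlonglongrightarrow> B\<^sup>2 * (\<Sum>n\<le>M. (cmod (x $ n))\<^sup>2)"
      by (intro tendsto_intros blim)
    have "(\<Sum>n\<le>M. (cmod ((fps_of_poly (p m) * x) $ n))\<^sup>2) = (b m)\<^sup>2 * (\<Sum>n\<le>M. (cmod ((fps_of_poly (u m) * x) $ n))\<^sup>2)" for m
      using b[of m] by (simp add: pu mult.assoc norm_mult power_mult_distrib sum_distrib_left)
    thus "\<exists>N. \<forall>m\<ge>N. (\<Sum>n\<le>M. (cmod ((fps_of_poly (p m) * x) $ n))\<^sup>2) \<le> (b m)\<^sup>2 * (\<Sum>n\<le>M. (cmod (x $ n))\<^sup>2)"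
      using multiplication_bound_poly[OF u] by (simp add: mult_left_mono)
  qed
  show "(\<Sum>S'\<in>Pow {..<K}. \<Sum>n\<le>2 ^ K. (cmod ((fps_deriv (fps_expansion \<phi> 0) * block_der K X S') $ n))\<^sup>2) \<le>
      512 * B\<^sup>2 * (\<Sum>S\<in>Pow {..<K}. \<Sum>n\<le>2 ^ K. (cmod (X S $ n))\<^sup>2)"
  proof (rule LIMSEQ_le)
    show "(\<lambda>m. \<Sum>S'\<in>Pow {..<K}. \<Sum>n\<le>2 ^ K. (cmod ((fps_deriv (fps_of_poly (p m)) * block_der K X S') $ n))\<^sup>2) \<longlonglongrightarrow>
      (\<Sum>S'\<in>Pow {..<K}. \<Sum>n\<le>2 ^ K. (cmod ((fps_deriv (fps_expansion \<phi> 0) * block_der K X S') $ n))\<^sup>2)"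
      by (intro tendsto_intros lim2)
    show "(\<lambda>m. 512 * (b m)\<^sup>2 * (\<Sum>S\<in>Pow {..<K}. \<Sum>n\<le>2 ^ K. (cmod (X S $ n))\<^sup>2)) \<longlonglongrightarrow>
       512 * B\<^sup>2 * (\<Sum>S\<in>Pow {..<K}. \<Sum>n\<le>2 ^ K. (cmod (X S $ n))\<^sup>2)"
      by (intro tendsto_intros blim)
    have "(\<Sum>S'\<in>Pow {..<K}. \<Sum>n\<le>2 ^ K. (cmod ((fps_deriv (fps_of_poly (p m)) * block_der K X S') $ n))\<^sup>2) =
       (b m)\<^sup>2 * (\<Sum>S'\<in>Pow {..<K}. \<Sum>n\<le>2 ^ K. (cmod ((fps_deriv (fps_of_poly (u m)) * block_der K X S') $ n))\<^sup>2)" for m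
    proof -
      have "fps_deriv (fps_of_poly (p m)) = fps_const (of_real (b m)) * fps_deriv (fps_of_poly (u m))"
        unfolding pu by (rule fps_deriv_mult_const_left)
      thus ?thesis using b[of m]
        by (simp only: mult.assoc fps_mult_left_const_nth norm_mult power_mult_distrib sum_distrib_left) simp
    qed
    moreover have "(b m)\<^sup>2 * (\<Sum>S'\<in>Pow {..<K}. \<Sum>n\<le>2 ^ K. (cmod ((fps_deriv (fps_of_poly (u m)) * block_der K X S') $ n))\<^sup>2)
        \<le> (b m)\<^sup>2 * (512 * (\<Sum>S\<in>Pow {..<K}. \<Sum>n\<le>2 ^ K. (cmod (X S $ n))\<^sup>2))" for m
      by (intro mult_left_mono derivation_bound_poly u) auto
    ultimately show "\<exists>N. \<forall>m\<ge>N. (\<Sum>S'\<in>Pow {..<K}. \<Sum>n\<le>2 ^ K. (cmod ((fps_deriv (fps_of_poly (p m)) * block_der K X S') $ n))\<^sup>2) \<le>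
       512 * (b m)\<^sup>2 * (\<Sum>S\<in>Pow {..<K}. \<Sum>n\<le>2 ^ K. (cmod (X S $ n))\<^sup>2)"
      by (simp only: mult_ac) simp
  qed
qed

no_notation fps_nth (infixl "$" 75)

unbundle vec_syntax

section \<open>An analytic disc in \<open>\<Omega>\<close> that is a retract\<close>

lemma coord_num_Max: "coord_num (Max UNIV :: 'd::{finite, linorder}) = CARD('d)"
proof -
  have "{..Max UNIV} = (UNIV :: 'd set)" by (auto intro: Max_ge)
  thus ?thesis by (simp add: coord_num_def)
qed

lemma coord_num_less_iff: "coord_num (i :: 'd::{finite, linorder}) < CARD('d) \<longleftrightarrow> i \<noteq> Max UNIV"
proof -
  have "coord_num i \<in> {1..CARD('d)}" and "inj (coord_num :: 'd \<Rightarrow> nat)"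
    using bij_betw_coord_num[where 'd = 'd] by (auto simp: bij_betw_def)
  thus ?thesis using coord_num_Max[where 'd = 'd] by (metis atLeastAtMost_iff injD nat_less_le)
qed

lemma coord_num_pos: "0 < coord_num (i :: 'd::{finite, linorder})"
  using bij_betw_coord_num[where 'd = 'd] by (force simp: bij_betw_def)

text \<open>
  A cyclic shift of the coordinates multiplies the point by \<open>\<zeta>\<close>, hence \<open>elem_sym k\<close> by \<open>\<zeta>^k\<close>; but
  \<open>elem_sym k\<close> is symmetric, and \<open>\<zeta>^k \<noteq> 1\<close>.
\<close>

lemma elem_sym_roots_of_unity:
  fixes \<mu> :: complex
  defines "\<zeta> \<equiv> unit_root CARD('d) 1"
  assumes k: "0 < k" "k < CARD('d)"
  shows "elem_sym k (\<chi> i. \<mu> * \<zeta> ^ coord_num i :: complex ^ 'd::{finite, linorder}) = 0"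
proof -
  let ?c = "coord_num :: 'd \<Rightarrow> nat"
  let ?d = "CARD('d)"
  define g where "g = inv_into UNIV ?c"
  have bij: "bij_betw ?c UNIV {1..?d}" by (rule bij_betw_coord_num)
  have cg: "?c (g n) = n" if "n \<in> {1..?d}" for n
    unfolding g_def using bij that by (intro f_inv_into_f) (auto simp: bij_betw_def)
  define \<sigma> where "\<sigma> i = g (?c i mod ?d + 1)" for i
  have d0: "?d > 0" by simp
  have c\<sigma>: "?c (\<sigma> i) = ?c i mod ?d + 1" for i
  proof -
    have "?c i mod ?d < ?d" by (rule mod_less_divisor[OF d0])
    hence "?c i mod ?d + 1 \<in> {1..?d}" by (simp only: atLeastAtMost_iff) linarith
    thus ?thesis unfolding \<sigma>_def by (rule cg)
  qed
  have "inj \<sigma>"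
  proof (rule injI)
    fix i j assume "\<sigma> i = \<sigma> j"
    hence "?c i mod ?d = ?c j mod ?d" using c\<sigma>[of i] c\<sigma>[of j] by simp
    moreover have "?c i \<in> {1..?d}" "?c j \<in> {1..?d}" using bij by (auto simp: bij_betw_def)
    ultimately have "?c i = ?c j"
      by (cases "?c i = ?d"; cases "?c j = ?d") auto
    thus "i = j" using bij by (auto simp: bij_betw_def dest: injD)
  qed
  hence \<sigma>: "bij \<sigma>" by (simp add: bij_def finite_UNIV_inj_surj)
  have \<zeta>d: "\<zeta> ^ ?d = 1" unfolding \<zeta>_def by (rule unit_root_power_order[OF d0])
  have \<zeta>mod: "\<zeta> ^ (n mod ?d) = \<zeta> ^ n" for n
  proof -
    have "\<zeta> ^ n = \<zeta> ^ (?d * (n div ?d) + n mod ?d)" by simp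
    also have "\<dots> = \<zeta> ^ (n mod ?d)" by (simp only: power_add power_mult \<zeta>d power_one mult_1)
    finally show ?thesis by simp
  qed
  define x where "x = (\<chi> i. \<mu> * \<zeta> ^ ?c i)"
  have "elem_sym k x = elem_sym k (\<chi> i. x $ \<sigma> i)"
    by (rule elem_sym_permute[OF \<sigma>, symmetric])
  also have "(\<chi> i. x $ \<sigma> i) = (\<chi> i. \<zeta> * x $ i)"
    by (simp add: x_def c\<sigma> \<zeta>mod vec_eq_iff)
  also have "elem_sym k (\<chi> i. \<zeta> * x $ i) = \<zeta> ^ k * elem_sym k x"
    by (simp add: elem_sym_def prod.distrib sum_distrib_left)
  finally have "(1 - \<zeta> ^ k) * elem_sym k x = 0" by (simp add: algebra_simps)
  moreover have "\<zeta> ^ k \<noteq> 1"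
  proof -
    have "inj_on (\<lambda>k. unit_root ?d k) {..<?d}"
      unfolding unit_root_def by (rule bij_betw_imp_inj_on[OF Complex.bij_betw_roots_unity[OF d0]])
    hence "unit_root ?d k \<noteq> unit_root ?d 0" using k by (auto dest: inj_onD)
    moreover have "unit_root ?d k = \<zeta> ^ k" unfolding \<zeta>_def unit_root_def Complex.DeMoivre by (simp add: mult_ac)
    moreover have "unit_root ?d 0 = 1" by (simp add: unit_root_def)
    ultimately show ?thesis by simp
  qed
  ultimately show ?thesis unfolding x_def by simp
qed

lemma ex_nth_root: "n > 0 \<Longrightarrow> \<exists>y::complex. y ^ n = z"
proof (cases "z = 0")
  case False
  assume "n > 0"
  hence "card {y. y ^ n = z} > 0" using False by (simp add: card_nth_roots)
  thus ?thesis by (auto simp: card_gt_0_iff)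
qed (auto intro: exI[of _ 0])

lemma norm_less_1_of_power:
  fixes y :: complex
  assumes "cmod y ^ n < 1"
  shows "cmod y < 1"
  using assms one_le_power[of "cmod y" n] by (meson not_le)

text \<open>
  Choosing \<open>z\<^sub>i\<^sup>m\<close> proportional to the \<open>d\<close>-th roots of unity makes all coordinates but the last vanish and
  leaves \<open>\<mu>\<close> free. The last one can be prescribed only up to a \<open>t\<close>-th root of unity, which multiplying
  one \<open>z\<^sub>i\<close> by an \<open>m\<close>-th root of unity corrects.
\<close>

lemma axis_in_basic_map_image:
  assumes "m > 0" "t > 0" "t dvd m" "cmod a < 1"
  shows "axis (Max UNIV) a \<in> basic_map m t ` (polydisc :: (complex ^ 'd::{finite, linorder}) set)"
proof -
  let ?c = "coord_num :: 'd \<Rightarrow> nat"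
  let ?d = "CARD('d)"
  define q where "q = m div t"
  have q: "q > 0" "m = q * t" using assms by (auto simp: q_def div_greater_zero_iff dvd_imp_le)
  define \<zeta> where "\<zeta> = unit_root ?d 1"
  have n\<zeta>: "cmod \<zeta> = 1" by (simp add: \<zeta>_def)
  define s where "s = (\<Prod>i\<in>(UNIV :: 'd set). \<zeta> ^ ?c i)"
  have ns: "cmod s = 1" unfolding s_def by (simp add: n\<zeta> norm_power flip: prod_norm)
  have s0: "s \<noteq> 0" using ns by auto
  obtain \<mu> where \<mu>: "\<mu> ^ ?d = a ^ t / s" using ex_nth_root[of ?d] by auto
  have "cmod \<mu> ^ ?d = cmod a ^ t" using arg_cong[OF \<mu>, of cmod] by (simp add: norm_power norm_divide ns)
  hence "cmod \<mu> ^ ?d < 1" using assms by (simp add: power_Suc_less_one power_less_one_iff)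
  hence n\<mu>: "cmod \<mu> < 1" by (rule norm_less_1_of_power)
  have "\<forall>i. \<exists>y. y ^ m = \<mu> * \<zeta> ^ ?c i"
    using ex_nth_root[OF assms(1)] by blast
  then obtain y where y: "\<And>i. y i ^ m = \<mu> * \<zeta> ^ ?c i"
    by metis
  have yn: "cmod (y i) < 1" for i
  proof (rule norm_less_1_of_power)
    have "cmod (y i) ^ m = cmod \<mu>" using arg_cong[OF y[of i], of cmod] by (simp add: norm_power norm_mult n\<zeta>)
    thus "cmod (y i) ^ m < 1" using n\<mu> by simp
  qed
  have "((\<Prod>i\<in>UNIV. y i) ^ q) ^ t = (\<Prod>i\<in>UNIV. y i ^ m)"
    by (simp add: q(2) prod_power_distrib flip: power_mult)
  also have "\<dots> = \<mu> ^ ?d * s" by (simp add: y prod.distrib s_def)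
  also have "\<dots> = a ^ t" using s0 by (simp add: \<mu>)
  finally have pt': "((\<Prod>i\<in>UNIV. y i) ^ q) ^ t = a ^ t" .
  define P where "P = (\<Prod>i\<in>UNIV. y i) ^ q"
  have pt: "P ^ t = a ^ t" using pt' by (simp only: P_def)
  \<comment> \<open>\<open>P\<close> is the last coordinate of the image of \<open>y\<close>; it differs from \<open>a\<close> by a \<open>t\<close>-th root of unity \<open>\<kappa>\<close>.\<close>
  obtain \<kappa> where \<kappa>: "\<kappa> ^ t = 1" "\<kappa> * P = a"
  proof (cases "a = 0")
    case True
    hence "P = 0" using pt assms by (simp add: zero_power)
    thus ?thesis using that[of 1] True by simp
  next
    case False
    hence "P \<noteq> 0" using pt assms(2) by (auto simp: zero_power)
    thus ?thesis using that[of "a / P"] pt False by (simp add: power_divide)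
  qed
  obtain \<omega> where \<omega>: "\<omega> ^ q = \<kappa>" using ex_nth_root[OF q(1)] by auto
  have \<omega>m: "\<omega> ^ m = 1" by (simp add: q(2) power_mult \<omega> \<kappa>)
  hence "cmod \<omega> ^ m = 1" by (metis norm_one norm_power)
  hence n\<omega>: "cmod \<omega> = 1" using assms(1) power_eq_imp_eq_base[of "cmod \<omega>" m 1] by simp
  define k where "k = (Max UNIV :: 'd)"
  define z where "z = (\<chi> i. (if i = k then \<omega> else 1) * y i)"
  have "z \<in> polydisc" using yn n\<omega> by (auto simp: polydisc_def z_def norm_mult)
  moreover have "basic_map m t z = axis k a"
  proof -
    have zm: "(\<chi> j. z $ j ^ m) = (\<chi> i. \<mu> * \<zeta> ^ ?c i)"
    proof -
      have "z $ j ^ m = \<mu> * \<zeta> ^ ?c j" for j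
      proof -
        have "(if j = k then \<omega> else 1) ^ m = 1" using \<omega>m by (cases "j = k") simp_all
        thus ?thesis by (simp only: z_def vec_lambda_beta power_mult_distrib y mult_1_left)
      qed
      thus ?thesis by (simp only:)
    qed
    have "(\<Prod>j\<in>UNIV. z $ j) ^ (m div t) = a"
    proof -
      have "(\<Prod>j\<in>UNIV. z $ j) = \<omega> * (\<Prod>j\<in>UNIV. y j)"
      proof -
        have "(\<Prod>j\<in>UNIV. z $ j) = (\<Prod>j\<in>UNIV. if j = k then \<omega> else 1) * (\<Prod>j\<in>UNIV. y j)"
          unfolding z_def vec_lambda_beta by (rule prod.distrib)
        also have "(\<Prod>j\<in>UNIV. if j = k then \<omega> else 1) = \<omega>"
          by (subst prod.delta) simp_all
        finally show ?thesis .
      qed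
      thus ?thesis using \<kappa>(2) by (simp only: P_def q_def[symmetric] power_mult_distrib \<omega>)
    qed
    moreover have "elem_sym (?c i) (\<chi> j. z $ j ^ m) = 0" if "?c i < ?d" for i
      unfolding zm \<zeta>_def by (rule elem_sym_roots_of_unity[OF coord_num_pos that])
    moreover have "?c i < ?d \<longleftrightarrow> i \<noteq> k" for i unfolding k_def by (rule coord_num_less_iff)
    ultimately show ?thesis
      unfolding basic_map_def axis_def by (intro arg_cong[of _ _ vec_lambda] ext) simp
  qed
  ultimately show ?thesis unfolding k_def by (metis image_eqI)
qed

definition disc_restriction :: "(complex ^ 'd::{finite, linorder} \<Rightarrow> complex) \<Rightarrow> complex \<Rightarrow> complex" where
  "disc_restriction f a = f (axis (Max UNIV) a)"

lemma bounded_linear_axis: "bounded_linear (axis k :: complex \<Rightarrow> complex ^ 'd)"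
proof (rule bounded_linear_intro[where K = 1])
  show "norm (axis k x :: complex ^ 'd) \<le> norm x * 1" for x
  proof -
    have "norm (axis k x :: complex ^ 'd) \<le> (\<Sum>i\<in>UNIV. norm ((axis k x :: complex ^ 'd) $ i))"
      by (simp add: norm_vec_def L2_set_le_sum)
    also have "\<dots> = norm x" by (simp add: axis_def if_distrib cong: if_cong)
    finally show ?thesis by simp
  qed
qed (auto simp: vec_eq_iff axis_def)

lemma holomorphic_disc_restriction:
  fixes \<Omega> :: "(complex ^ 'd::{finite, linorder}) set"
  assumes f: "f \<in> uniform_algebra \<Omega>" and sub: "\<And>a. cmod a < 1 \<Longrightarrow> axis (Max UNIV) a \<in> \<Omega>"
  shows "disc_restriction f holomorphic_on ball 0 1"
  unfolding holomorphic_on_def field_differentiable_def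
proof
  fix a :: complex assume "a \<in> ball 0 1"
  hence a: "cmod a < 1" by simp
  let ?\<iota> = "axis (Max UNIV) :: complex \<Rightarrow> (complex, 'd) vec"
  obtain F where F: "(f has_derivative F) (at (?\<iota> a) within \<Omega>)" "\<And>c v. F (c *s v) = c * F v"
    using f sub[OF a] unfolding uniform_algebra_def holomorphic_several_def by blast
  have "(f has_derivative F) (at (?\<iota> a) within ?\<iota> ` ball 0 1)"
    by (rule has_derivative_subset[OF F(1)]) (use sub in auto)
  moreover have "(?\<iota> has_derivative ?\<iota>) (at a within ball 0 1)"
    by (intro bounded_linear_imp_has_derivative bounded_linear_axis)
  ultimately have "((\<lambda>a. f (?\<iota> a)) has_derivative (\<lambda>h. F (?\<iota> h))) (at a within ball 0 1)"
    by (rule has_derivative_in_compose[rotated])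
  moreover have "(\<lambda>h. F (?\<iota> h)) = (*) (F (?\<iota> 1))"
  proof
    fix h
    have "?\<iota> h = h *s ?\<iota> 1" by (auto simp: vec_eq_iff axis_def)
    hence "F (?\<iota> h) = h * F (?\<iota> 1)" by (simp only: F(2))
    thus "F (?\<iota> h) = F (?\<iota> 1) * h" by (simp only: mult.commute)
  qed
  ultimately have "(disc_restriction f has_field_derivative F (?\<iota> 1)) (at a within ball 0 1)"
    by (simp only: has_field_derivative_def disc_restriction_def[abs_def])
  thus "\<exists>f'. (disc_restriction f has_field_derivative f') (at a within ball 0 1)" ..
qed

text \<open>
  The powers of the coordinate function that retracts \<open>\<Omega>\<close> to the disc, as elements of the algebra,
  hence extended by \<open>0\<close>.
\<close>

definition top_power :: "(complex ^ 'd::{finite, linorder}) set \<Rightarrow> nat \<Rightarrow> complex ^ 'd::{finite, linorder} \<Rightarrow> complex" where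
  "top_power \<Omega> n z = (if z \<in> closure \<Omega> then (z $ Max UNIV) ^ n else 0)"

lemma top_power_in_uniform_algebra:
  fixes \<Omega> :: "(complex ^ 'd::{finite, linorder}) set"
  shows "top_power \<Omega> n \<in> uniform_algebra \<Omega>"
proof -
  have "holomorphic_several (top_power \<Omega> n) \<Omega>"
    unfolding holomorphic_several_def
  proof
    fix z assume z: "z \<in> \<Omega>"
    let ?F = "\<lambda>v :: (complex, 'd) vec. of_nat n * (v $ Max UNIV) * (z $ Max UNIV) ^ (n - 1)"
    have "((\<lambda>z :: (complex, 'd) vec. (z $ Max UNIV) ^ n) has_derivative ?F) (at z within \<Omega>)"
      by (rule has_derivative_power[OF bounded_linear_imp_has_derivative[OF bounded_linear_vec_nth]])
    hence "(top_power \<Omega> n has_derivative ?F) (at z within \<Omega>)"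
      by (rule has_derivative_transform[OF z, rotated])
        (auto simp: top_power_def dest: closure_subset[THEN subsetD])
    thus "\<exists>F. (top_power \<Omega> n has_derivative F) (at z within \<Omega>) \<and> (\<forall>c v. F (c *s v) = c * F v)"
      by (intro exI[of _ ?F]) (simp add: mult_ac)
  qed
  moreover have "continuous_on (closure \<Omega>) (top_power \<Omega> n)"
  proof -
    have "continuous_on (closure \<Omega>) (\<lambda>z. (z $ Max UNIV) ^ n)"
      by (intro continuous_intros)
    thus ?thesis by (rule continuous_on_eq) (simp add: top_power_def)
  qed
  ultimately show ?thesis by (simp add: uniform_algebra_def top_power_def)
qed

lemma cmod_top_power_le:
  assumes \<Omega>: "\<Omega> = basic_map m t ` (polydisc :: (complex ^ 'd::{finite, linorder}) set)"
  shows "cmod (top_power \<Omega> n z) \<le> 1"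
proof (cases "z \<in> closure \<Omega>")
  case True
  have "closure \<Omega> \<subseteq> {z. cmod (z $ Max UNIV) \<le> 1}"
  proof (rule closure_minimal)
    show "closed {z :: (complex, 'd) vec. cmod (z $ Max UNIV) \<le> 1}"
      by (intro closed_Collect_le continuous_intros)
    show "\<Omega> \<subseteq> {z. cmod (z $ Max UNIV) \<le> 1}"
    proof
      fix w assume "w \<in> \<Omega>"
      then obtain y where y: "y \<in> polydisc" "w = basic_map m t y" using \<Omega> by auto
      have "w $ Max UNIV = (\<Prod>j\<in>UNIV. y $ j) ^ (m div t)"
        by (simp add: y(2) basic_map_def coord_num_less_iff)
      moreover have "(\<Prod>j\<in>UNIV. cmod (y $ j)) \<le> 1"
        using y(1) by (intro prod_le_1) (auto simp: polydisc_def less_imp_le)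
      ultimately show "w \<in> {z. cmod (z $ Max UNIV) \<le> 1}"
        by (simp add: norm_power power_le_one prod_nonneg flip: prod_norm)
    qed
  qed
  thus ?thesis using True by (auto simp: top_power_def norm_power power_le_one)
qed (simp add: top_power_def)

lemma has_fps_expansion_disc_restriction:
  assumes "disc_restriction f holomorphic_on ball 0 1"
  shows "disc_restriction f has_fps_expansion fps_expansion (disc_restriction f) 0"
  by (rule has_fps_expansion_fps_expansion[OF _ _ assms]) auto

lemma fps_expansion_disc_restriction_add:
  assumes "disc_restriction f holomorphic_on ball 0 1" "disc_restriction g holomorphic_on ball 0 1"
  shows "fps_expansion (disc_restriction (\<lambda>z. f z + g z)) 0 =
      fps_expansion (disc_restriction f) 0 + fps_expansion (disc_restriction g) 0"
proof -
  have "disc_restriction (\<lambda>z. f z + g z) = (\<lambda>a. disc_restriction f a + disc_restriction g a)"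
    by (simp add: disc_restriction_def fun_eq_iff)
  thus ?thesis
    using has_fps_expansion_add[OF assms[THEN has_fps_expansion_disc_restriction]]
    by (metis fps_expansion_eqI)
qed

lemma fps_expansion_disc_restriction_mult:
  assumes "disc_restriction f holomorphic_on ball 0 1" "disc_restriction g holomorphic_on ball 0 1"
  shows "fps_expansion (disc_restriction (\<lambda>z. f z * g z)) 0 =
      fps_expansion (disc_restriction f) 0 * fps_expansion (disc_restriction g) 0"
proof -
  have "disc_restriction (\<lambda>z. f z * g z) = (\<lambda>a. disc_restriction f a * disc_restriction g a)"
    by (simp add: disc_restriction_def fun_eq_iff)
  thus ?thesis
    using has_fps_expansion_mult[OF assms[THEN has_fps_expansion_disc_restriction]]
    by (metis fps_expansion_eqI)
qed

lemma fps_expansion_disc_restriction_scale: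
  assumes "disc_restriction f holomorphic_on ball 0 1"
  shows "fps_expansion (disc_restriction (\<lambda>z. c * f z)) 0 =
      fps_const c * fps_expansion (disc_restriction f) 0"
proof -
  have "disc_restriction (\<lambda>z. c * f z) = (\<lambda>a. c * disc_restriction f a)"
    by (simp add: disc_restriction_def fun_eq_iff)
  thus ?thesis
    using has_fps_expansion_cmult_left[OF has_fps_expansion_disc_restriction[OF assms]]
    by (metis fps_expansion_eqI)
qed

lemma fps_expansion_eq_if_eq_on_disc:
  assumes "\<And>a. cmod a < 1 \<Longrightarrow> \<phi> a = \<psi> a" "\<psi> has_fps_expansion F"
  shows "fps_expansion \<phi> 0 = F"
proof -
  have "\<forall>\<^sub>F x in nhds 0. \<phi> x = \<psi> x"
    using eventually_nhds_in_open[of "ball 0 1" "0 :: complex"] by (auto elim!: eventually_mono intro: assms(1))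
  hence "\<phi> has_fps_expansion F" using has_fps_expansion_cong[OF _ refl] assms(2) by blast
  thus ?thesis by (rule fps_expansion_eqI)
qed

unbundle no vec_syntax

section \<open>Square-summable sequences\<close>

definition l2 :: "(nat \<Rightarrow> complex) set" where
  "l2 = {x. summable (\<lambda>i. (cmod (x i))\<^sup>2)}"

definition lnorm :: "(nat \<Rightarrow> complex) \<Rightarrow> real" where
  "lnorm x = sqrt (\<Sum>i. (cmod (x i))\<^sup>2)"

lemma lnorm_sq: "x \<in> l2 \<Longrightarrow> (lnorm x)\<^sup>2 = (\<Sum>i. (cmod (x i))\<^sup>2)"
  by (simp add: lnorm_def l2_def suminf_nonneg)

lemma lnorm_nonneg: "x \<in> l2 \<Longrightarrow> 0 \<le> lnorm x"
  by (simp add: lnorm_def l2_def suminf_nonneg)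

lemma sum_le_lnorm_sq:
  assumes "x \<in> l2" "finite F"
  shows "(\<Sum>i\<in>F. (cmod (x i))\<^sup>2) \<le> (lnorm x)\<^sup>2"
  using assms unfolding lnorm_sq[OF assms(1)] l2_def by (intro sum_le_suminf) auto

lemma cmod_le_lnorm: "x \<in> l2 \<Longrightarrow> cmod (x i) \<le> lnorm x"
  using sum_le_lnorm_sq[of x "{i}"] by (intro power2_le_imp_le[OF _ lnorm_nonneg]) auto

lemma l2_bounded:
  assumes "\<And>F. finite F \<Longrightarrow> (\<Sum>i\<in>F. (cmod (x i))\<^sup>2) \<le> C\<^sup>2" "0 \<le> C"
  shows "x \<in> l2" "lnorm x \<le> C"
proof -
  have s: "summable (\<lambda>i. (cmod (x i))\<^sup>2)"
    using assms(1) by (intro summableI_nonneg_bounded[of _ "C\<^sup>2"]) auto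
  thus "x \<in> l2" by (simp add: l2_def)
  have "(\<Sum>i. (cmod (x i))\<^sup>2) \<le> C\<^sup>2"
    using s assms(1) by (intro suminf_le_const) auto
  thus "lnorm x \<le> C" using assms(2) by (simp add: lnorm_def real_le_lsqrt)
qed

lemma l2_add:
  assumes "x \<in> l2" "y \<in> l2"
  shows "(\<lambda>i. x i + y i) \<in> l2" "lnorm (\<lambda>i. x i + y i) \<le> lnorm x + lnorm y"
proof -
  have "(\<Sum>i\<in>F. (cmod (x i + y i))\<^sup>2) \<le> (lnorm x + lnorm y)\<^sup>2" if "finite F" for F
  proof -
    have *: "L2_set (\<lambda>i. cmod (z i)) F \<le> lnorm z" if "z \<in> l2" for z
      unfolding L2_set_def using sum_le_lnorm_sq[OF that \<open>finite F\<close>] lnorm_nonneg[OF that]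
      by (rule real_le_lsqrt[rotated 1])
    have "L2_set (\<lambda>i. cmod (x i + y i)) F \<le> L2_set (\<lambda>i. cmod (x i) + cmod (y i)) F"
      by (intro L2_set_mono norm_triangle_ineq) auto
    also have "\<dots> \<le> L2_set (\<lambda>i. cmod (x i)) F + L2_set (\<lambda>i. cmod (y i)) F"
      by (rule L2_set_triangle_ineq)
    also have "\<dots> \<le> lnorm x + lnorm y"
      using *[OF assms(1)] *[OF assms(2)] by simp
    finally have "(L2_set (\<lambda>i. cmod (x i + y i)) F)\<^sup>2 \<le> (lnorm x + lnorm y)\<^sup>2"
      by (intro power_mono L2_set_nonneg)
    thus ?thesis by (simp add: L2_set_def sum_nonneg)
  qed
  moreover have "0 \<le> lnorm x + lnorm y" using assms by (simp add: lnorm_nonneg)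
  ultimately show "(\<lambda>i. x i + y i) \<in> l2" "lnorm (\<lambda>i. x i + y i) \<le> lnorm x + lnorm y"
    using l2_bounded[of "\<lambda>i. x i + y i" "lnorm x + lnorm y"] by blast+
qed

lemma l2_scale:
  assumes "x \<in> l2"
  shows "(\<lambda>i. c * x i) \<in> l2" "lnorm (\<lambda>i. c * x i) = cmod c * lnorm x"
proof -
  show "(\<lambda>i. c * x i) \<in> l2"
    using assms by (simp add: l2_def norm_mult power_mult_distrib summable_mult)
  show "lnorm (\<lambda>i. c * x i) = cmod c * lnorm x"
    using assms by (simp add: lnorm_def l2_def norm_mult power_mult_distrib suminf_mult real_sqrt_mult)
qed

lemma l2_zero: "(\<lambda>i. 0) \<in> l2"
  by (simp add: l2_def)

lemma lnorm_zero [simp]: "lnorm (\<lambda>i. 0) = 0"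
  by (simp add: lnorm_def)

lemma l2_diff:
  assumes "x \<in> l2" "y \<in> l2"
  shows "(\<lambda>i. x i - y i) \<in> l2"
  using l2_add(1)[OF assms(1) l2_scale(1)[OF assms(2), of "- 1"]] by simp

lemma lnorm_minus_commute: "lnorm (\<lambda>i. x i - y i) = lnorm (\<lambda>i. y i - x i)"
  by (simp add: lnorm_def norm_minus_commute)

lemma lnorm_eq_0: "x \<in> l2 \<Longrightarrow> lnorm x = 0 \<Longrightarrow> x = (\<lambda>i. 0)"
  using cmod_le_lnorm[of x] by (auto intro!: ext)

definition l2_inner :: "(nat \<Rightarrow> complex) \<Rightarrow> (nat \<Rightarrow> complex) \<Rightarrow> complex" where
  "l2_inner x y = (\<Sum>i. x i * cnj (y i))"

lemma l2_inner_summable: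
  assumes "x \<in> l2" "y \<in> l2"
  shows "summable (\<lambda>i. x i * cnj (y i))"
proof (rule summable_comparison_test')
  show "summable (\<lambda>i. (cmod (x i))\<^sup>2 + (cmod (y i))\<^sup>2)"
    using assms by (auto simp: l2_def intro: summable_add)
  show "norm (x i * cnj (y i)) \<le> (cmod (x i))\<^sup>2 + (cmod (y i))\<^sup>2" for i
    using sum_squares_bound[of "cmod (x i)" "cmod (y i)"] mult_nonneg_nonneg[of "cmod (x i)" "cmod (y i)"]
    by (simp add: norm_mult del: mult_nonneg_nonneg)
qed

lemma l2_inner_self: "x \<in> l2 \<Longrightarrow> l2_inner x x = of_real ((lnorm x)\<^sup>2)"
  unfolding l2_inner_def by (simp add: lnorm_sq l2_def suminf_of_real flip: complex_norm_square)

lemma Metric_space_l2: "Metric_space l2 (\<lambda>x y. if x \<in> l2 \<and> y \<in> l2 then lnorm (\<lambda>i. x i - y i) else 0)"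
proof
  let ?d = "\<lambda>x y. if x \<in> l2 \<and> y \<in> l2 then lnorm (\<lambda>i. x i - y i) else 0"
  show "0 \<le> ?d x y" for x y by (simp add: lnorm_nonneg l2_diff)
  show "?d x y = ?d y x" for x y using lnorm_minus_commute[of x y] by simp
  show "?d x y = 0 \<longleftrightarrow> x = y" if "x \<in> l2" "y \<in> l2" for x y
  proof
    assume "?d x y = 0"
    hence "(\<lambda>i. x i - y i) = (\<lambda>i. 0)" using that lnorm_eq_0[OF l2_diff[OF that]] by simp
    thus "x = y" by (simp add: fun_eq_iff)
  next
    assume "x = y"
    thus "?d x y = 0" by (simp add: lnorm_def)
  qed
  show "?d x z \<le> ?d x y + ?d y z" if "x \<in> l2" "y \<in> l2" "z \<in> l2" for x y z
    using that l2_add(2)[OF l2_diff[OF that(1,2)] l2_diff[OF that(2,3)]] by simp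
qed

lemma mcomplete_l2:
  "Metric_space.mcomplete l2 (\<lambda>x y. if x \<in> l2 \<and> y \<in> l2 then lnorm (\<lambda>i. x i - y i) else 0)"
proof -
  interpret Metric_space l2 "\<lambda>x y. if x \<in> l2 \<and> y \<in> l2 then lnorm (\<lambda>i. x i - y i) else 0"
    by (rule Metric_space_l2)
  show ?thesis unfolding mcomplete_def
  proof (intro allI impI)
    fix \<sigma> assume \<sigma>: "MCauchy \<sigma>"
    hence ran: "\<sigma> n \<in> l2" for n by (auto simp: MCauchy_def)
    have C: "\<exists>N. \<forall>n\<ge>N. \<forall>k\<ge>N. lnorm (\<lambda>i. \<sigma> n i - \<sigma> k i) < e" if "e > 0" for e
      using \<sigma> that ran unfolding MCauchy_def by fastforce
    have "Cauchy (\<lambda>n. \<sigma> n i)" for i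
    proof (rule metric_CauchyI)
      fix e :: real assume "e > 0"
      then obtain N where N: "\<And>n k. n \<ge> N \<Longrightarrow> k \<ge> N \<Longrightarrow> lnorm (\<lambda>i. \<sigma> n i - \<sigma> k i) < e"
        using C by blast
      thus "\<exists>M. \<forall>m\<ge>M. \<forall>n\<ge>M. dist (\<sigma> m i) (\<sigma> n i) < e"
        using cmod_le_lnorm[OF l2_diff[OF ran ran]] by (metis dist_norm order.strict_trans1)
    qed
    hence "\<exists>x. (\<lambda>n. \<sigma> n i) \<longlonglongrightarrow> x" for i
      by (simp add: Cauchy_convergent_iff convergent_def)
    then obtain x where x: "\<And>i. (\<lambda>n. \<sigma> n i) \<longlonglongrightarrow> x i" by metis
    have close: "\<exists>N. \<forall>n\<ge>N. (\<lambda>i. \<sigma> n i - x i) \<in> l2 \<and> lnorm (\<lambda>i. \<sigma> n i - x i) \<le> e" if e: "e > 0" for e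
    proof -
      obtain N where N: "\<And>n k. n \<ge> N \<Longrightarrow> k \<ge> N \<Longrightarrow> lnorm (\<lambda>i. \<sigma> n i - \<sigma> k i) < e"
        using C[OF e] by blast
      have "(\<Sum>i\<in>F. (cmod (\<sigma> n i - x i))\<^sup>2) \<le> e\<^sup>2" if "n \<ge> N" "finite F" for n F
      proof (rule LIMSEQ_le_const2)
        show "(\<lambda>k. \<Sum>i\<in>F. (cmod (\<sigma> n i - \<sigma> k i))\<^sup>2) \<longlonglongrightarrow> (\<Sum>i\<in>F. (cmod (\<sigma> n i - x i))\<^sup>2)"
          by (intro tendsto_intros x)
        have "(\<Sum>i\<in>F. (cmod (\<sigma> n i - \<sigma> k i))\<^sup>2) \<le> e\<^sup>2" if "k \<ge> N" for k
        proof -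
          have "(\<Sum>i\<in>F. (cmod (\<sigma> n i - \<sigma> k i))\<^sup>2) \<le> (lnorm (\<lambda>i. \<sigma> n i - \<sigma> k i))\<^sup>2"
            by (rule sum_le_lnorm_sq[OF l2_diff[OF ran ran] \<open>finite F\<close>])
          also have "\<dots> \<le> e\<^sup>2" using N[OF \<open>n \<ge> N\<close> that]
            by (intro power_mono lnorm_nonneg l2_diff ran) auto
          finally show ?thesis .
        qed
        thus "\<exists>M. \<forall>k\<ge>M. (\<Sum>i\<in>F. (cmod (\<sigma> n i - \<sigma> k i))\<^sup>2) \<le> e\<^sup>2" by blast
      qed
      hence "\<forall>n\<ge>N. (\<lambda>i. \<sigma> n i - x i) \<in> l2 \<and> lnorm (\<lambda>i. \<sigma> n i - x i) \<le> e"
        using l2_bounded[of "\<lambda>i. \<sigma> _ i - x i" e] e by (simp add: less_imp_le)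
      thus ?thesis by blast
    qed
    obtain N where "(\<lambda>i. \<sigma> N i - x i) \<in> l2" using close[of 1] by auto
    from l2_diff[OF ran[of N] this] have xl: "x \<in> l2" by simp
    have "limitin mtopology \<sigma> x sequentially"
      unfolding limit_metric_sequentially
    proof (intro conjI allI impI xl)
      fix e :: real assume "e > 0"
      hence "e / 2 > 0" by simp
      from close[OF this] obtain N where "\<forall>n\<ge>N. lnorm (\<lambda>i. \<sigma> n i - x i) \<le> e / 2" by blast
      thus "\<exists>N. \<forall>n\<ge>N. \<sigma> n \<in> l2 \<and> (if \<sigma> n \<in> l2 \<and> x \<in> l2 then lnorm (\<lambda>i. \<sigma> n i - x i) else 0) < e"
        using ran xl \<open>e > 0\<close> by (intro exI[of _ N]) force
    qed
    thus "\<exists>x. limitin mtopology \<sigma> x sequentially" by blast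
  qed
qed

definition l2_module :: "('f \<Rightarrow> (nat \<Rightarrow> complex) \<Rightarrow> nat \<Rightarrow> complex) \<Rightarrow> ('f, nat \<Rightarrow> complex) hmodule" where
  "l2_module A = \<lparr>carrier = l2, mult = (\<lambda>x y. x), one = (\<lambda>i. 0), zero = (\<lambda>i. 0),
     add = (\<lambda>x y i. x i + y i), smult = (\<lambda>c x i. c * x i), cinner = l2_inner, act = A\<rparr>"

lemma l2_module_simps [simp]:
  "carrier (l2_module A) = l2" "zero (l2_module A) = (\<lambda>i. 0)"
  "add (l2_module A) = (\<lambda>x y i. x i + y i)" "smult (l2_module A) = (\<lambda>c x i. c * x i)"
  "cinner (l2_module A) = l2_inner" "act (l2_module A) = A"
  by (simp_all add: l2_module_def)

lemma abelian_group_l2: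
  assumes R: "carrier R = l2" "zero R = (\<lambda>i. 0)" "add R = (\<lambda>x y i. x i + y i)"
  shows "abelian_group R"
proof (rule abelian_groupI)
  fix x assume "x \<in> carrier R"
  hence "(\<lambda>i. - 1 * x i) \<in> l2" using R by (intro l2_scale) simp
  thus "\<exists>y\<in>carrier R. y \<oplus>\<^bsub>R\<^esub> x = \<zero>\<^bsub>R\<^esub>"
    using R by (intro bexI[of _ "\<lambda>i. - 1 * x i"]) auto
qed (auto simp: R l2_add l2_zero add_ac)

lemma abelian_group_l2_module: "abelian_group (l2_module A)"
  by (rule abelian_group_l2) simp_all

lemma l2_module_minus:
  assumes "x \<in> l2" "y \<in> l2"
  shows "x \<ominus>\<^bsub>l2_module A\<^esub> y = (\<lambda>i. x i - y i)"
proof -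
  interpret abelian_group "l2_module A" by (rule abelian_group_l2_module)
  have "\<ominus>\<^bsub>l2_module A\<^esub> y = (\<lambda>i. - 1 * y i)"
    using assms l2_scale(1)[OF assms(2), of "- 1"] by (intro minus_equality) auto
  thus ?thesis by (simp add: a_minus_def)
qed

lemma hnorm_l2_module: "x \<in> l2 \<Longrightarrow> hnorm (l2_module A) x = lnorm x"
  by (simp add: hnorm_def l2_inner_self lnorm_nonneg)

lemma hdist_l2_module:
  "hdist (l2_module A) = (\<lambda>x y. if x \<in> l2 \<and> y \<in> l2 then lnorm (\<lambda>i. x i - y i) else 0)"
  by (auto simp: hdist_def fun_eq_iff l2_module_minus hnorm_l2_module l2_diff)

lemma hilbert_space_l2_module: "hilbert_space (l2_module A)"
proof (intro hilbert_space.intro hilbert_space_axioms.intro, unfold l2_module_simps)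
  show "Module.module complex_ring (l2_module A)"
    by (rule Module.moduleI[OF cring_complex_ring abelian_group_l2_module])
      (auto simp: l2_scale distrib_left distrib_right mult.assoc)
  show "l2_inner (\<lambda>i. x i + y i) z = l2_inner x z + l2_inner y z"
    if "x \<in> l2" "y \<in> l2" "z \<in> l2" for x y z
    unfolding l2_inner_def using that
    by (subst suminf_add[OF l2_inner_summable l2_inner_summable]) (auto simp: distrib_right)
  show "l2_inner (\<lambda>i. c * x i) y = c * l2_inner x y" if "x \<in> l2" "y \<in> l2" for c x y
    unfolding l2_inner_def using that
    by (subst suminf_mult[OF l2_inner_summable, symmetric]) (auto simp: mult.assoc)
  show "l2_inner y x = cnj (l2_inner x y)" if "x \<in> l2" "y \<in> l2" for x y
  proof -
    have "(\<lambda>i. cnj (x i * cnj (y i))) sums cnj (l2_inner x y)"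
      unfolding l2_inner_def sums_cnj by (rule summable_sums[OF l2_inner_summable[OF that]])
    hence "(\<lambda>i. y i * cnj (x i)) sums cnj (l2_inner x y)" by (simp add: mult.commute)
    thus ?thesis unfolding l2_inner_def[of y x] by (simp add: sums_iff)
  qed
  show "x = (\<lambda>i. 0)" if "x \<in> l2" "l2_inner x x = 0" for x
    using that lnorm_eq_0[OF that(1)] by (simp add: l2_inner_self)
  show "0 \<le> Re (l2_inner x x)" if "x \<in> l2" for x
    using that by (simp add: l2_inner_self)
  show "Metric_space.mcomplete l2 (hdist (l2_module A))"
    unfolding hdist_l2_module by (rule mcomplete_l2)
qed

text \<open>
  Joint continuity of the action follows from the bilinear bound, via
  \<open>f x - g y = f (x - y) + (f - g) y\<close>.
\<close>

lemma hilbert_module_l2_module: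
  fixes X :: "'x::topological_space set" and A :: "('x \<Rightarrow> complex) set"
    and T :: "('x \<Rightarrow> complex) \<Rightarrow> (nat \<Rightarrow> complex) \<Rightarrow> nat \<Rightarrow> complex"
  assumes alg: "function_algebra X A"
    and closed: "\<And>f x. f \<in> A \<Longrightarrow> x \<in> l2 \<Longrightarrow> T f x \<in> l2"
    and bound: "\<And>f x. f \<in> A \<Longrightarrow> x \<in> l2 \<Longrightarrow> lnorm (T f x) \<le> C * sup_norm X f * lnorm x"
    and add_left: "\<And>f g x. f \<in> A \<Longrightarrow> g \<in> A \<Longrightarrow> x \<in> l2 \<Longrightarrow> T (\<lambda>z. f z + g z) x = (\<lambda>i. T f x i + T g x i)"
    and add_right: "\<And>f x y. f \<in> A \<Longrightarrow> x \<in> l2 \<Longrightarrow> y \<in> l2 \<Longrightarrow> T f (\<lambda>i. x i + y i) = (\<lambda>i. T f x i + T f y i)"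
    and mult: "\<And>f g x. f \<in> A \<Longrightarrow> g \<in> A \<Longrightarrow> x \<in> l2 \<Longrightarrow> T (\<lambda>z. f z * g z) x = T f (T g x)"
    and one: "\<And>x. x \<in> l2 \<Longrightarrow> T (indicator X) x = x"
    and scale_left: "\<And>c f x. f \<in> A \<Longrightarrow> x \<in> l2 \<Longrightarrow> T (\<lambda>z. c * f z) x = (\<lambda>i. c * T f x i)"
    and scale_right: "\<And>c f x. f \<in> A \<Longrightarrow> x \<in> l2 \<Longrightarrow> T f (\<lambda>i. c * x i) = (\<lambda>i. c * T f x i)"
  shows "hilbert_module X A (l2_module T)"
proof -
  interpret function_algebra X A by (rule alg)
  let ?H = "l2_module T"
  let ?d = "\<lambda>x y. if x \<in> l2 \<and> y \<in> l2 then lnorm (\<lambda>i. x i - y i) else 0"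
  have act: "action_module ?H = \<lparr>carrier = l2, mult = (\<lambda>x y. x), one = (\<lambda>i. 0), zero = (\<lambda>i. 0),
     add = (\<lambda>x y i. x i + y i), smult = T\<rparr>"
    by (simp add: action_module_def l2_module_def)
  have "abelian_group (action_module ?H)"
    unfolding act by (rule abelian_group_l2) simp_all
  hence action: "Module.module (function_ring X A) (action_module ?H)"
    by (intro Module.moduleI cring_function_ring)
      (simp_all add: act function_ring_def closed add_left add_right mult one)
  interpret S: Metric_space A "sup_dist X A" by (rule Metric_space_sup_dist)
  interpret M: Metric_space l2 ?d by (rule Metric_space_l2)
  have sup0: "0 \<le> sup_norm X f" if "f \<in> A" for f
  proof -
    obtain x where "x \<in> X" using nonempty by auto
    from cmod_le_sup_norm[OF continuous[OF that] this] show ?thesis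
      using norm_ge_zero[of "f x"] by linarith
  qed
  define c where "c = \<bar>C\<bar> + 1"
  have c: "c > 0" by (simp add: c_def)
  have bound': "lnorm (T f x) \<le> c * sup_norm X f * lnorm x" if "f \<in> A" "x \<in> l2" for f x
  proof -
    have "C * sup_norm X f * lnorm x \<le> c * sup_norm X f * lnorm x"
      using that by (intro mult_right_mono lnorm_nonneg sup0) (auto simp: c_def)
    thus ?thesis using bound[OF that] by linarith
  qed
  have "continuous_map (prod_topology S.mtopology M.mtopology) M.mtopology (\<lambda>(f, x). T f x)"
    unfolding M.continuous_map_to_metric
  proof (intro ballI allI impI)
    fix p :: "('x \<Rightarrow> complex) \<times> (nat \<Rightarrow> complex)" and e :: real
    assume "p \<in> topspace (prod_topology S.mtopology M.mtopology)" and e: "e > 0"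
    then obtain f x where p: "p = (f, x)" "f \<in> A" "x \<in> l2" by auto
    \<comment> \<open>If \<open>g\<close> and \<open>y\<close> are within \<open>r \<le> 1\<close> of \<open>f\<close> and \<open>x\<close>, then \<open>|y| \<le> s + 1\<close>, and the two differences add up to
      at most \<open>c s r + c r (s + 1) \<le> 3 c r s\<close>.\<close>
    define s where "s = sup_norm X f + lnorm x + 1"
    define r where "r = min 1 (e / (4 * c * s))"
    have s: "s \<ge> 1" "sup_norm X f \<le> s" "lnorm x \<le> s"
      using sup0[OF p(2)] lnorm_nonneg[OF p(3)] by (auto simp: s_def)
    have r: "0 < r" "r \<le> 1" "c * r * s \<le> e / 4"
    proof -
      show "0 < r" "r \<le> 1" using e c s by (auto simp: r_def)
      have "r * (4 * c * s) \<le> e" using e c s by (simp add: r_def min_def field_simps)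
      thus "c * r * s \<le> e / 4" by (simp add: field_simps)
    qed
    show "\<exists>U. openin (prod_topology S.mtopology M.mtopology) U \<and> p \<in> U \<and>
        (\<forall>q\<in>U. (case q of (f, x) \<Rightarrow> T f x) \<in> M.mball (case p of (f, x) \<Rightarrow> T f x) e)"
    proof (intro exI conjI ballI)
      show "openin (prod_topology S.mtopology M.mtopology) (S.mball f r \<times> M.mball x r)"
        by (simp add: openin_prod_Times_iff)
      show "p \<in> S.mball f r \<times> M.mball x r" using p r by simp
      fix q assume "q \<in> S.mball f r \<times> M.mball x r"
      then obtain g y where q: "q = (g, y)" "g \<in> A" "y \<in> l2" "sup_dist X A f g < r" "lnorm (\<lambda>i. x i - y i) < r"
        using p by auto
      have fg: "(\<lambda>z. f z + - 1 * g z) \<in> A" by (intro add_closed p scale_closed q)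
      have fgr: "sup_norm X (\<lambda>z. f z + - 1 * g z) \<le> r"
        using q p by (simp add: sup_dist_def)
      have yx: "(\<lambda>i. x i + - 1 * y i) \<in> l2" by (intro l2_add(1) l2_scale(1) p q)
      have yxr: "lnorm (\<lambda>i. x i + - 1 * y i) \<le> r" using q by simp
      have ny: "lnorm y \<le> s + 1"
      proof -
        have "lnorm (\<lambda>i. x i + - 1 * (\<lambda>i. x i + - 1 * y i) i) \<le> lnorm x + lnorm (\<lambda>i. - 1 * (\<lambda>i. x i + - 1 * y i) i)"
          by (intro l2_add(2) l2_scale(1) yx p)
        also have "lnorm (\<lambda>i. - 1 * (\<lambda>i. x i + - 1 * y i) i) = lnorm (\<lambda>i. x i + - 1 * y i)"
          by (subst l2_scale(2)[OF yx]) simp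
        finally show ?thesis using yxr r s by simp
      qed
      have eq: "(\<lambda>i. T f x i - T g y i) = (\<lambda>i. T f (\<lambda>i. x i + - 1 * y i) i + T (\<lambda>z. f z + - 1 * g z) y i)"
        using p q add_right[OF p(2,3) l2_scale(1)[OF q(3)], of "- 1"] scale_right[OF p(2) q(3), of "- 1"]
          add_left[OF p(2) scale_closed[OF q(2)] q(3), of "- 1"] scale_left[OF q(2,3), of "- 1"]
        by (simp add: fun_eq_iff)
      have "lnorm (\<lambda>i. T f x i - T g y i) \<le> lnorm (T f (\<lambda>i. x i + - 1 * y i)) + lnorm (T (\<lambda>z. f z + - 1 * g z) y)"
        unfolding eq by (intro l2_add(2) closed p q yx fg)
      also have "\<dots> \<le> c * sup_norm X f * lnorm (\<lambda>i. x i + - 1 * y i) + c * sup_norm X (\<lambda>z. f z + - 1 * g z) * lnorm y"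
        by (intro add_mono bound' p q yx fg)
      also have "\<dots> \<le> c * s * r + c * r * (s + 1)"
        using s r c yxr fgr ny
        by (intro add_mono mult_mono lnorm_nonneg sup0 fg yx p(2) q(3) mult_nonneg_nonneg) auto
      also have "\<dots> \<le> 3 * (c * r * s)"
        using mult_left_mono[OF s(1), of "c * r"] c r by (simp add: algebra_simps)
      also have "\<dots> < e" using r(3) e by simp
      finally show "(case q of (f, x) \<Rightarrow> T f x) \<in> M.mball (case p of (f, x) \<Rightarrow> T f x) e"
        using p q closed by simp
    qed
  qed
  hence "hilbert_module_axioms X A ?H"
    using action scale_left scale_right by (simp add: hilbert_module_axioms_def hdist_l2_module)
  thus ?thesis
    by (intro hilbert_module.intro alg hilbert_space_l2_module)
qed

notation fps_nth (infixl "$" 75)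

section \<open>The Hilbert sum of the blocks\<close>

text \<open>
  An index \<open>(K, b, n, S)\<close> stands for the coefficient of degree \<open>n\<close> at the basis vector \<open>S\<close> in block \<open>K\<close>; it
  belongs to \<open>x\<close> if \<open>b\<close> holds and to \<open>v\<close> otherwise. All blocks together are enumerated by the natural
  numbers, so that the sum lives on \<open>l2\<close>.
\<close>

type_synonym block_index = "nat \<times> bool \<times> nat \<times> nat set"

definition block_indices :: "block_index set" where
  "block_indices = (SIGMA K:UNIV. UNIV \<times> {..2 ^ K} \<times> Pow {..<K})"

definition index_at :: "nat \<Rightarrow> block_index" where "index_at = from_nat_into block_indices"
definition position :: "block_index \<Rightarrow> nat" where "position = to_nat_on block_indices"

lemma countable_block_indices: "countable block_indices"
  unfolding block_indices_def by (rule countable_SIGMA) (auto intro: countable_finite)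

lemma infinite_block_indices: "infinite block_indices"
proof
  assume "finite block_indices"
  moreover have "(\<lambda>K. (K, True, 0, {})) ` UNIV \<subseteq> block_indices"
    by (auto simp: block_indices_def)
  ultimately have "finite (range (\<lambda>K :: nat. (K, True, 0 :: nat, {} :: nat set)))"
    by (rule finite_subset[rotated])
  hence "finite (UNIV :: nat set)"
    by (rule finite_imageD) (auto simp: inj_on_def)
  thus False by simp
qed

lemma index_at_position: "\<kappa> \<in> block_indices \<Longrightarrow> index_at (position \<kappa>) = \<kappa>"
  unfolding index_at_def position_def by (rule from_nat_into_to_nat_on[OF countable_block_indices])

lemma position_index_at: "position (index_at i) = i"
  unfolding index_at_def position_def
  by (rule to_nat_on_from_nat_into_infinite[OF countable_block_indices infinite_block_indices])

lemma index_at_in: "index_at i \<in> block_indices"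
  unfolding index_at_def using infinite_block_indices by (intro from_nat_into) auto

lemma inj_on_position: "inj_on position block_indices"
  unfolding position_def by (rule inj_on_to_nat_on[OF countable_block_indices])

definition coord_fps :: "(nat \<Rightarrow> complex) \<Rightarrow> nat \<Rightarrow> bool \<Rightarrow> nat set \<Rightarrow> complex fps" where
  "coord_fps x K b S = Abs_fps (\<lambda>n. if n \<le> 2 ^ K then x (position (K, b, n, S)) else 0)"

lemma coord_fps_nth: "n \<le> 2 ^ K \<Longrightarrow> coord_fps x K b S $ n = x (position (K, b, n, S))"
  by (simp add: coord_fps_def)

text \<open>
  \<open>F \<cdot> (v, x) = (F v + F' D x, F x)\<close> before truncation.
\<close>

definition block_act_fps :: "complex fps \<Rightarrow> (nat \<Rightarrow> complex) \<Rightarrow> nat \<Rightarrow> bool \<Rightarrow> nat set \<Rightarrow> complex fps" where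
  "block_act_fps F x K b S = (if b then F * coord_fps x K True S
     else F * coord_fps x K False S + fps_deriv F * block_der K (coord_fps x K True) S)"

definition block_act :: "complex fps \<Rightarrow> (nat \<Rightarrow> complex) \<Rightarrow> nat \<Rightarrow> complex" where
  "block_act F x i = (case index_at i of (K, b, n, S) \<Rightarrow> block_act_fps F x K b S $ n)"

lemma block_act_position:
  "(K, b, n, S) \<in> block_indices \<Longrightarrow> block_act F x (position (K, b, n, S)) = block_act_fps F x K b S $ n"
  by (simp add: block_act_def index_at_position)

lemma coord_fps_add: "coord_fps (\<lambda>i. x i + y i) K b = (\<lambda>S. coord_fps x K b S + coord_fps y K b S)"
  by (auto simp: coord_fps_def fps_eq_iff fun_eq_iff)

lemma coord_fps_scale: "coord_fps (\<lambda>i. c * x i) K b = (\<lambda>S. fps_const c * coord_fps x K b S)"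
  by (auto simp: coord_fps_def fps_eq_iff fun_eq_iff)

lemma block_der_add: "block_der K (\<lambda>S. x S + y S) S' = block_der K x S' + block_der K y S'"
  by (simp add: block_der_def distrib_left sum.distrib)

lemma block_der_mult: "block_der K (\<lambda>S. G * x S) S' = G * block_der K x S'"
proof -
  have "c * (d * (G * e)) = G * (c * (d * e))" for c d e :: "complex fps"
    by (simp only: mult.left_commute)
  thus ?thesis unfolding block_der_def sum_distrib_left by (simp only:)
qed

lemma block_act_add_right: "block_act F (\<lambda>i. x i + y i) = (\<lambda>i. block_act F x i + block_act F y i)"
  by (auto simp: block_act_def block_act_fps_def coord_fps_add block_der_add algebra_simps fun_eq_iff split: prod.splits)

lemma block_act_add_left: "block_act (F + G) x = (\<lambda>i. block_act F x i + block_act G x i)"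
  by (auto simp: block_act_def block_act_fps_def algebra_simps fun_eq_iff split: prod.splits)

lemma block_act_scale_right: "block_act F (\<lambda>i. c * x i) = (\<lambda>i. c * block_act F x i)"
proof
  fix i
  obtain K b n S where i: "index_at i = (K, b, n, S)" by (cases "index_at i") auto
  have "block_act_fps F (\<lambda>i. c * x i) K b S = fps_const c * block_act_fps F x K b S"
    unfolding block_act_fps_def coord_fps_scale block_der_mult by (simp add: algebra_simps)
  thus "block_act F (\<lambda>i. c * x i) i = c * block_act F x i" by (simp add: block_act_def i)
qed

lemma block_act_scale_left: "block_act (fps_const c * F) x = (\<lambda>i. c * block_act F x i)"
proof
  fix i
  obtain K b n S where i: "index_at i = (K, b, n, S)" by (cases "index_at i") auto
  have "block_act_fps (fps_const c * F) x K b S = fps_const c * block_act_fps F x K b S"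
    unfolding block_act_fps_def fps_deriv_mult_const_left by (simp add: algebra_simps)
  thus "block_act (fps_const c * F) x i = c * block_act F x i" by (simp add: block_act_def i)
qed

lemma block_act_one: "block_act 1 x = x"
proof
  fix i
  obtain K b n S where i: "index_at i = (K, b, n, S)" by (cases "index_at i") auto
  have "n \<le> 2 ^ K" using index_at_in[of i] by (simp add: i block_indices_def)
  moreover have "position (K, b, n, S) = i" using position_index_at[of i] by (simp add: i)
  ultimately show "block_act 1 x i = x i"
    by (cases b) (simp_all add: block_act_def i block_act_fps_def coord_fps_nth)
qed

lemma fps_mult_nth_cong:
  assumes "\<And>j. j \<le> n \<Longrightarrow> x $ j = y $ j"
  shows "(F * x) $ n = (F * y) $ n"
  unfolding fps_mult_nth using assms by (intro sum.cong) auto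

text \<open>
  \<open>F (G v + G' D x) + F' D (G x) = F G v + (F G)' D x\<close>, where only degrees up to \<open>2^K\<close> are seen.
\<close>

lemma block_act_mult: "block_act (F * G) x = block_act F (block_act G x)"
proof
  fix i
  obtain K b n S where i: "index_at i = (K, b, n, S)" by (cases "index_at i") auto
  have n: "n \<le> 2 ^ K" and S: "S \<subseteq> {..<K}" using index_at_in[of i] by (auto simp: i block_indices_def)
  have low: "coord_fps (block_act G x) K b S $ j = block_act_fps G x K b S $ j"
    if "j \<le> 2 ^ K" "S \<in> Pow {..<K}" for b S j
    using that by (simp add: coord_fps_nth block_act_position block_indices_def)
  have "block_act_fps F (block_act G x) K b S $ n = block_act_fps (F * G) x K b S $ n"
  proof (cases b)
    case True
    have "(F * coord_fps (block_act G x) K True S) $ n = (F * (G * coord_fps x K True S)) $ n"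
      using n S low[where b = True] by (intro fps_mult_nth_cong) (auto simp: block_act_fps_def)
    thus ?thesis using True by (simp add: block_act_fps_def mult.assoc)
  next
    case False
    have 1: "(F * coord_fps (block_act G x) K False S) $ n =
        (F * (G * coord_fps x K False S + fps_deriv G * block_der K (coord_fps x K True) S)) $ n"
      using n S low[where b = False] by (intro fps_mult_nth_cong) (auto simp: block_act_fps_def)
    have "(fps_deriv F * block_der K (coord_fps (block_act G x) K True) S) $ n =
        (fps_deriv F * block_der K (\<lambda>S. G * coord_fps x K True S) S) $ n"
      using low[where b = True] by (intro block_der_cong_low[OF _ n]) (auto simp: block_act_fps_def)
    hence 2: "(fps_deriv F * block_der K (coord_fps (block_act G x) K True) S) $ n =
        (fps_deriv F * (G * block_der K (coord_fps x K True) S)) $ n"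
      unfolding block_der_mult .
    have "block_act_fps F (block_act G x) K b S $ n =
        (F * (G * coord_fps x K False S + fps_deriv G * block_der K (coord_fps x K True) S)
          + fps_deriv F * (G * block_der K (coord_fps x K True) S)) $ n"
      using False 1 2 by (simp only: block_act_fps_def if_False fps_add_nth)
    also have "F * (G * coord_fps x K False S + fps_deriv G * block_der K (coord_fps x K True) S)
          + fps_deriv F * (G * block_der K (coord_fps x K True) S) = block_act_fps (F * G) x K b S"
      using False by (simp add: block_act_fps_def algebra_simps)
    finally show ?thesis .
  qed
  thus "block_act (F * G) x i = block_act F (block_act G x) i" by (simp add: block_act_def i)
qed

text \<open>
  In each block the square norm grows at most by \<open>2 \<cdot> 512 + 1 = 1025\<close> on \<open>x\<close> and \<open>2\<close> on \<open>v\<close>, both below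
  \<open>33\<^sup>2\<close>. A finite set of positions lies in finitely many blocks, so the bound passes to the sum.
\<close>

lemma block_act_bound:
  assumes hol: "\<phi> holomorphic_on ball 0 1" and B: "\<And>z. cmod z < 1 \<Longrightarrow> cmod (\<phi> z) \<le> B" and x: "x \<in> l2"
  shows "block_act (fps_expansion \<phi> 0) x \<in> l2" "lnorm (block_act (fps_expansion \<phi> 0) x) \<le> 33 * B * lnorm x"
proof -
  let ?F = "fps_expansion \<phi> 0"
  have B0: "0 \<le> B" using B[of 0] norm_ge_zero[of "\<phi> 0"] by (simp del: norm_ge_zero)
  define Z where "Z y K b = (\<Sum>S\<in>Pow {..<K}. \<Sum>n\<le>2 ^ K. (cmod (y (position (K, b, n, S))))\<^sup>2)" for y :: "nat \<Rightarrow> complex" and K b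
  have Zc: "(\<Sum>S\<in>Pow {..<K}. \<Sum>n\<le>2 ^ K. (cmod (coord_fps y K b S $ n))\<^sup>2) = Z y K b" for y K b
    unfolding Z_def by (intro sum.cong refl) (simp add: coord_fps_nth)
  have Za: "Z (block_act ?F x) K b = (\<Sum>S\<in>Pow {..<K}. \<Sum>n\<le>2 ^ K. (cmod (block_act_fps ?F x K b S $ n))\<^sup>2)" for K b
    unfolding Z_def by (intro sum.cong refl) (simp add: block_act_position block_indices_def)
  have Z0: "0 \<le> Z y K b" for y K b by (simp add: Z_def sum_nonneg)
  have m: "(\<Sum>S\<in>Pow {..<K}. \<Sum>n\<le>2 ^ K. (cmod ((?F * coord_fps x K b S) $ n))\<^sup>2) \<le> B\<^sup>2 * Z x K b" for K b
    unfolding Zc[symmetric] sum_distrib_left[of _ _ "Pow {..<K}"]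
    by (intro sum_mono bounded_holomorphic_action_bound[OF hol B])
  have block: "Z (block_act ?F x) K True + Z (block_act ?F x) K False \<le> (33 * B)\<^sup>2 * (Z x K True + Z x K False)" for K
  proof -
    have 1: "Z (block_act ?F x) K True \<le> B\<^sup>2 * Z x K True"
      unfolding Za using m[of K True] by (simp add: block_act_fps_def)
    have "Z (block_act ?F x) K False \<le> (\<Sum>S\<in>Pow {..<K}. \<Sum>n\<le>2 ^ K.
        2 * (cmod ((?F * coord_fps x K False S) $ n))\<^sup>2 + 2 * (cmod ((fps_deriv ?F * block_der K (coord_fps x K True) S) $ n))\<^sup>2)"
      unfolding Za
    proof (intro sum_mono)
      fix S n
      have "(cmod (a + b))\<^sup>2 \<le> 2 * (cmod a)\<^sup>2 + 2 * (cmod b)\<^sup>2" for a b :: complex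
      proof -
        have "(cmod (a + b))\<^sup>2 \<le> (cmod a + cmod b)\<^sup>2"
          by (intro power_mono norm_triangle_ineq) simp
        also have "\<dots> \<le> 2 * (cmod a)\<^sup>2 + 2 * (cmod b)\<^sup>2"
          using sum_squares_bound[of "cmod a" "cmod b"] by (simp add: power2_sum)
        finally show ?thesis .
      qed
      thus "(cmod (block_act_fps ?F x K False S $ n))\<^sup>2 \<le> 2 * (cmod ((?F * coord_fps x K False S) $ n))\<^sup>2 +
          2 * (cmod ((fps_deriv ?F * block_der K (coord_fps x K True) S) $ n))\<^sup>2"
        by (simp add: block_act_fps_def)
    qed
    also have "\<dots> = 2 * (\<Sum>S\<in>Pow {..<K}. \<Sum>n\<le>2 ^ K. (cmod ((?F * coord_fps x K False S) $ n))\<^sup>2) +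
        2 * (\<Sum>S\<in>Pow {..<K}. \<Sum>n\<le>2 ^ K. (cmod ((fps_deriv ?F * block_der K (coord_fps x K True) S) $ n))\<^sup>2)"
      by (simp add: sum.distrib sum_distrib_left)
    also have "\<dots> \<le> 2 * (B\<^sup>2 * Z x K False) + 2 * (512 * B\<^sup>2 * Z x K True)"
      using m[of K False] bounded_holomorphic_action_bound(2)[OF hol B, of K "coord_fps x K True"] unfolding Zc by simp
    finally have "Z (block_act ?F x) K True + Z (block_act ?F x) K False \<le> B\<^sup>2 * (1025 * Z x K True + 2 * Z x K False)"
      using 1 by (simp add: algebra_simps)
    also have "\<dots> \<le> B\<^sup>2 * (33\<^sup>2 * (Z x K True + Z x K False))"
      using Z0[of x K True] Z0[of x K False] by (intro mult_left_mono) auto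
    finally show ?thesis by (simp add: power_mult_distrib mult_ac)
  qed
  have fin: "(\<Sum>i\<in>A. (cmod (block_act ?F x i))\<^sup>2) \<le> (33 * B * lnorm x)\<^sup>2" if A: "finite A" for A
  proof -
    define k where "k = Suc (Max (insert 0 (fst ` index_at ` A)))"
    define J :: "block_index set" where "J = (SIGMA K:{..<k}. UNIV \<times> {..2 ^ K} \<times> Pow {..<K})"
    have J: "J \<subseteq> block_indices" "finite J" by (auto simp: J_def block_indices_def)
    have sumJ: "(\<Sum>i\<in>position ` J. (cmod (y i))\<^sup>2) = (\<Sum>K<k. Z y K True + Z y K False)" for y
    proof -
      have "(\<Sum>i\<in>position ` J. (cmod (y i))\<^sup>2) = (\<Sum>\<kappa>\<in>J. (cmod (y (position \<kappa>)))\<^sup>2)"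
        by (subst sum.reindex[OF inj_on_subset[OF inj_on_position J(1)]]) simp
      also have "\<dots> = (\<Sum>K<k. \<Sum>p\<in>UNIV \<times> {..2 ^ K} \<times> Pow {..<K}. (cmod (y (position (K, p))))\<^sup>2)"
        unfolding J_def
        using sum.Sigma[of "{..<k}" "\<lambda>K. UNIV \<times> {..2 ^ K} \<times> Pow {..<K}" "\<lambda>K p. (cmod (y (position (K, p))))\<^sup>2"]
        by (simp add: case_prod_unfold)
      also have "\<dots> = (\<Sum>K<k. \<Sum>b\<in>UNIV. \<Sum>n\<le>2 ^ K. \<Sum>S\<in>Pow {..<K}. (cmod (y (position (K, b, n, S))))\<^sup>2)"
        by (simp add: sum.cartesian_product)
      also have "\<dots> = (\<Sum>K<k. \<Sum>b\<in>UNIV. Z y K b)"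
        unfolding Z_def by (intro sum.cong refl sum.swap)
      also have "\<dots> = (\<Sum>K<k. Z y K True + Z y K False)"
        by (simp add: UNIV_bool add.commute)
      finally show ?thesis .
    qed
    have "A \<subseteq> position ` J"
    proof
      fix i assume i: "i \<in> A"
      have "fst (index_at i) \<le> Max (insert 0 (fst ` index_at ` A))"
        using A i by (intro Max_ge) auto
      hence "index_at i \<in> J" using index_at_in[of i] by (auto simp: J_def k_def block_indices_def)
      thus "i \<in> position ` J" using position_index_at[of i] by (metis image_eqI)
    qed
    hence "(\<Sum>i\<in>A. (cmod (block_act ?F x i))\<^sup>2) \<le> (\<Sum>i\<in>position ` J. (cmod (block_act ?F x i))\<^sup>2)"
      using J by (intro sum_mono2) auto
    also have "\<dots> \<le> (33 * B)\<^sup>2 * (\<Sum>i\<in>position ` J. (cmod (x i))\<^sup>2)"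
      unfolding sumJ sum_distrib_left by (intro sum_mono block)
    also have "\<dots> \<le> (33 * B)\<^sup>2 * (lnorm x)\<^sup>2"
      using J by (intro mult_left_mono sum_le_lnorm_sq x) auto
    finally show ?thesis by (simp add: power_mult_distrib)
  qed
  show "block_act ?F x \<in> l2" "lnorm (block_act ?F x) \<le> 33 * B * lnorm x"
    using l2_bounded[OF fin] B0 lnorm_nonneg[OF x] by auto
qed

no_notation fps_nth (infixl "$" 75)

section \<open>Von Neumann's inequality for anticommuting coefficients\<close>

text \<open>
  The powers of an operator on \<open>l2\<close> that is a contraction for some other positive semidefinite form,
  such as the form pulled back along a similarity.
\<close>

locale contractive_semigroup =
  fixes \<phi> :: "(nat \<Rightarrow> complex) \<Rightarrow> (nat \<Rightarrow> complex) \<Rightarrow> complex"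
    and \<tau> :: "nat \<Rightarrow> (nat \<Rightarrow> complex) \<Rightarrow> nat \<Rightarrow> complex"
  assumes form_add: "\<lbrakk>x \<in> l2; y \<in> l2; z \<in> l2\<rbrakk> \<Longrightarrow> \<phi> (\<lambda>i. x i + y i) z = \<phi> x z + \<phi> y z"
    and form_scale: "\<lbrakk>x \<in> l2; z \<in> l2\<rbrakk> \<Longrightarrow> \<phi> (\<lambda>i. c * x i) z = c * \<phi> x z"
    and form_commute: "\<lbrakk>x \<in> l2; z \<in> l2\<rbrakk> \<Longrightarrow> \<phi> z x = cnj (\<phi> x z)"
    and form_nonneg: "x \<in> l2 \<Longrightarrow> 0 \<le> Re (\<phi> x x)"
    and semigroup_closed: "x \<in> l2 \<Longrightarrow> \<tau> n x \<in> l2"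
    and semigroup_add: "\<lbrakk>x \<in> l2; y \<in> l2\<rbrakk> \<Longrightarrow> \<tau> n (\<lambda>i. x i + y i) = (\<lambda>i. \<tau> n x i + \<tau> n y i)"
    and semigroup_scale: "x \<in> l2 \<Longrightarrow> \<tau> n (\<lambda>i. c * x i) = (\<lambda>i. c * \<tau> n x i)"
    and semigroup_0: "x \<in> l2 \<Longrightarrow> \<tau> 0 x = x"
    and semigroup_plus: "x \<in> l2 \<Longrightarrow> \<tau> (m + n) x = \<tau> m (\<tau> n x)"
    and contraction: "x \<in> l2 \<Longrightarrow> Re (\<phi> (\<tau> n x) (\<tau> n x)) \<le> Re (\<phi> x x)"
begin

definition lincomb :: "'a set \<Rightarrow> ('a \<Rightarrow> complex) \<Rightarrow> ('a \<Rightarrow> nat \<Rightarrow> complex) \<Rightarrow> nat \<Rightarrow> complex" where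
  "lincomb A c \<xi> i = (\<Sum>a\<in>A. c a * \<xi> a i)"

lemma lincomb_insert:
  "\<lbrakk>finite A; a \<notin> A\<rbrakk> \<Longrightarrow> lincomb (insert a A) c \<xi> = (\<lambda>i. c a * \<xi> a i + lincomb A c \<xi> i)"
  by (auto simp: lincomb_def fun_eq_iff)

lemma lincomb_empty: "lincomb {} c \<xi> = (\<lambda>i. 0)"
  by (auto simp: lincomb_def fun_eq_iff)

lemma lincomb_closed:
  assumes "finite A" "\<And>a. a \<in> A \<Longrightarrow> \<xi> a \<in> l2"
  shows "lincomb A c \<xi> \<in> l2"
  using assms
proof (induction A rule: finite_induct)
  case (insert a A)
  thus ?case unfolding lincomb_insert[OF insert(1,2)] by (intro l2_add(1) l2_scale(1)) auto
qed (simp add: lincomb_empty l2_zero)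

lemma form_zero: "z \<in> l2 \<Longrightarrow> \<phi> (\<lambda>i. 0) z = 0"
  using form_scale[OF l2_zero, of z 0] by simp

lemma form_lincomb_left:
  assumes "finite A" "\<And>a. a \<in> A \<Longrightarrow> \<xi> a \<in> l2" "z \<in> l2"
  shows "\<phi> (lincomb A c \<xi>) z = (\<Sum>a\<in>A. c a * \<phi> (\<xi> a) z)"
  using assms
proof (induction A rule: finite_induct)
  case (insert a A)
  have 1: "(\<lambda>i. c a * \<xi> a i) \<in> l2" "lincomb A c \<xi> \<in> l2"
    using insert by (auto intro!: l2_scale(1) lincomb_closed)
  show ?case unfolding lincomb_insert[OF insert(1,2)]
    using insert by (subst form_add[OF 1 \<open>z \<in> l2\<close>]) (simp add: form_scale)
qed (simp add: lincomb_empty form_zero)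

lemma form_lincomb_right:
  assumes "finite A" "\<And>a. a \<in> A \<Longrightarrow> \<xi> a \<in> l2" "z \<in> l2"
  shows "\<phi> z (lincomb A c \<xi>) = (\<Sum>a\<in>A. cnj (c a) * \<phi> z (\<xi> a))"
proof -
  have "\<phi> z (lincomb A c \<xi>) = cnj (\<phi> (lincomb A c \<xi>) z)"
    by (rule form_commute[OF lincomb_closed[OF assms(1,2)] assms(3)])
  also have "\<dots> = (\<Sum>a\<in>A. cnj (c a) * cnj (\<phi> (\<xi> a) z))"
    by (simp add: form_lincomb_left[OF assms])
  also have "\<dots> = (\<Sum>a\<in>A. cnj (c a) * \<phi> z (\<xi> a))"
    using assms by (intro sum.cong refl) (simp add: form_commute[of _ z])
  finally show ?thesis .
qed

lemma semigroup_zero: "\<tau> n (\<lambda>i. 0) = (\<lambda>i. 0)"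
  using semigroup_scale[OF l2_zero, of n 0] by simp

lemma semigroup_lincomb:
  assumes "finite A" "\<And>a. a \<in> A \<Longrightarrow> \<xi> a \<in> l2"
  shows "\<tau> n (lincomb A c \<xi>) = lincomb A c (\<lambda>a. \<tau> n (\<xi> a))"
  using assms
proof (induction A rule: finite_induct)
  case (insert a A)
  have 1: "(\<lambda>i. c a * \<xi> a i) \<in> l2" "lincomb A c \<xi> \<in> l2"
    using insert by (auto intro!: l2_scale(1) lincomb_closed)
  show ?case unfolding lincomb_insert[OF insert(1,2)]
    using insert by (subst semigroup_add[OF 1]) (simp add: semigroup_scale)
qed (simp add: lincomb_empty semigroup_zero)

lemma form_sum_square:
  assumes "x \<in> l2" "y \<in> l2"
  shows "Re (\<phi> (\<lambda>i. x i + y i) (\<lambda>i. x i + y i)) = Re (\<phi> x x) + 2 * Re (\<phi> y x) + Re (\<phi> y y)"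
proof -
  let ?s = "\<lambda>i. x i + y i"
  have s: "?s \<in> l2" by (rule l2_add(1)[OF assms])
  have "\<phi> z ?s = \<phi> z x + \<phi> z y" if "z \<in> l2" for z
    using form_commute[OF s that] form_add[OF assms that] form_commute[OF assms(1) that] form_commute[OF assms(2) that]
    by simp
  hence "\<phi> ?s ?s = \<phi> x x + \<phi> x y + (\<phi> y x + \<phi> y y)"
    using form_add[OF assms s] assms by simp
  thus ?thesis using form_commute[OF assms(2,1)] by simp
qed

text \<open>
  The right-hand side is the square norm of \<open>\<Sum> U^m\<^sub>l \<xi>\<^sub>l\<close> for the isometric dilation \<open>U\<close> of \<open>T\<close>, and
  projecting the dilation space to the original space can only decrease the norm. Directly: by Horner's
  scheme \<open>y = \<xi>\<^sub>0 + T^n y'\<close> with \<open>n = m\<^sub>1 - m\<^sub>0\<close>, and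
  \<open>\<parallel>y\<parallel>\<^sup>2 = \<parallel>\<xi>\<^sub>0\<parallel>\<^sup>2 + 2 Re \<langle>T^n y', \<xi>\<^sub>0\<rangle> + \<parallel>T^n y'\<parallel>\<^sup>2\<close>, where the last term is at most \<open>\<parallel>y'\<parallel>\<^sup>2\<close>.
\<close>

lemma toeplitz_forward:
  fixes K :: nat
  assumes "\<And>l. \<xi> l \<in> l2" "mono m" "p \<le> m 0"
  shows "Re (\<phi> (lincomb {..<K} (\<lambda>_. 1) (\<lambda>l. \<tau> (m l - p) (\<xi> l))) (lincomb {..<K} (\<lambda>_. 1) (\<lambda>l. \<tau> (m l - p) (\<xi> l)))) \<le>
    (\<Sum>l<K. Re (\<phi> (\<xi> l) (\<xi> l))) + 2 * (\<Sum>l<K. \<Sum>l'<l. Re (\<phi> (\<tau> (m l - m l') (\<xi> l)) (\<xi> l')))"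
  using assms
proof (induction K arbitrary: \<xi> m p)
  case 0
  show ?case by (simp add: lincomb_empty form_zero l2_zero)
next
  case (Suc K)
  define y where "y = lincomb {..<K} (\<lambda>_. 1) (\<lambda>l. \<tau> (m (Suc l) - m 0) (\<xi> (Suc l)))"
  have mono: "m 0 \<le> m l" for l using Suc.prems(2) by (simp add: monoD)
  have y: "y \<in> l2" unfolding y_def by (intro lincomb_closed semigroup_closed Suc.prems) auto
  have tl: "\<tau> (m l - p) (\<xi> l) = \<tau> (m 0 - p) (\<tau> (m l - m 0) (\<xi> l))" for l
    using semigroup_plus[of "\<xi> l" "m 0 - p" "m l - m 0"] Suc.prems mono[of l] by simp
  have "lincomb {..<Suc K} (\<lambda>_. 1) (\<lambda>l. \<tau> (m l - p) (\<xi> l)) =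
      lincomb {..<Suc K} (\<lambda>_. 1) (\<lambda>l. \<tau> (m 0 - p) (\<tau> (m l - m 0) (\<xi> l)))"
    by (simp only: tl)
  also have "\<dots> = \<tau> (m 0 - p) (lincomb {..<Suc K} (\<lambda>_. 1) (\<lambda>l. \<tau> (m l - m 0) (\<xi> l)))"
    by (subst semigroup_lincomb) (auto intro: semigroup_closed Suc.prems)
  also have "lincomb {..<Suc K} (\<lambda>_. 1) (\<lambda>l. \<tau> (m l - m 0) (\<xi> l)) = (\<lambda>i. \<xi> 0 i + y i)"
    unfolding lincomb_def y_def sum.lessThan_Suc_shift using Suc.prems(1) by (simp add: semigroup_0 lincomb_def)
  finally have eq: "lincomb {..<Suc K} (\<lambda>_. 1) (\<lambda>l. \<tau> (m l - p) (\<xi> l)) = \<tau> (m 0 - p) (\<lambda>i. \<xi> 0 i + y i)" .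
  have cross: "Re (\<phi> y (\<xi> 0)) = (\<Sum>l<K. Re (\<phi> (\<tau> (m (Suc l) - m 0) (\<xi> (Suc l))) (\<xi> 0)))"
    unfolding y_def by (subst form_lincomb_left) (auto intro: semigroup_closed Suc.prems)
  have IH: "Re (\<phi> y y) \<le> (\<Sum>l<K. Re (\<phi> (\<xi> (Suc l)) (\<xi> (Suc l)))) +
      2 * (\<Sum>l<K. \<Sum>l'<l. Re (\<phi> (\<tau> (m (Suc l) - m (Suc l')) (\<xi> (Suc l))) (\<xi> (Suc l'))))"
    unfolding y_def using Suc.prems mono[of 1]
    by (intro Suc.IH[of "\<lambda>l. \<xi> (Suc l)" "\<lambda>l. m (Suc l)" "m 0"]) (auto simp: mono_def)
  have dbl: "(\<Sum>l<Suc K. \<Sum>l'<l. g l l') = (\<Sum>l<K. g (Suc l) 0) + (\<Sum>l<K. \<Sum>l'<l. g (Suc l) (Suc l'))" for g :: "nat \<Rightarrow> nat \<Rightarrow> real"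
    by (simp only: sum.lessThan_Suc_shift sum.distrib) simp
  have "Re (\<phi> (\<tau> (m 0 - p) (\<lambda>i. \<xi> 0 i + y i)) (\<tau> (m 0 - p) (\<lambda>i. \<xi> 0 i + y i))) \<le>
      Re (\<phi> (\<lambda>i. \<xi> 0 i + y i) (\<lambda>i. \<xi> 0 i + y i))"
    by (intro contraction l2_add(1) Suc.prems y)
  also have "\<dots> = Re (\<phi> (\<xi> 0) (\<xi> 0)) + 2 * Re (\<phi> y (\<xi> 0)) + Re (\<phi> y y)"
    by (rule form_sum_square[OF Suc.prems(1) y])
  also have "\<dots> \<le> Re (\<phi> (\<xi> 0) (\<xi> 0)) + 2 * (\<Sum>l<K. Re (\<phi> (\<tau> (m (Suc l) - m 0) (\<xi> (Suc l))) (\<xi> 0))) +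
     ((\<Sum>l<K. Re (\<phi> (\<xi> (Suc l)) (\<xi> (Suc l)))) +
      2 * (\<Sum>l<K. \<Sum>l'<l. Re (\<phi> (\<tau> (m (Suc l) - m (Suc l')) (\<xi> (Suc l))) (\<xi> (Suc l')))))"
    using IH cross by simp
  also have "\<dots> = (\<Sum>l<Suc K. Re (\<phi> (\<xi> l) (\<xi> l))) + 2 * (\<Sum>l<Suc K. \<Sum>l'<l. Re (\<phi> (\<tau> (m l - m l') (\<xi> l)) (\<xi> l')))"
    unfolding dbl sum.lessThan_Suc_shift[of "\<lambda>l. Re (\<phi> (\<xi> l) (\<xi> l))"] by (simp add: algebra_simps)
  finally show ?case unfolding eq .
qed

text \<open>
  The same with exponents \<open>p - m\<^sub>l\<close>, which decrease; here Horner's scheme starts from the other end.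
\<close>

lemma toeplitz_backward:
  fixes K :: nat
  assumes "\<And>l. \<eta> l \<in> l2" "mono m" "\<And>l. l < K \<Longrightarrow> m l \<le> p"
  shows "Re (\<phi> (lincomb {..<K} (\<lambda>_. 1) (\<lambda>l. \<tau> (p - m l) (\<eta> l))) (lincomb {..<K} (\<lambda>_. 1) (\<lambda>l. \<tau> (p - m l) (\<eta> l)))) \<le>
    (\<Sum>l<K. Re (\<phi> (\<eta> l) (\<eta> l))) + 2 * (\<Sum>l<K. \<Sum>l'<l. Re (\<phi> (\<tau> (m l - m l') (\<eta> l')) (\<eta> l)))"
  using assms(3)
proof (induction K arbitrary: p)
  case 0
  show ?case by (simp add: lincomb_empty form_zero l2_zero)
next
  case (Suc K)
  define y where "y = lincomb {..<K} (\<lambda>_. 1) (\<lambda>l. \<tau> (m K - m l) (\<eta> l))"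
  have mono: "m l \<le> m K" if "l < Suc K" for l using assms(2) that by (simp add: monoD)
  have mp: "m K \<le> p" using Suc.prems by simp
  have y: "y \<in> l2" unfolding y_def by (intro lincomb_closed semigroup_closed assms) auto
  have tl: "\<tau> (p - m l) (\<eta> l) = \<tau> (p - m K) (\<tau> (m K - m l) (\<eta> l))" if "l < Suc K" for l
    using semigroup_plus[of "\<eta> l" "p - m K" "m K - m l"] assms(1) mono[OF that] mp by simp
  have "lincomb {..<Suc K} (\<lambda>_. 1) (\<lambda>l. \<tau> (p - m l) (\<eta> l)) =
      lincomb {..<Suc K} (\<lambda>_. 1) (\<lambda>l. \<tau> (p - m K) (\<tau> (m K - m l) (\<eta> l)))"
    unfolding lincomb_def by (intro ext sum.cong refl) (simp only: lessThan_iff tl)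
  also have "\<dots> = \<tau> (p - m K) (lincomb {..<Suc K} (\<lambda>_. 1) (\<lambda>l. \<tau> (m K - m l) (\<eta> l)))"
    by (subst semigroup_lincomb) (auto intro: semigroup_closed assms)
  also have "lincomb {..<Suc K} (\<lambda>_. 1) (\<lambda>l. \<tau> (m K - m l) (\<eta> l)) = (\<lambda>i. \<eta> K i + y i)"
    unfolding lincomb_def y_def using assms(1) by (simp add: semigroup_0 lincomb_def add.commute)
  finally have eq: "lincomb {..<Suc K} (\<lambda>_. 1) (\<lambda>l. \<tau> (p - m l) (\<eta> l)) = \<tau> (p - m K) (\<lambda>i. \<eta> K i + y i)" .
  have cross: "Re (\<phi> y (\<eta> K)) = (\<Sum>l<K. Re (\<phi> (\<tau> (m K - m l) (\<eta> l)) (\<eta> K)))"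
    unfolding y_def by (subst form_lincomb_left) (auto intro: semigroup_closed assms)
  have IH: "Re (\<phi> y y) \<le> (\<Sum>l<K. Re (\<phi> (\<eta> l) (\<eta> l))) + 2 * (\<Sum>l<K. \<Sum>l'<l. Re (\<phi> (\<tau> (m l - m l') (\<eta> l')) (\<eta> l)))"
    unfolding y_def using mono by (intro Suc.IH) auto
  have "Re (\<phi> (\<tau> (p - m K) (\<lambda>i. \<eta> K i + y i)) (\<tau> (p - m K) (\<lambda>i. \<eta> K i + y i))) \<le>
      Re (\<phi> (\<lambda>i. \<eta> K i + y i) (\<lambda>i. \<eta> K i + y i))"
    by (intro contraction l2_add(1) assms y)
  also have "\<dots> = Re (\<phi> (\<eta> K) (\<eta> K)) + 2 * Re (\<phi> y (\<eta> K)) + Re (\<phi> y y)"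
    by (rule form_sum_square[OF assms(1) y])
  also have "\<dots> \<le> (\<Sum>l<Suc K. Re (\<phi> (\<eta> l) (\<eta> l))) + 2 * (\<Sum>l<Suc K. \<Sum>l'<l. Re (\<phi> (\<tau> (m l - m l') (\<eta> l')) (\<eta> l)))"
    using IH cross by (simp add: algebra_simps)
  finally show ?case unfolding eq .
qed

text \<open>
  For an isometry \<open>U\<close> put \<open>a = \<Sum> U^m\<^sub>l C\<^sub>l\<close> and \<open>b = \<Sum> U^(p - m\<^sub>l) C\<^sub>l\<^sup>*\<close>. Then
  \<open>\<parallel>a u\<parallel>\<^sup>2 + \<parallel>b u\<parallel>\<^sup>2 = K \<parallel>u\<parallel>\<^sup>2\<close>, since by anticommutation the cross terms for \<open>l\<close> and \<open>l'\<close> cancel. Here \<open>N\<close>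
  and \<open>N'\<close> stand for the two square norms on the left in the isometric dilation.
\<close>

lemma car_von_neumann:
  fixes u :: "nat set \<Rightarrow> nat \<Rightarrow> complex" and K :: nat
  assumes u: "\<And>S. u S \<in> l2" and m: "mono m"
  defines "\<xi> \<equiv> \<lambda>l S'. lincomb (Pow {..<K}) (\<lambda>S. of_real (car l S' S)) u"
  defines "y \<equiv> \<lambda>S'. lincomb {..<K} (\<lambda>_. 1) (\<lambda>l. \<tau> (m l) (\<xi> l S'))"
  shows "(\<Sum>S'\<in>Pow {..<K}. Re (\<phi> (y S') (y S'))) \<le> real K * (\<Sum>S\<in>Pow {..<K}. Re (\<phi> (u S) (u S)))"
proof -
  let ?P = "Pow {..<K}"
  define \<eta> where "\<eta> l S' = lincomb ?P (\<lambda>S. of_real (car l S S')) u" for l S'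
  have \<xi>: "\<xi> l S' \<in> l2" and \<eta>: "\<eta> l S' \<in> l2" for l S'
    unfolding \<xi>_def \<eta>_def by (intro lincomb_closed u; simp)+
  define G where "G n S S'' = \<phi> (\<tau> n (u S)) (u S'')" for n S S''
  have gen: "\<phi> (\<tau> n (lincomb ?P c u)) (lincomb ?P d u) = (\<Sum>S\<in>?P. \<Sum>S''\<in>?P. c S * cnj (d S'') * G n S S'')" for n c d
  proof -
    have "\<phi> (\<tau> n (lincomb ?P c u)) (lincomb ?P d u) = \<phi> (lincomb ?P c (\<lambda>S. \<tau> n (u S))) (lincomb ?P d u)"
      by (subst semigroup_lincomb) (auto intro: u)
    also have "\<dots> = (\<Sum>S\<in>?P. c S * \<phi> (\<tau> n (u S)) (lincomb ?P d u))"
      by (rule form_lincomb_left) (auto intro!: semigroup_closed u lincomb_closed)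
    also have "\<dots> = (\<Sum>S\<in>?P. c S * (\<Sum>S''\<in>?P. cnj (d S'') * G n S S''))"
      unfolding G_def by (intro sum.cong refl, subst form_lincomb_right) (auto intro!: semigroup_closed u)
    finally show ?thesis by (simp add: sum_distrib_left mult.assoc)
  qed
  have tot: "(\<Sum>S'\<in>?P. Re (\<phi> (\<tau> n (\<xi> l S')) (\<xi> l' S')) + Re (\<phi> (\<tau> n (\<eta> l' S')) (\<eta> l S'))) =
      (if l = l' then \<Sum>S\<in>?P. Re (G n S S) else 0)" if "l < K" "l' < K" for n l l'
  proof -
    have "(\<Sum>S'\<in>?P. \<phi> (\<tau> n (\<xi> l S')) (\<xi> l' S') + \<phi> (\<tau> n (\<eta> l' S')) (\<eta> l S')) =
        (\<Sum>S'\<in>?P. \<Sum>S\<in>?P. \<Sum>S''\<in>?P. of_real (car l S' S * car l' S' S'' + car l' S S' * car l S'' S') * G n S S'')"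
      unfolding \<xi>_def \<eta>_def gen by (simp add: sum.distrib distrib_right)
    also have "\<dots> = (if l' = l then \<Sum>S\<in>?P. G n S S else 0)"
      by (rule car_gram_sum[OF that(2,1)])
    finally have *: "(\<Sum>S'\<in>?P. \<phi> (\<tau> n (\<xi> l S')) (\<xi> l' S') + \<phi> (\<tau> n (\<eta> l' S')) (\<eta> l S')) =
      (if l' = l then \<Sum>S\<in>?P. G n S S else 0)" .
    show ?thesis using arg_cong[OF *, of Re] by (auto simp: Re_sum)
  qed
  define N where "N S' = (\<Sum>l<K. Re (\<phi> (\<xi> l S') (\<xi> l S'))) + 2 * (\<Sum>l<K. \<Sum>l'<l. Re (\<phi> (\<tau> (m l - m l') (\<xi> l S')) (\<xi> l' S')))" for S'
  define N' where "N' S' = (\<Sum>l<K. Re (\<phi> (\<eta> l S') (\<eta> l S'))) + 2 * (\<Sum>l<K. \<Sum>l'<l. Re (\<phi> (\<tau> (m l - m l') (\<eta> l' S')) (\<eta> l S')))" for S'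
  have le: "Re (\<phi> (y S') (y S')) \<le> N S'" for S'
    using toeplitz_forward[where \<xi> = "\<lambda>l. \<xi> l S'" and p = 0 and K = K, OF \<xi> m] by (simp add: y_def N_def)
  have nonneg: "0 \<le> N' S'" for S'
  proof -
    have "0 \<le> Re (\<phi> (lincomb {..<K} (\<lambda>_. 1) (\<lambda>l. \<tau> (m K - m l) (\<eta> l S'))) (lincomb {..<K} (\<lambda>_. 1) (\<lambda>l. \<tau> (m K - m l) (\<eta> l S'))))"
      by (intro form_nonneg lincomb_closed semigroup_closed \<eta>) simp
    also have "\<dots> \<le> N' S'"
      unfolding N'_def using m by (intro toeplitz_backward \<eta>) (auto simp: mono_def)
    finally show ?thesis .
  qed
  have "(\<Sum>S'\<in>?P. Re (\<phi> (y S') (y S'))) \<le> (\<Sum>S'\<in>?P. N S' + N' S')"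
    by (intro sum_mono add_increasing2 le nonneg)
  also have "\<dots> = (\<Sum>l<K. \<Sum>S'\<in>?P. Re (\<phi> (\<tau> 0 (\<xi> l S')) (\<xi> l S')) + Re (\<phi> (\<tau> 0 (\<eta> l S')) (\<eta> l S')))
     + 2 * (\<Sum>l<K. \<Sum>l'<l. \<Sum>S'\<in>?P. Re (\<phi> (\<tau> (m l - m l') (\<xi> l S')) (\<xi> l' S')) + Re (\<phi> (\<tau> (m l - m l') (\<eta> l' S')) (\<eta> l S')))"
  proof -
    have sw: "(\<Sum>S'\<in>?P. \<Sum>l<n. f l S') = (\<Sum>l<n. \<Sum>S'\<in>?P. f l S')" for f :: "nat \<Rightarrow> nat set \<Rightarrow> real" and n
      by (rule sum.swap)
    show ?thesis
      unfolding N_def N'_def semigroup_0[OF \<xi>] semigroup_0[OF \<eta>] sum.distrib sw sum_distrib_left[symmetric]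
      by (simp add: algebra_simps)
  qed
  also have "(\<Sum>l<K. \<Sum>l'<l. \<Sum>S'\<in>?P. Re (\<phi> (\<tau> (m l - m l') (\<xi> l S')) (\<xi> l' S')) + Re (\<phi> (\<tau> (m l - m l') (\<eta> l' S')) (\<eta> l S'))) = 0"
  proof (rule sum.neutral, rule ballI, rule sum.neutral, rule ballI)
    fix l l' assume "l \<in> {..<K}" "l' \<in> {..<l}"
    thus "(\<Sum>S'\<in>?P. Re (\<phi> (\<tau> (m l - m l') (\<xi> l S')) (\<xi> l' S')) + Re (\<phi> (\<tau> (m l - m l') (\<eta> l' S')) (\<eta> l S'))) = 0"
      by (subst tot) auto
  qed
  also have "(\<Sum>l<K. \<Sum>S'\<in>?P. Re (\<phi> (\<tau> 0 (\<xi> l S')) (\<xi> l S')) + Re (\<phi> (\<tau> 0 (\<eta> l S')) (\<eta> l S'))) =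
      (\<Sum>l<K. \<Sum>S\<in>?P. Re (\<phi> (u S) (u S)))"
  proof (rule sum.cong[OF refl])
    fix l assume "l \<in> {..<K}"
    thus "(\<Sum>S'\<in>?P. Re (\<phi> (\<tau> 0 (\<xi> l S')) (\<xi> l S')) + Re (\<phi> (\<tau> 0 (\<eta> l S')) (\<eta> l S'))) = (\<Sum>S\<in>?P. Re (\<phi> (u S) (u S)))"
      by (subst tot) (auto simp: G_def semigroup_0 u)
  qed
  finally show ?thesis by simp
qed

end

notation fps_nth (infixl "$" 75)

section \<open>The module that is not similar to a contractive one\<close>

text \<open>
  The constant power series with value the basis vector \<open>S\<close> in the second component of block \<open>K\<close>.
\<close>

definition block_vector :: "nat \<Rightarrow> nat set \<Rightarrow> nat \<Rightarrow> complex" where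
  "block_vector K S i = (if i = position (K, True, 0, S) then 1 else 0)"

lemma block_vector_l2: "block_vector K S \<in> l2" "lnorm (block_vector K S) \<le> 1"
proof -
  have "(\<Sum>i\<in>F. (cmod (block_vector K S i))\<^sup>2) \<le> 1\<^sup>2" if "finite F" for F
  proof -
    have "(\<Sum>i\<in>F. (cmod (block_vector K S i))\<^sup>2) = (\<Sum>i\<in>F. if i = position (K, True, 0, S) then 1 else 0)"
      by (intro sum.cong) (auto simp: block_vector_def)
    thus ?thesis using that by simp
  qed
  thus "block_vector K S \<in> l2" "lnorm (block_vector K S) \<le> 1"
    using l2_bounded[of "block_vector K S" 1] by auto
qed

text \<open>
  In the top degree of the first component only \<open>k = l\<close> contributes to the action of \<open>X^(2^(l+1))\<close>. It
  sends the constant series \<open>z\<close> to \<open>C\<^sub>l z\<close>, the factor \<open>2^(l+1)\<close> from the derivative cancelling the weight. As \<open>z\<close>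
  is the row \<open>S'\<close> of \<open>C\<^sub>l\<close>, the coefficient at \<open>S'\<close> is the square sum of that row.
\<close>

lemma block_act_power_block_vector:
  fixes K :: nat
  assumes l: "l < K" and S': "S' \<subseteq> {..<K}"
  defines "z \<equiv> \<lambda>i. \<Sum>S\<in>Pow {..<K}. of_real (car l S' S) * block_vector K S i"
  shows "block_act (fps_X ^ (2 ^ Suc l)) z (position (K, False, 2 ^ K, S')) = (if l \<in> S' then 1 else 0)"
proof -
  have position_eq: "position \<kappa> = position \<kappa>' \<longleftrightarrow> \<kappa> = \<kappa>'" if "\<kappa> \<in> block_indices" "\<kappa>' \<in> block_indices" for \<kappa> \<kappa>'
    using inj_on_position that by (auto dest: inj_onD)
  have z: "z (position (K, b, n, S)) = (if b \<and> n = 0 then of_real (car l S' S) else 0)"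
    if "n \<le> 2 ^ K" "S \<in> Pow {..<K}" for b n S
  proof -
    have "block_vector K T (position (K, b, n, S)) = (if T = S then if b \<and> n = 0 then 1 else 0 else 0)"
      if "T \<in> Pow {..<K}" for T
      unfolding block_vector_def using that \<open>n \<le> 2 ^ K\<close> \<open>S \<in> Pow {..<K}\<close>
      by (subst position_eq) (auto simp: block_indices_def)
    hence "z (position (K, b, n, S)) = (\<Sum>T\<in>Pow {..<K}. if T = S then of_real (car l S' S) * (if b \<and> n = 0 then 1 else 0) else 0)"
      unfolding z_def by (intro sum.cong) auto
    thus ?thesis using that by simp
  qed
  have F: "coord_fps z K False S = 0" if "S \<in> Pow {..<K}" for S
    using z[OF _ that, of _ False] by (auto simp: coord_fps_def fps_eq_iff)
  have T: "coord_fps z K True S = fps_const (of_real (car l S' S))" if "S \<in> Pow {..<K}" for S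
    using z[OF _ that, of _ True] by (auto simp: coord_fps_def fps_eq_iff)
  define m :: nat where "m = 2 ^ Suc l"
  have "block_act (fps_X ^ m) z (position (K, False, 2 ^ K, S')) = block_act_fps (fps_X ^ m) z K False S' $ (2 ^ K)"
    using S' by (intro block_act_position) (simp add: block_indices_def)
  also have "\<dots> = (fps_deriv (fps_X ^ m) * block_der K (coord_fps z K True) S') $ (2 ^ K)"
    using S' by (simp add: block_act_fps_def F)
  also have "\<dots> = (\<Sum>k<K. if k = l then \<Sum>S\<in>Pow {..<K}. of_real ((car l S' S)\<^sup>2) else 0)"
    unfolding nth_mult_block_der
  proof (intro sum.cong refl)
    fix k assume "k \<in> {..<K}"
    hence "(2::nat) ^ Suc k \<le> 2 ^ K" by (intro power_increasing) auto
    moreover have "1 \<le> (2::nat) ^ Suc k" by (rule one_le_power) simp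
    ultimately have idx: "\<not> 2 ^ K < 2 ^ K - 2 ^ Suc k + (1::nat)" "2 ^ K - (2 ^ K - 2 ^ Suc k + 1) = 2 ^ Suc k - (1::nat)"
      by linarith+
    have coeff: "(fps_deriv (fps_X ^ m) * coord_fps z K True S) $ (2 ^ Suc k - 1) =
        (if k = l then of_nat m * of_real (car l S' S) else 0)" if "S \<in> Pow {..<K}" for S
    proof -
      have "(2::nat) ^ Suc k - 1 = m - 1 \<longleftrightarrow> k = l"
      proof -
        have "(2::nat) ^ Suc k - 1 = m - 1 \<longleftrightarrow> (2::nat) ^ Suc k = 2 ^ Suc l"
          unfolding m_def using \<open>1 \<le> 2 ^ Suc k\<close> one_le_power[of "2::nat" "Suc l"] by linarith
        thus ?thesis by (simp only: power_inject_exp) simp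
      qed
      thus ?thesis using that
        by (simp add: T fps_deriv_power fps_mult_right_const_nth)
    qed
    show "(\<Sum>S\<in>Pow {..<K}. of_real (car k S' S) / 2 ^ Suc k *
        (if 2 ^ K < 2 ^ K - 2 ^ Suc k + (1::nat) then 0 else (fps_deriv (fps_X ^ m) * coord_fps z K True S) $ (2 ^ K - (2 ^ K - 2 ^ Suc k + 1))))
      = (if k = l then \<Sum>S\<in>Pow {..<K}. of_real ((car l S' S)\<^sup>2) else (0::complex))"
    proof (cases "k = l")
      case True
      have "of_real (car k S' S) / 2 ^ Suc k *
        (if 2 ^ K < 2 ^ K - 2 ^ Suc k + (1::nat) then 0 else (fps_deriv (fps_X ^ m) * coord_fps z K True S) $ (2 ^ K - (2 ^ K - 2 ^ Suc k + 1)))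
        = complex_of_real ((car l S' S)\<^sup>2)" if "S \<in> Pow {..<K}" for S
        unfolding idx(2) coeff[OF that] using idx(1) True by (simp add: m_def power2_eq_square)
      thus ?thesis using True by simp
    next
      case False
      have "of_real (car k S' S) / 2 ^ Suc k *
        (if 2 ^ K < 2 ^ K - 2 ^ Suc k + (1::nat) then 0 else (fps_deriv (fps_X ^ m) * coord_fps z K True S) $ (2 ^ K - (2 ^ K - 2 ^ Suc k + 1)))
        = 0" if "S \<in> Pow {..<K}" for S
        unfolding idx(2) coeff[OF that] using False by simp
      thus ?thesis using False by (intro trans[OF sum.neutral]) auto
    qed
  qed
  also have "\<dots> = of_real (\<Sum>S\<in>Pow {..<K}. (car l S' S)\<^sup>2)"
    using l by (simp only: of_real_sum sum.delta[OF finite_lessThan] lessThan_iff if_True)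
  also have "\<dots> = (if l \<in> S' then 1 else 0)"
    by (simp only: car_square_sum[OF S']) simp
  finally show ?thesis unfolding m_def .
qed

text \<open>
  Pair each set with its complement.
\<close>

lemma sum_card_square_Pow: "real K ^ 2 / 4 * 2 ^ K \<le> (\<Sum>S\<in>Pow {..<K}. (real (card S))\<^sup>2)"
proof -
  let ?P = "Pow {..<K}"
  have comp: "(\<Sum>S\<in>?P. (real (card S))\<^sup>2) = (\<Sum>S\<in>?P. (real (card ({..<K} - S)))\<^sup>2)"
    by (intro sum.reindex_bij_witness[of _ "\<lambda>S. {..<K} - S" "\<lambda>S. {..<K} - S"]) (auto simp: double_diff)
  have "(\<Sum>S\<in>?P. (real K)\<^sup>2 / 2) \<le> (\<Sum>S\<in>?P. (real (card S))\<^sup>2 + (real (card ({..<K} - S)))\<^sup>2)"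
  proof (rule sum_mono)
    fix S assume S: "S \<in> ?P"
    hence "finite S" using finite_subset by auto
    hence "card S \<le> K" "card ({..<K} - S) = K - card S"
      using S card_mono[of "{..<K}" S] by (auto simp: card_Diff_subset)
    hence K: "real K = real (card S) + real (card ({..<K} - S))" by simp
    have "0 \<le> (real (card S) - real (card ({..<K} - S)))\<^sup>2" by simp
    thus "(real K)\<^sup>2 / 2 \<le> (real (card S))\<^sup>2 + (real (card ({..<K} - S)))\<^sup>2"
      unfolding K by (simp add: power2_eq_square algebra_simps)
  qed
  also have "\<dots> = 2 * (\<Sum>S\<in>?P. (real (card S))\<^sup>2)"
    unfolding sum.distrib comp[symmetric] by simp
  finally show ?thesis by (simp add: card_Pow mult.commute)
qed

definition disc_action :: "(complex ^ 'd::{finite, linorder} \<Rightarrow> complex) \<Rightarrow> (nat \<Rightarrow> complex) \<Rightarrow> nat \<Rightarrow> complex" where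
  "disc_action f = block_act (fps_expansion (disc_restriction f) 0)"

context
  fixes \<Omega> :: "(complex ^ 'd::{finite, linorder}) set"
  assumes \<Omega>: "function_algebra (closure \<Omega>) (uniform_algebra \<Omega>)"
    and axis: "\<And>a. cmod a < 1 \<Longrightarrow> axis (Max UNIV) a \<in> \<Omega>"
begin

interpretation function_algebra "closure \<Omega>" "uniform_algebra \<Omega>" by (rule \<Omega>)

lemma disc_restriction_holomorphic: "f \<in> uniform_algebra \<Omega> \<Longrightarrow> disc_restriction f holomorphic_on ball 0 1"
  by (rule holomorphic_disc_restriction[OF _ axis])

lemma disc_restriction_le_sup_norm:
  "\<lbrakk>f \<in> uniform_algebra \<Omega>; cmod a < 1\<rbrakk> \<Longrightarrow> cmod (disc_restriction f a) \<le> sup_norm (closure \<Omega>) f"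
  unfolding disc_restriction_def using axis
  by (intro cmod_le_sup_norm continuous) (auto intro: closure_subset[THEN subsetD])

lemma disc_action_top_power: "disc_action (top_power \<Omega> n) = block_act (fps_X ^ n)"
proof -
  have "fps_expansion (disc_restriction (top_power \<Omega> n)) 0 = fps_X ^ n"
  proof (rule fps_expansion_eq_if_eq_on_disc)
    show "(\<lambda>a. a ^ n) has_fps_expansion (fps_X ^ n :: complex fps)"
      by (intro fps_expansion_intros)
    show "disc_restriction (top_power \<Omega> n) a = a ^ n" if "cmod a < 1" for a
      using axis[OF that] closure_subset by (auto simp: disc_restriction_def top_power_def axis_def)
  qed
  thus ?thesis by (simp add: disc_action_def)
qed

lemma top_power_0: "top_power \<Omega> 0 = indicator (closure \<Omega>)"
  by (auto simp: top_power_def fun_eq_iff)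

lemma hilbert_module_disc_action:
  "hilbert_module (closure \<Omega>) (uniform_algebra \<Omega>) (l2_module disc_action)"
proof (rule hilbert_module_l2_module[OF \<Omega>, where C = 33])
  show "disc_action f x \<in> l2" if "f \<in> uniform_algebra \<Omega>" "x \<in> l2" for f x
    unfolding disc_action_def
    by (rule block_act_bound(1)[OF disc_restriction_holomorphic[OF that(1)] disc_restriction_le_sup_norm[OF that(1)] that(2)])
  show "lnorm (disc_action f x) \<le> 33 * sup_norm (closure \<Omega>) f * lnorm x" if "f \<in> uniform_algebra \<Omega>" "x \<in> l2" for f x
    unfolding disc_action_def
    by (rule block_act_bound(2)[OF disc_restriction_holomorphic[OF that(1)] disc_restriction_le_sup_norm[OF that(1)] that(2)])
  show "disc_action (indicator (closure \<Omega>)) x = x" for x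
    using disc_action_top_power[of 0] by (simp add: top_power_0 block_act_one)
  show "disc_action (\<lambda>z. c * f z) x = (\<lambda>i. c * disc_action f x i)" if "f \<in> uniform_algebra \<Omega>" for c f x
    unfolding disc_action_def fps_expansion_disc_restriction_scale[OF disc_restriction_holomorphic[OF that]] by (rule block_act_scale_left)
qed (simp_all add: disc_action_def fps_expansion_disc_restriction_add
    fps_expansion_disc_restriction_mult disc_restriction_holomorphic
    block_act_add_left block_act_add_right block_act_scale_right block_act_mult)

text \<open>
  Pulling the inner product of a contractive module back along a similarity makes the powers of the
  coordinate a contractive semigroup, so \<open>car_von_neumann\<close> bounds the vectors \<open>y\<close> below. Their
  coordinates \<open>card S'\<close> in block \<open>K\<close> are of average size \<open>K/2\<close>, which bounds \<open>K\<close> in terms of the constants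
  of the similarity.
\<close>

lemma not_cramped_disc_action:
  assumes top: "\<And>n z. cmod (top_power \<Omega> n z) \<le> 1"
  shows "\<not> cramped (closure \<Omega>) (uniform_algebra \<Omega>) (l2_module disc_action)"
proof
  let ?A = "uniform_algebra \<Omega>" and ?H = "l2_module disc_action :: ((complex, 'd) vec \<Rightarrow> complex, nat \<Rightarrow> complex) hmodule"
  assume "cramped (closure \<Omega>) ?A ?H"
  then obtain W :: "((complex, 'd) vec \<Rightarrow> complex, nat \<Rightarrow> complex) hmodule" and T S where
    W: "contractive_hilbert_module (closure \<Omega>) ?A W" and
    T: "module_map ?A ?H W T" and S: "module_map ?A W ?H S" and
    ST: "\<And>x. x \<in> l2 \<Longrightarrow> S (T x) = x"
    unfolding cramped_def similar_def by auto
  interpret W: contractive_hilbert_module "closure \<Omega>" ?A W by (rule W)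
  have T_carr: "T x \<in> carrier W" if "x \<in> l2" for x
    using T that unfolding module_map_def by auto
  have T_add: "T (\<lambda>i. x i + y i) = T x \<oplus>\<^bsub>W\<^esub> T y" if "x \<in> l2" "y \<in> l2" for x y
    using T that unfolding module_map_def by auto
  have T_smult: "T (\<lambda>i. c * x i) = c \<odot>\<^bsub>W\<^esub> T x" if "x \<in> l2" for c x
    using T that unfolding module_map_def by auto
  have T_act: "T (disc_action f x) = act W f (T x)" if "f \<in> ?A" "x \<in> l2" for f x
    using T that unfolding module_map_def by auto
  have "\<exists>C. \<forall>x\<in>l2. hnorm W (T x) \<le> C * hnorm ?H x"
    using T unfolding module_map_def l2_module_simps by (elim conjE)
  then obtain C where "\<And>x. x \<in> l2 \<Longrightarrow> hnorm W (T x) \<le> C * hnorm ?H x"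
    by blast
  hence C: "hnorm W (T x) \<le> C * lnorm x" if "x \<in> l2" for x
    using that by (simp add: hnorm_l2_module)
  obtain D where D: "\<And>y. y \<in> carrier W \<Longrightarrow> hnorm ?H (S y) \<le> D * hnorm W y"
    using S unfolding module_map_def by blast
  define \<phi> where "\<phi> x y = cinner W (T x) (T y)" for x y
  define \<tau> where "\<tau> n = block_act (fps_X ^ n)" for n
  have \<tau>: "\<tau> n = disc_action (top_power \<Omega> n)" for n
    by (simp add: \<tau>_def disc_action_top_power)
  have \<tau>_l2: "\<tau> n x \<in> l2" if "x \<in> l2" for n x
    unfolding \<tau> disc_action_def
    by (rule block_act_bound(1)[OF disc_restriction_holomorphic[OF top_power_in_uniform_algebra]
          disc_restriction_le_sup_norm[OF top_power_in_uniform_algebra] that])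
  have \<phi>_norm: "Re (\<phi> x x) = (hnorm W (T x))\<^sup>2" if "x \<in> l2" for x
    using W.cinner_self[OF T_carr[OF that]] by (simp add: \<phi>_def)
  interpret contractive_semigroup \<phi> \<tau>
  proof
    fix x y z :: "nat \<Rightarrow> complex" and c :: complex and m n :: nat
    assume x: "x \<in> l2"
    show "\<phi> (\<lambda>i. x i + y i) z = \<phi> x z + \<phi> y z" if "y \<in> l2" "z \<in> l2"
      using x that by (simp add: \<phi>_def T_add W.cinner_add_left T_carr)
    show "\<phi> (\<lambda>i. c * x i) z = c * \<phi> x z" if "z \<in> l2"
      using x that by (simp add: \<phi>_def T_smult W.cinner_smult_left T_carr)
    show "\<phi> z x = cnj (\<phi> x z)" if "z \<in> l2"
      unfolding \<phi>_def by (rule W.cinner_commute[OF T_carr[OF x] T_carr[OF that]])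
    show "0 \<le> Re (\<phi> x x)"
      unfolding \<phi>_def by (rule W.cinner_nonneg[OF T_carr[OF x]])
    show "\<tau> n x \<in> l2" by (rule \<tau>_l2[OF x])
    show "\<tau> n (\<lambda>i. x i + y i) = (\<lambda>i. \<tau> n x i + \<tau> n y i)" if "y \<in> l2"
      unfolding \<tau>_def by (rule block_act_add_right)
    show "\<tau> n (\<lambda>i. c * x i) = (\<lambda>i. c * \<tau> n x i)"
      unfolding \<tau>_def by (rule block_act_scale_right)
    show "\<tau> 0 x = x" by (simp add: \<tau>_def block_act_one)
    show "\<tau> (m + n) x = \<tau> m (\<tau> n x)" by (simp add: \<tau>_def power_add block_act_mult)
    have "hnorm W (T (\<tau> n x)) \<le> sup_norm (closure \<Omega>) (top_power \<Omega> n) * hnorm W (T x)"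
      unfolding \<tau> T_act[OF top_power_in_uniform_algebra x]
      by (rule W.contractive[OF top_power_in_uniform_algebra T_carr[OF x]])
    also have "\<dots> \<le> 1 * hnorm W (T x)"
      by (intro mult_right_mono sup_norm_le top W.hnorm_nonneg T_carr x)
    finally show "Re (\<phi> (\<tau> n x) (\<tau> n x)) \<le> Re (\<phi> x x)"
      unfolding \<phi>_norm[OF x] \<phi>_norm[OF \<tau>_l2[OF x]]
      by (intro power_mono W.hnorm_nonneg T_carr \<tau>_l2 x) simp
  qed
  have bound: "real K \<le> 4 * D\<^sup>2 * C\<^sup>2" if K: "K > 0" for K :: nat
  proof -
    let ?P = "Pow {..<K}"
    define u where "u = block_vector K"
    define \<xi> where "\<xi> l S' = lincomb ?P (\<lambda>S. of_real (car l S' S)) u" for l S'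
    define y where "y S' = lincomb {..<K} (\<lambda>_. 1) (\<lambda>l. \<tau> (2 ^ Suc l) (\<xi> l S'))" for S'
    have u: "u S \<in> l2" for S by (simp add: u_def block_vector_l2)
    have \<xi>: "\<xi> l S' \<in> l2" for l S' unfolding \<xi>_def by (intro lincomb_closed u) simp
    have y: "y S' \<in> l2" for S' unfolding y_def by (intro lincomb_closed \<tau>_l2 \<xi>) simp
    have "mono (\<lambda>l. 2 ^ Suc l :: nat)"
      by (intro monoI power_increasing) auto
    hence vN: "(\<Sum>S'\<in>?P. Re (\<phi> (y S') (y S'))) \<le> real K * (\<Sum>S\<in>?P. Re (\<phi> (u S) (u S)))"
      unfolding y_def \<xi>_def by (rule car_von_neumann[OF u])
    have upper: "Re (\<phi> (u S) (u S)) \<le> C\<^sup>2" for S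
    proof -
      have "hnorm W (T (u S)) \<le> \<bar>C\<bar> * lnorm (u S)"
        using C[OF u, of S] mult_right_mono[of C "\<bar>C\<bar>" "lnorm (u S)"] lnorm_nonneg[OF u, of S] by linarith
      also have "\<dots> \<le> \<bar>C\<bar> * 1"
        unfolding u_def by (intro mult_left_mono block_vector_l2) simp
      finally have "(hnorm W (T (u S)))\<^sup>2 \<le> \<bar>C\<bar>\<^sup>2"
        by (intro power_mono W.hnorm_nonneg T_carr u) simp
      thus ?thesis by (simp add: \<phi>_norm u)
    qed
    have lower: "(real (card S'))\<^sup>2 \<le> D\<^sup>2 * Re (\<phi> (y S') (y S'))" if S': "S' \<in> ?P" for S'
    proof -
      have "y S' (position (K, False, 2 ^ K, S')) = (\<Sum>l<K. \<tau> (2 ^ Suc l) (\<xi> l S') (position (K, False, 2 ^ K, S')))"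
        by (simp add: y_def lincomb_def)
      also have "\<dots> = (\<Sum>l<K. if l \<in> S' then 1 else 0)"
        unfolding \<tau>_def \<xi>_def lincomb_def u_def using S'
        by (intro sum.cong refl block_act_power_block_vector) auto
      also have "\<dots> = of_nat (card S')"
      proof -
        have "{..<K} \<inter> S' = S'" using S' by auto
        thus ?thesis by (simp flip: sum.inter_restrict)
      qed
      finally have "real (card S') \<le> lnorm (y S')"
        using cmod_le_lnorm[OF y, of S' "position (K, False, 2 ^ K, S')"] by simp
      also have "\<dots> = hnorm ?H (S (T (y S')))"
        by (simp add: ST y hnorm_l2_module)
      also have "\<dots> \<le> D * hnorm W (T (y S'))"
        by (rule D[OF T_carr[OF y]])
      finally have "(real (card S'))\<^sup>2 \<le> (D * hnorm W (T (y S')))\<^sup>2"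
        by (intro power_mono) auto
      thus ?thesis by (simp add: power_mult_distrib \<phi>_norm y)
    qed
    have "real K ^ 2 / 4 * 2 ^ K \<le> (\<Sum>S\<in>?P. (real (card S))\<^sup>2)"
      by (rule sum_card_square_Pow)
    also have "\<dots> \<le> (\<Sum>S\<in>?P. D\<^sup>2 * Re (\<phi> (y S) (y S)))"
      by (intro sum_mono lower)
    also have "\<dots> \<le> D\<^sup>2 * (real K * (\<Sum>S\<in>?P. Re (\<phi> (u S) (u S))))"
      unfolding sum_distrib_left[symmetric] by (intro mult_left_mono vN) simp
    also have "\<dots> \<le> D\<^sup>2 * (real K * (\<Sum>S\<in>?P. C\<^sup>2))"
      by (intro mult_left_mono sum_mono upper) auto
    also have "\<dots> = D\<^sup>2 * C\<^sup>2 * real K * 2 ^ K"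
      by (simp add: card_Pow mult_ac)
    finally have "real K ^ 2 / 4 \<le> D\<^sup>2 * C\<^sup>2 * real K"
      by (rule mult_right_le_imp_le) simp
    thus ?thesis using K by (simp add: power2_eq_square)
  qed
  obtain n :: nat where n: "4 * D\<^sup>2 * C\<^sup>2 < real n" using reals_Archimedean2 by blast
  have "0 \<le> 4 * D\<^sup>2 * C\<^sup>2" by simp
  hence "0 < real n" using n by linarith
  hence "n > 0" by simp
  from bound[OF this] n show False by simp
qed

end

theorem theorem5p1:
  fixes m t d :: nat and \<Omega> :: "(complex ^ 'd::{finite, linorder}) set"
  assumes "m > 0" and "t > 0" and "t dvd m"
    and "d = CARD('d)" and "d > 1"
    and "\<Omega> = basic_map m t ` polydisc"
  shows "\<exists>H :: ((complex, 'd) vec \<Rightarrow> complex, nat \<Rightarrow> complex) hmodule.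
    hilbert_module (closure \<Omega>) (uniform_algebra \<Omega>) H \<and>
    \<not> cramped (closure \<Omega>) (uniform_algebra \<Omega>) H"
proof -
  have alg: "function_algebra (closure \<Omega>) (uniform_algebra \<Omega>)"
    using function_algebra_basic_map_polydisc[of m t] assms(6) by simp
  have axis: "axis (Max UNIV) a \<in> \<Omega>" if "cmod a < 1" for a
    using axis_in_basic_map_image[OF assms(1-3) that] assms(6) by simp
  show ?thesis
    using hilbert_module_disc_action[OF alg axis] not_cramped_disc_action[OF alg axis cmod_top_power_le[OF assms(6)]]
    by blast
qed

end
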